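(* Let $\mathbb{D}\subset\mathbb{C}$ be a simply connected domain with coordinate $z$ and let $f:\mathbb{D}\to Q_2^*$ be a conformal minimal Lagrangian immersion with induced metric $2e^u\,\mathrm{d}z\,\mathrm{d}\bar z$ and holomorphic quadratic differential $\hat\alpha\,\mathrm{d}z^2$, where $\hat\alpha=\langle\hat{\mathfrak f}_z,\hat{\mathfrak f}_z\rangle$ for a normalized horizontal lift $\hat{\mathfrak f}$ of $f$. Then there exists an $\mathbb{S}^1$-family of minimal Lagrangian immersions $\{f^\lambda\}_{\lambda\in\mathbb{S}^1}$, $f^\lambda:\mathbb{D}\to Q_2^*$, with the same induced metric $2e^u\,\mathrm{d}z\,\mathrm{d}\bar z$ and with holomorphic quadratic differential $\hat\alpha^\lambda\,\mathrm{d}z^2=\lambda^{-2}\hat\alpha\,\mathrm{d}z^2$.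
   Context: On $\mathbb{C}^4_2=\mathbb{C}^4$ let $\langle \boldsymbol z,\boldsymbol w\rangle=-z_1w_1-z_2w_2+z_3w_3+z_4w_4$ (complex bilinear) and let $(\boldsymbol z,\boldsymbol w)=\langle \boldsymbol z,\overline{\boldsymbol w}\rangle$ be the indefinite Hermitian form. Put $\mathbb{H}^7_3(-1)=\{\boldsymbol z : (\boldsymbol z,\boldsymbol z)=-1\}$ and $\mathbb{CH}^3_1=\{[\boldsymbol z]\in\mathbb{C}P^3 : (\boldsymbol z,\boldsymbol z)<0\}$. The indefinite Hopf fibration $\pi:\mathbb{H}^7_3(-1)\to\mathbb{CH}^3_1$ is a pseudo-Riemannian submersion (with respect to $\mathrm{Re}(\cdot,\cdot)$), which defines the indefinite Kähler structure of $\mathbb{CH}^3_1$. $Q_2^*$ is a fixed connected component of $\{[\boldsymbol z]\in\mathbb{CH}^3_1 : \langle \boldsymbol z,\boldsymbol z\rangle=0\}$ with the induced Kähler structure (its metric is positive definite). An immersion of a surface into $Q_2^*$ is Lagrangian if the Kähler form pulls back to $0$, and minimal if its mean curvature vector vanishes. A horizontal lift of $f$ is a smooth $\mathfrak{f}:\mathbb{D}\to\mathbb{H}^7_3(-1)$ with $\pi\circ\mathfrak{f}=f$ and $\langle \mathfrak{f}_z,\overline{\mathfrak{f}}\rangle=\langle \mathfrak{f}_{\bar z},\overline{\mathfrak{f}}\rangle=0$; it is unique up to a constant unitary factor. For a minimal Lagrangian $f$ the argument $\varphi$ of $\beta=\langle\mathfrak f_z,\mathfrak f_{\bar z}\rangle$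 is constant, in the sense that $\beta=e^{i\varphi}|\beta|$ on the domain considered, and the normalized horizontal lift is $\hat{\mathfrak f}=e^{-i\varphi/2}\mathfrak f$; it satisfies $\hat\beta:=\langle\hat{\mathfrak f}_z,\hat{\mathfrak f}_{\bar z}\rangle=|\beta|\ge0$. The holomorphic quadratic differential of a minimal Lagrangian surface is $\langle\hat{\mathfrak f}_z,\hat{\mathfrak f}_z\rangle\,\mathrm{d}z^2$; $\hat\alpha^\lambda$ is the corresponding quantity for $f^\lambda$. *)

theory Defs
  imports "HOL-Analysis.Analysis"
begin

section \<open>The space \<open>\<complex>\<^sup>4\<^sub>2\<close>\<close>

definition bil :: "complex^4 \<Rightarrow> complex^4 \<Rightarrow> complex" where
  "bil z w = - z$1 * w$1 - z$2 * w$2 + z$3 * w$3 + z$4 * w$4"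

definition cnj_vec :: "complex^4 \<Rightarrow> complex^4" where
  "cnj_vec w = (\<chi> i. cnj (w$i))"

definition herm :: "complex^4 \<Rightarrow> complex^4 \<Rightarrow> complex" where
  "herm z w = bil z (cnj_vec w)"

definition metric :: "complex^4 \<Rightarrow> complex^4 \<Rightarrow> real" where
  "metric z w = Re (herm z w)"

definition H73 :: "(complex^4) set" where
  "H73 = {z. herm z z = -1}"

text \<open>Orthogonal projection with respect to the indefinite inner product \<^const>\<open>metric\<close>.
  It is only applied to real subspaces on which \<^const>\<open>metric\<close> is nondegenerate, where the
  description is satisfied by exactly one vector.\<close>

definition oproj :: "(complex^4) set \<Rightarrow> complex^4 \<Rightarrow> complex^4" where
  "oproj S X = (THE Y. Y \<in> S \<and> (\<forall>Z\<in>S. metric (X - Y) Z = 0))"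


section \<open>Projective space and the quadric\<close>

text \<open>Points of \<open>\<complex>P\<^sup>3\<close> are the complex lines through the origin of \<open>\<complex>\<^sup>4\<close>;
  the restriction of \<open>cline\<close> to \<^const>\<open>H73\<close> is the Hopf fibration.\<close>

definition cline :: "complex^4 \<Rightarrow> (complex^4) set" where
  "cline z = vec.span {z}"

definition CP3 :: "(complex^4) set set" where
  "CP3 = cline ` (- {0})"

definition CP3_topology :: "(complex^4) set topology" where
  "CP3_topology = topology (\<lambda>U. U \<subseteq> CP3 \<and> open {z. z \<noteq> 0 \<and> cline z \<in> U})"

lemma openin_CP3_topology:
  "openin CP3_topology U \<longleftrightarrow> U \<subseteq> CP3 \<and> open {z. z \<noteq> 0 \<and> cline z \<in> U}"
proof -
  have "istopology (\<lambda>U. U \<subseteq> CP3 \<and> open {z. z \<noteq> 0 \<and> cline z \<in> U})"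
    unfolding istopology_def
  proof (intro conjI allI impI)
    fix S T assume "S \<subseteq> CP3 \<and> open {z. z \<noteq> 0 \<and> cline z \<in> S}"
      and "T \<subseteq> CP3 \<and> open {z. z \<noteq> 0 \<and> cline z \<in> T}"
    then have "open ({z. z \<noteq> 0 \<and> cline z \<in> S} \<inter> {z. z \<noteq> 0 \<and> cline z \<in> T})"
      by blast
    moreover have "{z. z \<noteq> 0 \<and> cline z \<in> S} \<inter> {z. z \<noteq> 0 \<and> cline z \<in> T}
        = {z. z \<noteq> 0 \<and> cline z \<in> S \<inter> T}" by auto
    ultimately show "open {z. z \<noteq> 0 \<and> cline z \<in> S \<inter> T}" by simp
  next
    fix \<K> assume K: "\<forall>K\<in>\<K>. K \<subseteq> CP3 \<and> open {z. z \<noteq> 0 \<and> cline z \<in> K}"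
    then have "open (\<Union>K\<in>\<K>. {z. z \<noteq> 0 \<and> cline z \<in> K})" by blast
    moreover have "(\<Union>K\<in>\<K>. {z. z \<noteq> 0 \<and> cline z \<in> K}) = {z. z \<noteq> 0 \<and> cline z \<in> \<Union>\<K>}"
      by auto
    ultimately show "open {z. z \<noteq> 0 \<and> cline z \<in> \<Union>\<K>}" by simp
  qed auto
  then show ?thesis
    unfolding CP3_topology_def by (simp add: topology_inverse')
qed

definition CH31 :: "(complex^4) set set" where
  "CH31 = {cline z | z. Re (herm z z) < 0}"

definition is_Q2star :: "(complex^4) set set \<Rightarrow> bool" where
  "is_Q2star Q \<longleftrightarrow> Q \<in> connected_components_of
     (subtopology CP3_topology {L \<in> CH31. \<forall>z\<in>L. bil z z = 0})"


section \<open>Smooth maps\<close>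

text \<open>To be used on open sets only.\<close>

primrec Ck_on :: "nat \<Rightarrow> complex set \<Rightarrow> (complex \<Rightarrow> 'a::real_normed_vector) \<Rightarrow> bool" where
  "Ck_on 0 S f \<longleftrightarrow> continuous_on S f"
| "Ck_on (Suc k) S f \<longleftrightarrow> (\<forall>p\<in>S. f differentiable (at p)) \<and>
     (\<forall>v. Ck_on k S (\<lambda>p. frechet_derivative f (at p) v))"

definition Cinf_on :: "complex set \<Rightarrow> (complex \<Rightarrow> 'a::real_normed_vector) \<Rightarrow> bool" where
  "Cinf_on S f \<longleftrightarrow> (\<forall>k. Ck_on k S f)"

text \<open>The affine charts \<open>[z] \<mapsto> z / z\<^sub>j\<close>; their values lie in the copy \<open>{v. v$j = 1}\<close> of
  \<open>\<complex>\<^sup>3\<close>.\<close>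

definition chart_dom :: "4 \<Rightarrow> (complex^4) set set" where
  "chart_dom j = {L \<in> CP3. \<exists>v\<in>L. v$j \<noteq> 0}"

definition chart :: "4 \<Rightarrow> (complex^4) set \<Rightarrow> complex^4" where
  "chart j L = (THE v. v \<in> L \<and> v$j = 1)"

definition smooth_into_CP3 :: "complex set \<Rightarrow> (complex \<Rightarrow> (complex^4) set) \<Rightarrow> bool" where
  "smooth_into_CP3 D f \<longleftrightarrow> f ` D \<subseteq> CP3 \<and>
     (\<forall>j. open {p\<in>D. f p \<in> chart_dom j} \<and>
          Cinf_on {p\<in>D. f p \<in> chart_dom j} (\<lambda>p. chart j (f p)))"


section \<open>Geometry of the submersion\<close>

text \<open>The horizontal space at \<open>v \<in> H73\<close>: the tangent vectors of \<^const>\<open>H73\<close> at \<open>v\<close>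
  (first condition) orthogonal to the fibre direction \<open>\<i>v\<close> (second condition).\<close>

definition horizontal :: "complex^4 \<Rightarrow> (complex^4) set" where
  "horizontal v = {X. metric X v = 0 \<and> metric X (\<i> *s v) = 0}"

text \<open>Horizontal lift to \<open>v\<close> of the tangent space of the quadric at \<open>[v]\<close>;
  the extra equation is the differential of \<open>bil z z = 0\<close>.\<close>

definition horizontal_Q :: "complex^4 \<Rightarrow> (complex^4) set" where
  "horizontal_Q v = {X \<in> horizontal v. bil X v = 0}"

text \<open>Geometric quantities of \<open>f\<close> at \<open>p\<close> are computed from a smooth local lift \<open>F\<close> to
  \<^const>\<open>H73\<close> whose differential at the single point \<open>p\<close> is horizontal. Such lifts always exist
  for a smooth \<open>f\<close> into \<^const>\<open>CH31\<close>, and two of them differ by a smooth unitary factor with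
  vanishing derivative at \<open>p\<close>. Hence the real-valued quantities below do not depend on the choice,
  and the vector-valued ones, which are horizontal lifts to \<open>F p\<close> of tangent vectors at \<open>f p\<close>,
  only change by the constant unitary factor relating the two base points in the fibre.\<close>

definition is_lift_at :: "(complex \<Rightarrow> (complex^4) set) \<Rightarrow> complex \<Rightarrow> (complex \<Rightarrow> complex^4) \<Rightarrow> bool"
  where
  "is_lift_at f p F \<longleftrightarrow> (\<exists>U. open U \<and> p \<in> U \<and> Cinf_on U F \<and>
     (\<forall>q\<in>U. F q \<in> H73 \<and> cline (F q) = f q)) \<and>
     (\<forall>v. frechet_derivative F (at p) v \<in> horizontal (F p))"

definition lift_at :: "(complex \<Rightarrow> (complex^4) set) \<Rightarrow> complex \<Rightarrow> complex \<Rightarrow> complex^4" where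
  "lift_at f p = (SOME F. is_lift_at f p F)"

text \<open>The horizontal lift to \<open>F q\<close> of \<open>df\<^sub>q(v)\<close>, where \<open>f = [F]\<close>.\<close>

definition hdiff :: "(complex \<Rightarrow> complex^4) \<Rightarrow> complex \<Rightarrow> complex \<Rightarrow> complex^4" where
  "hdiff F q v = oproj (horizontal (F q)) (frechet_derivative F (at q) v)"

definition induced_metric :: "(complex \<Rightarrow> (complex^4) set) \<Rightarrow> complex \<Rightarrow> complex \<Rightarrow> complex \<Rightarrow> real"
  where
  "induced_metric f p v w =
     metric (hdiff (lift_at f p) p v) (hdiff (lift_at f p) p w)"

definition induced_Kaehler_form ::
    "(complex \<Rightarrow> (complex^4) set) \<Rightarrow> complex \<Rightarrow> complex \<Rightarrow> complex \<Rightarrow> real" where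
  "induced_Kaehler_form f p v w =
     metric (\<i> *s hdiff (lift_at f p) p v) (hdiff (lift_at f p) p w)"

text \<open>Horizontal lift of \<open>\<nabla>\<^sub>v(df(w))\<close> at \<open>p\<close>, with \<open>v\<close>, \<open>w\<close> constant vector fields on the
  domain and \<open>\<nabla>\<close> the Levi-Civita connection of the quadric. For a submersion from a submanifold
  of a flat space, the Levi-Civita connection of the base is the horizontal part of the flat
  derivative of horizontally lifted fields along horizontal directions; that of the quadric is its
  tangential part. Both projections are combined into one, and the differentiation direction is
  horizontal because \<^const>\<open>lift_at\<close> is horizontal at \<open>p\<close>.\<close>

definition cov_deriv ::
    "(complex \<Rightarrow> (complex^4) set) \<Rightarrow> complex \<Rightarrow> complex \<Rightarrow> complex \<Rightarrow> complex^4" where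
  "cov_deriv f p v w = (let F = lift_at f p in
     oproj (horizontal_Q (F p)) (frechet_derivative (\<lambda>q. hdiff F q w) (at p) v))"

definition second_fundamental_form ::
    "(complex \<Rightarrow> (complex^4) set) \<Rightarrow> complex \<Rightarrow> complex \<Rightarrow> complex \<Rightarrow> complex^4" where
  "second_fundamental_form f p v w =
     cov_deriv f p v w - oproj (range (hdiff (lift_at f p) p)) (cov_deriv f p v w)"

text \<open>Half the trace of the second fundamental form with respect to the induced metric, written
  in the coordinate frame \<open>1, \<i>\<close> of the domain.\<close>

definition mean_curvature :: "(complex \<Rightarrow> (complex^4) set) \<Rightarrow> complex \<Rightarrow> complex^4" where
  "mean_curvature f p = (let
     g11 = induced_metric f p 1 1; g12 = induced_metric f p 1 \<i>; g22 = induced_metric f p \<i> \<i>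
     in (1 / (2 * (g11 * g22 - g12\<^sup>2))) *\<^sub>R
        (g22 *\<^sub>R second_fundamental_form f p 1 1
         - (2 * g12) *\<^sub>R second_fundamental_form f p 1 \<i>
         + g11 *\<^sub>R second_fundamental_form f p \<i> \<i>))"

definition immersion_on :: "complex set \<Rightarrow> (complex \<Rightarrow> (complex^4) set) \<Rightarrow> bool" where
  "immersion_on D f \<longleftrightarrow> smooth_into_CP3 D f \<and> (\<forall>p\<in>D. inj (hdiff (lift_at f p) p))"

definition lagrangian_on :: "complex set \<Rightarrow> (complex \<Rightarrow> (complex^4) set) \<Rightarrow> bool" where
  "lagrangian_on D f \<longleftrightarrow> (\<forall>p\<in>D. \<forall>v w. induced_Kaehler_form f p v w = 0)"

definition minimal_on :: "complex set \<Rightarrow> (complex \<Rightarrow> (complex^4) set) \<Rightarrow> bool" where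
  "minimal_on D f \<longleftrightarrow> (\<forall>p\<in>D. mean_curvature f p = 0)"

definition minimal_lagrangian_immersion ::
    "complex set \<Rightarrow> (complex^4) set set \<Rightarrow> (complex \<Rightarrow> (complex^4) set) \<Rightarrow> bool" where
  "minimal_lagrangian_immersion D Q f \<longleftrightarrow>
     f ` D \<subseteq> Q \<and> immersion_on D f \<and> lagrangian_on D f \<and> minimal_on D f"

text \<open>The induced metric is \<open>2e\<^sup>u dz d\<zeta>\<close> with \<open>\<zeta>\<close> the conjugate of \<open>z\<close>, that is,
  \<open>2e\<^sup>u (dx\<^sup>2 + dy\<^sup>2)\<close>; the inner product on the right is the Euclidean one of the domain.
  In particular this expresses conformality.\<close>

definition has_induced_metric ::
    "complex set \<Rightarrow> (complex \<Rightarrow> (complex^4) set) \<Rightarrow> (complex \<Rightarrow> real) \<Rightarrow> bool" where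
  "has_induced_metric D f u \<longleftrightarrow>
     (\<forall>p\<in>D. \<forall>v w. induced_metric f p v w = 2 * exp (u p) * (v \<bullet> w))"


section \<open>Horizontal lifts and the quadratic differential\<close>

definition d_z :: "(complex \<Rightarrow> complex^4) \<Rightarrow> complex \<Rightarrow> complex^4" where
  "d_z F p = (1/2) *s (frechet_derivative F (at p) 1 - \<i> *s frechet_derivative F (at p) \<i>)"

definition d_zbar :: "(complex \<Rightarrow> complex^4) \<Rightarrow> complex \<Rightarrow> complex^4" where
  "d_zbar F p = (1/2) *s (frechet_derivative F (at p) 1 + \<i> *s frechet_derivative F (at p) \<i>)"

definition horizontal_lift ::
    "complex set \<Rightarrow> (complex \<Rightarrow> (complex^4) set) \<Rightarrow> (complex \<Rightarrow> complex^4) \<Rightarrow> bool" where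
  "horizontal_lift D f F \<longleftrightarrow> Cinf_on D F \<and>
     (\<forall>p\<in>D. F p \<in> H73 \<and> cline (F p) = f p \<and>
        bil (d_z F p) (cnj_vec (F p)) = 0 \<and> bil (d_zbar F p) (cnj_vec (F p)) = 0)"

definition beta :: "(complex \<Rightarrow> complex^4) \<Rightarrow> complex \<Rightarrow> complex" where
  "beta F p = bil (d_z F p) (d_zbar F p)"

definition alpha :: "(complex \<Rightarrow> complex^4) \<Rightarrow> complex \<Rightarrow> complex" where
  "alpha F p = bil (d_z F p) (d_z F p)"

definition normalized_horizontal_lift ::
    "complex set \<Rightarrow> (complex \<Rightarrow> (complex^4) set) \<Rightarrow> (complex \<Rightarrow> complex^4) \<Rightarrow> bool" where
  "normalized_horizontal_lift D f Fhat \<longleftrightarrow>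
     (\<exists>F \<phi>. horizontal_lift D f F \<and>
        (\<forall>p\<in>D. beta F p = cis \<phi> * of_real (cmod (beta F p))) \<and>
        Fhat = (\<lambda>p. cis (- \<phi> / 2) *s F p))"

text \<open>\<open>a dz\<^sup>2\<close> is the holomorphic quadratic differential of \<open>f\<close>. Normalized lifts are unique up to
  sign, so that \<open>a\<close> is unique, unless \<^const>\<open>beta\<close> vanishes identically; in that case \<open>\<phi>\<close> is
  arbitrary and \<open>a\<close> is determined only up to the choice of this constant.\<close>

definition has_quadratic_differential ::
    "complex set \<Rightarrow> (complex \<Rightarrow> (complex^4) set) \<Rightarrow> (complex \<Rightarrow> complex) \<Rightarrow> bool" where
  "has_quadratic_differential D f a \<longleftrightarrow>
     (\<exists>Fhat. normalized_horizontal_lift D f Fhat \<and> (\<forall>p\<in>D. a p = alpha Fhat p))"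

end

theory Submission
  imports Defs "HOL-Complex_Analysis.Riemann_Mapping"
begin

text \<open>Let \<open>F\<close> be a normalized horizontal lift and \<open>P\<close> the complex plane spanned by \<open>F\<close> and its conjugate.
  Then \<open>dF\<close> is orthogonal to \<open>P\<close>, the Laplacian of \<open>F\<close> lies in \<open>P\<close> by minimality and conformality,
  and \<open>(dF(v), dF(w))\<close> is real by the Lagrangian condition. For the one-form \<open>B\<close> with values in the real
  skew endomorphisms of \<open>\<complex>\<^sup>4\<^sub>2\<close>, namely \<open>-\<sigma>d\<sigma> / 2\<close> for the reflection \<open>\<sigma>\<close> that is \<open>-1\<close> on \<open>P\<close>
  and \<open>1\<close> on its orthogonal complement, these properties say that \<open>v \<mapsto> B(v) - B(v / \<mu>)\<close> is a flat
  connection for every unit \<open>\<mu>\<close>. Its parallel frames form a map \<open>\<Phi>\<close> into the real orthogonal group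
  such that \<open>d(\<Phi> F)(v) = \<Phi> (dF(v / \<mu>))\<close>. So \<open>[\<Phi> F]\<close> has the metric of \<open>f\<close>, is again Lagrangian and
  harmonic, and its quadratic differential is multiplied by \<open>\<mu>\<^sup>-\<^sup>2\<close>.\<close>

section \<open>Flat connections on simply connected domains\<close>

text \<open>On the quadric, the real and imaginary parts of \<open>F p\<close> span a negative
  definite real plane whose complexification is \<open>P\<close>. The target is thus a symmetric
  space of planes, and the construction is the associated family of a harmonic map. Write the flat
  derivative as \<open>\<nabla> + B\<close>, where \<open>\<nabla>\<close> preserves
  \<open>P\<close> and its complement while \<open>B\<close> exchanges them. Its curvature has a
  part that preserves the splitting, the curvature of \<open>\<nabla>\<close> plus a term quadratic
  in \<open>B\<close>, and a part that exchanges the summands, the \<open>\<nabla>\<close>-exterior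
  derivative of \<open>B\<close>. Replacing \<open>B(v)\<close> by \<open>B(v / \<mu>)\<close>
  rotates the domain. The quadratic term is a 2-form, so a rotation leaves it unchanged; the
  exchanging part acquires a multiple of the Laplacian, which harmonicity removes. The Lagrangian
  condition removes the rotation of \<open>P\<close> from the commutators of \<open>B\<close>, in
  agreement with a lift that is horizontal. The conditions on a lift only place the new surface in
  the quadric, whereas \<open>Q\<close> is one component of it. The frame is therefore normalized at
  a base point: there both surfaces pass through the same point, and connectedness does the
  rest.\<close>

text \<open>Picard iteration, organized as a series: the increments \<open>X n\<close> are dominated
  by the terms of an exponential series, so they sum uniformly on all of \<open>{0..1}\<close> at
  once, and short-time solutions need not be continued.\<close>

lemma linear_ode_exists:
  fixes a :: "real \<Rightarrow> 'a::banach \<Rightarrow>\<^sub>L 'a"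
  assumes a: "continuous_on {0..1} a"
  obtains x where "x 0 = x0"
    and "\<And>t. t \<in> {0..1} \<Longrightarrow> (x has_vector_derivative a t (x t)) (at t within {0..1})"
proof -
  have "compact (a ` {0..1})"
    using a by (intro compact_continuous_image) auto
  then obtain M where M: "M > 0" "\<And>t. t \<in> {0..1} \<Longrightarrow> norm (a t) \<le> M"
    by (auto dest!: compact_imp_bounded simp: bounded_pos)
  define X where "X = rec_nat (\<lambda>_. x0) (\<lambda>_ y t. integral {0..t} (\<lambda>s. a s (y s)))"
  have X0: "X 0 = (\<lambda>_. x0)" and XS: "X (Suc n) = (\<lambda>t. integral {0..t} (\<lambda>s. a s (X n s)))" for n
    by (simp_all add: X_def)
  have cX: "continuous_on {0..1} (X n)" for n
  proof (induction n)
    case (Suc n)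
    have "continuous_on {0..1} (\<lambda>s. a s (X n s))"
      by (intro continuous_intros a Suc)
    then have "(X (Suc n) has_vector_derivative a t (X n t)) (at t within {0..1})" if "t \<in> {0..1}" for t
      unfolding XS using that by (rule integral_has_vector_derivative)
    then show ?case
      by (meson continuous_on_eq_continuous_within has_vector_derivative_continuous)
  qed (simp add: X0)
  have caX: "continuous_on {0..1} (\<lambda>s. a s (X n s))" for n
    by (intro continuous_intros a cX)
  have nX: "norm (X n t) \<le> norm x0 * ((M * t) ^ n /\<^sub>R fact n)" if "t \<in> {0..1}" for n t
    using that
  proof (induction n arbitrary: t)
    case (Suc n)
    have sub: "{0..t} \<subseteq> {0..1}" using Suc.prems by auto
    let ?g = "\<lambda>s. M * (norm x0 * ((M * s) ^ n /\<^sub>R fact n))"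
    let ?G = "\<lambda>s. norm x0 * ((M * s) ^ Suc n /\<^sub>R fact (Suc n))"
    have der: "(?G has_vector_derivative ?g s) (at s within {0..t})" for s
    proof -
      have [simp]: "fact n + real n * fact n = (1 + real n) * fact n" "1 + real n \<noteq> 0"
        by (simp_all add: algebra_simps)
      show ?thesis
        unfolding has_real_derivative_iff_has_vector_derivative[symmetric]
        apply (rule derivative_eq_intros refl)+
        by (simp del: of_nat_Suc add: field_simps)
    qed
    have "(?g has_integral (?G t - ?G 0)) {0..t}"
      by (rule fundamental_theorem_of_calculus) (use Suc.prems der in auto)
    then have int: "(?g has_integral ?G t) {0..t}" by simp
    have "norm (X (Suc n) t) \<le> integral {0..t} ?g"
      unfolding XS
    proof (rule integral_norm_bound_integral)
      show "(\<lambda>s. a s (X n s)) integrable_on {0..t}"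
        by (rule integrable_continuous_real) (rule continuous_on_subset[OF caX sub])
      show "norm (a s (X n s)) \<le> ?g s" if "s \<in> {0..t}" for s
      proof -
        have s: "s \<in> {0..1}" using that sub by auto
        have "norm (a s (X n s)) \<le> norm (a s) * norm (X n s)" by (rule norm_blinfun)
        also have "\<dots> \<le> ?g s"
          using M s Suc.IH[OF s] by (intro mult_mono) auto
        finally show ?thesis .
      qed
    qed (use int in blast)
    with integral_unique[OF int] show ?case by (simp only:)
  qed (simp add: X0)
  define x where "x t = (\<Sum>n. X n t)" for t
  define S where "S n t = (\<Sum>i<n. X i t)" for n t
  have "uniform_limit {0..1} (\<lambda>n t. \<Sum>i<n. X i t) (\<lambda>t. \<Sum>n. X n t) sequentially"
  proof (rule Weierstrass_m_test)
    show "norm (X n t) \<le> norm x0 * (M ^ n /\<^sub>R fact n)" if "t \<in> {0..1}" for n t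
    proof -
      have "(M * t) ^ n \<le> M ^ n"
        using that M by (intro power_mono) (auto simp: mult_le_cancel_left1)
      then have "norm x0 * ((M * t) ^ n /\<^sub>R fact n) \<le> norm x0 * (M ^ n /\<^sub>R fact n)"
        by (intro mult_left_mono scaleR_left_mono) auto
      with nX[OF that, of n] show ?thesis by linarith
    qed
    show "summable (\<lambda>n. norm x0 * (M ^ n /\<^sub>R fact n))"
      by (intro summable_mult summable_exp_generic)
  qed
  then have ul: "uniform_limit {0..1} S x sequentially"
    by (simp add: S_def[abs_def] x_def[abs_def])
  have cS: "continuous_on {0..1} (S n)" for n
    unfolding S_def[abs_def] by (intro continuous_intros cX)
  have cx: "continuous_on {0..1} x"
    by (rule uniform_limit_theorem[OF _ ul]) (auto simp: cS)
  have ul2: "uniform_limit {0..1} (\<lambda>n s. a s (S n s)) (\<lambda>s. a s (x s)) sequentially"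
  proof (rule uniform_limitI)
    fix e :: real assume "e > 0"
    then have "\<forall>\<^sub>F n in sequentially. \<forall>t\<in>{0..1}. dist (S n t) (x t) < e / M"
      using ul M by (auto simp: uniform_limit_iff)
    then show "\<forall>\<^sub>F n in sequentially. \<forall>t\<in>{0..1}. dist (a t (S n t)) (a t (x t)) < e"
    proof eventually_elim
      case (elim n)
      show ?case
      proof
        fix t :: real assume t: "t \<in> {0..1}"
        have "dist (a t (S n t)) (a t (x t)) \<le> norm (a t) * dist (S n t) (x t)"
          by (simp add: dist_norm blinfun.diff_right[symmetric] norm_blinfun)
        also have "\<dots> \<le> M * dist (S n t) (x t)" using M t by (intro mult_right_mono) auto
        also have "\<dots> < e" using elim t M by (auto simp: field_simps)
        finally show "dist (a t (S n t)) (a t (x t)) < e" .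
      qed
    qed
  qed
  \<comment> \<open>The partial sums are the Picard iterates: the linear integral operator shifts
    the index by one, and the initial term \<open>X 0\<close> supplies \<open>x0\<close>.\<close>
  have SS: "S (Suc n) t = x0 + integral {0..t} (\<lambda>s. a s (S n s))" if "t \<in> {0..1}" for n t
  proof -
    have sub: "{0..t} \<subseteq> {0..1}" using that by auto
    have "integral {0..t} (\<lambda>s. a s (S n s)) = integral {0..t} (\<lambda>s. \<Sum>i<n. a s (X i s))"
      by (simp add: S_def blinfun.sum_right)
    also have "\<dots> = (\<Sum>i<n. X (Suc i) t)"
      unfolding XS
      by (rule integral_sum) (auto intro!: integrable_continuous_real continuous_on_subset[OF caX sub])
    finally show ?thesis
      unfolding S_def by (subst sum.lessThan_Suc_shift) (simp add: X0)
  qed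
  have xint: "x t = x0 + integral {0..t} (\<lambda>s. a s (x s))" if t: "t \<in> {0..1}" for t
  proof -
    have sub: "{0..t} \<subseteq> {0..1}" using t by auto
    obtain I J where I: "\<And>n. ((\<lambda>s. a s (S n s)) has_integral I n) {0..t}"
      and J: "((\<lambda>s. a s (x s)) has_integral J) {0..t}" and IJ: "I \<longlonglongrightarrow> J"
    proof (rule uniform_limit_integral[OF uniform_limit_on_subset[OF ul2 sub]])
      show "continuous_on {0..t} (\<lambda>s. a s (S n s))" for n
        by (intro continuous_intros continuous_on_subset[OF a sub] continuous_on_subset[OF cS sub])
    qed (auto simp: trivial_limit_sequentially)
    have "(\<lambda>n. S (Suc n) t) \<longlonglongrightarrow> x t"
      using ul t by (intro LIMSEQ_Suc tendsto_uniform_limitI)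
    moreover have "(\<lambda>n. S (Suc n) t) \<longlonglongrightarrow> x0 + J"
      unfolding SS[OF t] integral_unique[OF I] by (intro tendsto_intros IJ)
    ultimately have "x t = x0 + J" by (rule LIMSEQ_unique)
    with J show ?thesis by (simp add: integral_unique)
  qed
  have "continuous_on {0..1} (\<lambda>s. a s (x s))"
    by (intro continuous_intros a cx)
  then have der: "((\<lambda>t. x0 + integral {0..t} (\<lambda>s. a s (x s))) has_vector_derivative a t (x t)) (at t within {0..1})"
    if "t \<in> {0..1}" for t
    using has_vector_derivative_add[OF has_vector_derivative_const integral_has_vector_derivative]
      that by fastforce
  show ?thesis
  proof (rule that)
    show "x 0 = x0" using xint[of 0] by simp
    show "(x has_vector_derivative a t (x t)) (at t within {0..1})" if "t \<in> {0..1}" for t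
      using der[OF that]
      by (rule has_vector_derivative_transform[OF that, rotated]) (rule xint)
  qed
qed

text \<open>Gronwall's argument: \<open>exp (- (2 M + 1) t) |D t|\<^sup>2 - e\<^sup>2 t\<close> is decreasing.\<close>

lemma linear_ode_bound:
  fixes D :: "real \<Rightarrow> 'a::real_inner" and a :: "real \<Rightarrow> 'a \<Rightarrow>\<^sub>L 'a"
  assumes D: "\<And>t. t \<in> {0..1} \<Longrightarrow> (D has_vector_derivative D' t) (at t within {0..1})"
    and D0: "D 0 = 0"
    and e: "\<And>t. t \<in> {0..1} \<Longrightarrow> norm (D' t - a t (D t)) \<le> e"
    and M: "\<And>t. t \<in> {0..1} \<Longrightarrow> norm (a t) \<le> M"
  shows "norm (D 1) \<le> exp (M + 1/2) * e"
proof -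
  have "0 \<le> e" using order_trans[OF norm_ge_zero e[of 0]] by simp
  \<comment> \<open>\<open>2 * M\<close> pays for the linear term and \<open>1\<close> for the
    square of \<open>D t\<close> in the bound of the mixed term
    \<open>2 * (D t \<bullet> r)\<close>. Taking the root at the end halves \<open>K\<close>, whence
    \<open>M + 1/2\<close>.\<close>
  define K where "K = 2 * M + 1"
  have M0: "0 \<le> M" using order_trans[OF norm_ge_zero M[of 0]] by simp
  define \<phi> where "\<phi> t = exp (- K * t) * (D t \<bullet> D t) - e\<^sup>2 * t" for t
  have der: "(\<phi> has_real_derivative exp (- K * t) * (2 * (D t \<bullet> D' t) - K * (D t \<bullet> D t)) - e\<^sup>2) (at t within {0..1})"
    if "t \<in> {0..1}" for t
  proof -
    have dd: "((\<lambda>t. D t \<bullet> D t) has_real_derivative 2 * (D t \<bullet> D' t)) (at t within {0..1})"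
      using has_derivative_inner[OF D[OF that, unfolded has_vector_derivative_def] D[OF that, unfolded has_vector_derivative_def]]
      unfolding has_field_derivative_def
      by (rule has_derivative_eq_rhs) (simp add: fun_eq_iff inner_commute algebra_simps)
    have "((\<lambda>t. exp (- K * t)) has_real_derivative - K * exp (- K * t)) (at t within {0..1})"
      by (auto intro!: derivative_eq_intros)
    from DERIV_diff[OF DERIV_mult[OF this dd] DERIV_cmult_Id[of "e\<^sup>2"]] show ?thesis
      unfolding \<phi>_def by (simp add: algebra_simps)
  qed
  have "\<phi> 1 \<le> \<phi> 0"
  proof (rule DERIV_nonpos_imp_decreasing_open[where f=\<phi> and a=0 and b=1])
    show "continuous_on {0..1} \<phi>"
      using der by (meson DERIV_continuous continuous_on_eq_continuous_within)
    fix t :: real assume t: "0 < t" "t < 1"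
    then have t': "t \<in> {0..1}" by auto
    define r where "r = D' t - a t (D t)"
    have "2 * (D t \<bullet> D' t) = 2 * (D t \<bullet> a t (D t)) + 2 * (D t \<bullet> r)"
      unfolding r_def inner_diff_right by simp
    also have "\<dots> \<le> 2 * M * (norm (D t))\<^sup>2 + ((norm (D t))\<^sup>2 + (norm r)\<^sup>2)"
    proof (rule add_mono)
      have "D t \<bullet> a t (D t) \<le> norm (D t) * norm (a t (D t))" by (rule norm_cauchy_schwarz)
      also have "\<dots> \<le> norm (D t) * (M * norm (D t))"
        using norm_blinfun[of "a t" "D t"] M[OF t'] mult_right_mono[of "norm (a t)" M "norm (D t)"]
        by (intro mult_left_mono) auto
      finally show "2 * (D t \<bullet> a t (D t)) \<le> 2 * M * (norm (D t))\<^sup>2"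
        by (simp add: power2_eq_square mult.left_commute)
      have "0 \<le> (norm (D t) - norm r)\<^sup>2" by simp
      then have "2 * (norm (D t) * norm r) \<le> (norm (D t))\<^sup>2 + (norm r)\<^sup>2"
        by (simp add: power2_diff)
      with norm_cauchy_schwarz[of "D t" r]
      show "2 * (D t \<bullet> r) \<le> (norm (D t))\<^sup>2 + (norm r)\<^sup>2" by linarith
    qed
    also have "\<dots> = K * (D t \<bullet> D t) + (norm r)\<^sup>2"
      by (simp add: K_def power2_norm_eq_inner algebra_simps)
    also have "(norm r)\<^sup>2 \<le> e\<^sup>2" using e[OF t'] by (simp add: r_def power_mono)
    finally have "exp (- K * t) * (2 * (D t \<bullet> D' t) - K * (D t \<bullet> D t)) \<le> exp (- K * t) * e\<^sup>2"
      by (intro mult_left_mono) auto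
    also have "\<dots> \<le> 1 * e\<^sup>2"
      using t M0 by (intro mult_right_mono) (simp_all add: K_def mult_nonneg_nonneg mult_nonpos_nonneg)
    finally have "exp (- K * t) * (2 * (D t \<bullet> D' t) - K * (D t \<bullet> D t)) - e\<^sup>2 \<le> 0" by simp
    moreover have "at t within {0..1} = at t"
      using t by (intro at_within_interior) auto
    ultimately show "\<exists>y. (\<phi> has_real_derivative y) (at t) \<and> y \<le> 0"
      using der[OF t'] by auto
  qed simp
  then have "exp (- K) * (norm (D 1))\<^sup>2 \<le> e\<^sup>2"
    by (simp add: \<phi>_def D0 power2_norm_eq_inner)
  then have "(norm (D 1))\<^sup>2 \<le> exp K * e\<^sup>2"
    by (simp add: exp_minus field_simps)
  also have "exp K * e\<^sup>2 = (exp (M + 1/2) * e)\<^sup>2"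
    by (simp add: power_mult_distrib flip: exp_double) (simp add: K_def)
  finally show ?thesis
    using \<open>0 \<le> e\<close> by (simp add: power2_le_iff_abs_le)
qed

section \<open>Parallel sections on star-shaped and on simply connected domains\<close>

lemma norm_scaleR_le_norm:
  "t \<in> {0..1} \<Longrightarrow> norm (t *\<^sub>R x) \<le> norm x"
  by (simp add: mult_left_le_one_le)

text \<open>The closed neighbourhood \<open>K'\<close> of radius \<open>r\<close> around
  \<open>K\<close> is still compact, so \<open>\<omega>'\<close> is uniformly continuous on it, and
  the mean value inequality along the segment from \<open>q\<close> to \<open>q + k\<close> yields a
  \<open>d\<close> independent of \<open>q\<close>. Below, \<open>K\<close> is a segment from the
  origin, along which the remainders must be small simultaneously.\<close>

lemma uniform_linearization:
  fixes \<omega> :: "'b::euclidean_space \<Rightarrow> 'c::real_normed_vector"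
    and \<omega>' :: "'b \<Rightarrow> 'b \<Rightarrow>\<^sub>L 'c"
  assumes "compact K" "K \<noteq> {}" "open S" "K \<subseteq> S"
    and der: "\<And>p. p \<in> S \<Longrightarrow> (\<omega> has_derivative \<omega>' p) (at p)"
    and cont: "continuous_on S \<omega>'" and "0 < e"
  obtains d M where "0 < d" "0 \<le> M"
    "\<And>q k. q \<in> K \<Longrightarrow> norm k < d \<Longrightarrow> q + k \<in> S \<and> norm (\<omega> (q + k)) \<le> M \<and> norm (\<omega>' (q + k)) \<le> M \<and>
       norm (\<omega> (q + k) - \<omega> q - \<omega>' q k) \<le> e * norm k"
proof -
  obtain r where r: "0 < r" "(\<Union>x\<in>K. cball x r) \<subseteq> S"
    using compact_subset_open_imp_cball_epsilon_subset[OF \<open>compact K\<close> \<open>open S\<close> \<open>K \<subseteq> S\<close>] by blast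
  define K' where "K' = (\<Union>x\<in>K. \<Union>k\<in>cball 0 r. {x + k})"
  have K'S: "K' \<subseteq> S" using r(2) by (force simp: K'_def dist_norm)
  have "compact K'"
  proof -
    have "K' = {x + y | x y. x \<in> K \<and> y \<in> cball 0 r}" unfolding K'_def by blast
    then show ?thesis using compact_sums[OF \<open>compact K\<close> compact_cball[of 0 r]] by simp
  qed
  have in_K': "q + k \<in> K'" if "q \<in> K" "norm k \<le> r" for q k
    using that unfolding K'_def by force
  have cont\<omega>: "continuous_on S \<omega>"
    using der by (meson continuous_at_imp_continuous_on has_derivative_continuous)
  have "bounded (\<omega> ` K')" "bounded (\<omega>' ` K')"
    by (auto intro!: compact_imp_bounded compact_continuous_image \<open>compact K'\<close>
        continuous_on_subset[OF cont K'S] continuous_on_subset[OF cont\<omega> K'S])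
  then obtain M1 M2 where M1: "\<And>q. q \<in> K' \<Longrightarrow> norm (\<omega> q) \<le> M1"
    and M2: "\<And>q. q \<in> K' \<Longrightarrow> norm (\<omega>' q) \<le> M2"
    by (auto simp: bounded_iff)
  have "uniformly_continuous_on K' \<omega>'"
    by (intro compact_uniformly_continuous \<open>compact K'\<close> continuous_on_subset[OF cont K'S])
  then obtain d where d: "0 < d"
      "\<And>q q'. q \<in> K' \<Longrightarrow> q' \<in> K' \<Longrightarrow> dist q' q < d \<Longrightarrow> dist (\<omega>' q') (\<omega>' q) < e"
    using \<open>0 < e\<close> unfolding uniformly_continuous_on_def by metis
  show thesis
  proof (rule that[of "min d r" "max 0 (max M1 M2)"])
    fix q k :: 'b assume q: "q \<in> K" and k: "norm k < min d r"
    have qk: "q + k \<in> K'" "q \<in> K'" using in_K'[OF q, of k] in_K'[OF q, of 0] k r(1) by auto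
    have seg: "q + t *\<^sub>R k \<in> K'" "norm (t *\<^sub>R k) < d" if "t \<in> {0..1}" for t
    proof -
      have "norm (t *\<^sub>R k) \<le> norm k" using that by (rule norm_scaleR_le_norm)
      then show "q + t *\<^sub>R k \<in> K'" "norm (t *\<^sub>R k) < d" using in_K'[OF q] k by auto
    qed
    have "norm (\<omega> (q + k) - \<omega> q - \<omega>' q (q + k - q)) \<le> norm (q + k - q) * e"
    proof (rule differentiable_bound_linearization[where S="(\<lambda>t. q + t *\<^sub>R k) ` {0..1}"
          and f=\<omega> and a=q and b="q + k" and ?x0.0=q and f'="\<lambda>x. blinfun_apply (\<omega>' x)"])
      show "q + t *\<^sub>R (q + k - q) \<in> (\<lambda>t. q + t *\<^sub>R k) ` {0..1}" if "t \<in> {0..1}" for t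
        by (rule image_eqI[OF _ that]) simp
      show "q \<in> (\<lambda>t. q + t *\<^sub>R k) ` {0..1}" by (rule image_eqI[of _ _ 0]) auto
    next
      fix x assume "x \<in> (\<lambda>t. q + t *\<^sub>R k) ` {0..1}"
      then obtain t where t: "t \<in> {0..1}" "x = q + t *\<^sub>R k" by blast
      have xK': "x \<in> K'" unfolding t(2) by (rule seg(1)[OF t(1)])
      show "(\<omega> has_derivative \<omega>' x) (at x within (\<lambda>t. q + t *\<^sub>R k) ` {0..1})"
        by (rule has_derivative_at_withinI[OF der]) (use K'S xK' in blast)
      have "dist (\<omega>' x) (\<omega>' q) < e"
        using d(2)[OF qk(2) xK'] seg(2)[OF t(1)] by (simp add: t(2) dist_norm)
      then show "onorm (blinfun_apply (\<omega>' x) - blinfun_apply (\<omega>' q)) \<le> e"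
        by (simp add: dist_norm norm_blinfun.rep_eq minus_blinfun.rep_eq fun_diff_def)
    qed
    then show "q + k \<in> S \<and> norm (\<omega> (q + k)) \<le> max 0 (max M1 M2) \<and> norm (\<omega>' (q + k)) \<le> max 0 (max M1 M2) \<and>
        norm (\<omega> (q + k) - \<omega> q - \<omega>' q k) \<le> e * norm k"
      using K'S qk M1[OF qk(1)] M2[OF qk(1)] by (auto simp: mult.commute)
  qed (use d r in auto)
qed

text \<open>The section is obtained by solving the linear equation along the rays from the origin. To
  differentiate it at \<open>p\<close> in the direction \<open>h\<close>, the solution along the ray through \<open>p + h\<close> is
  compared with the first order correction \<open>x + t \<omega>(h) x\<close> of the solution \<open>x\<close> along the ray through
  \<open>p\<close>. Flatness says precisely that the correction satisfies the equation of the perturbed ray up to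
  \<open>o(h)\<close>.\<close>

lemma flat_section_star_shaped:
  fixes \<omega> :: "'b::euclidean_space \<Rightarrow> 'b \<Rightarrow>\<^sub>L ('a::{real_inner,banach} \<Rightarrow>\<^sub>L 'a)"
    and \<omega>' :: "'b \<Rightarrow> 'b \<Rightarrow>\<^sub>L ('b \<Rightarrow>\<^sub>L ('a \<Rightarrow>\<^sub>L 'a))"
  assumes S: "open S" and star: "\<And>p t. p \<in> S \<Longrightarrow> t \<in> {0..1} \<Longrightarrow> t *\<^sub>R p \<in> S"
    and der: "\<And>p. p \<in> S \<Longrightarrow> (\<omega> has_derivative \<omega>' p) (at p)"
    and cont: "continuous_on S \<omega>'"
    and flat: "\<And>p v w. p \<in> S \<Longrightarrow> \<omega>' p v w - \<omega>' p w v = (\<omega> p v o\<^sub>L \<omega> p w) - (\<omega> p w o\<^sub>L \<omega> p v)"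
  shows "\<exists>X. X 0 = x0 \<and> (\<forall>p\<in>S. (X has_derivative (\<lambda>v. \<omega> p v (X p))) (at p))"
proof -
  have cont\<omega>: "continuous_on S \<omega>"
    using der by (meson continuous_at_imp_continuous_on has_derivative_continuous)
  have cray: "continuous_on {0..1} (\<lambda>t. \<omega> (t *\<^sub>R p))" if "p \<in> S" for p
    by (rule continuous_on_compose2[OF cont\<omega>]) (auto intro!: continuous_intros star[OF that])
  have ex: "\<exists>x. x 0 = x0 \<and> (\<forall>t\<in>{0..1}. (x has_vector_derivative \<omega> (t *\<^sub>R p) p (x t)) (at t within {0..1}))"
    if "p \<in> S" for p
  proof -
    have "continuous_on {0..1} (\<lambda>t. \<omega> (t *\<^sub>R p) p)" by (intro continuous_intros cray that)
    then show ?thesis by (rule linear_ode_exists[of _ x0]) blast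
  qed
  define x where "x p = (if p \<in> S
      then SOME x. x 0 = x0 \<and> (\<forall>t\<in>{0..1}. (x has_vector_derivative \<omega> (t *\<^sub>R p) p (x t)) (at t within {0..1})) else (\<lambda>_. x0))" for p
  have x0: "x p 0 = x0" for p
    using someI_ex[OF ex, of p] by (cases "p \<in> S") (auto simp: x_def)
  have x': "(x p has_vector_derivative \<omega> (t *\<^sub>R p) p (x p t)) (at t within {0..1})" if "p \<in> S" "t \<in> {0..1}" for p t
    using someI_ex[OF ex[OF that(1)]] that by (auto simp: x_def)
  define X where "X p = x p 1" for p
  have "X 0 = x0"
  \<comment> \<open>At the origin the ray is constant, and the stability bound with zero coefficient
    and zero error identifies the solution. Otherwise the default value in \<open>x\<close>
    applies.\<close>
  proof (cases "0 \<in> S")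
    case True
    have "norm (x 0 1 - x0) \<le> exp (0 + 1/2) * 0"
      by (rule linear_ode_bound[where a="\<lambda>_. 0" and D'="\<lambda>_. 0"])
        (use x'[OF True] in \<open>auto simp: x0 blinfun.zero_right intro!: derivative_eq_intros\<close>)
    then show ?thesis by (simp add: X_def)
  qed (simp add: X_def x_def)
  moreover have "(X has_derivative (\<lambda>v. \<omega> p v (X p))) (at p)" if p: "p \<in> S" for p
  proof (unfold has_derivative_at_alt, intro conjI allI impI)
    show "bounded_linear (\<lambda>v. \<omega> p v (X p))"
      by (intro bounded_linear_intros)
    fix e :: real assume "0 < e"
    define K where "K = (\<lambda>t. t *\<^sub>R p) ` {0..1}"
    have K: "compact K" "K \<noteq> {}" "K \<subseteq> S"
      unfolding K_def using star[OF p] by (auto intro!: compact_continuous_image continuous_intros)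
    have xp: "continuous_on {0..1} (x p)"
      using x'[OF p] by (meson continuous_on_eq_continuous_within has_vector_derivative_continuous)
    obtain C where C: "0 < C" "\<And>t. t \<in> {0..1} \<Longrightarrow> norm (x p t) \<le> C"
      using compact_imp_bounded[OF compact_continuous_image[OF xp compact_Icc]]
      by (auto simp: bounded_pos)
    \<comment> \<open>The bound \<open>M\<close> has to be known before the tolerance
      \<open>e1\<close> can be chosen. The linearization lemma is therefore used twice, here only
      for \<open>M\<close>.\<close>
    obtain d0 M where d0: "0 < d0" "0 \<le> M" and M: "\<And>q k. q \<in> K \<Longrightarrow> norm k < d0 \<Longrightarrow>
       q + k \<in> S \<and> norm (\<omega> (q + k)) \<le> M \<and> norm (\<omega>' (q + k)) \<le> M"
      by (rule uniform_linearization[OF K(1,2) S K(3) der cont zero_less_one]) blast+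
    have half: "A * (e / (2 * A)) = e / 2" if "A \<noteq> 0" for A :: real
      using that by (simp add: field_simps)
    define P where "P = norm p + 1"
    have P: "1 \<le> P" by (simp add: P_def)
    define c where "c = exp (M * P + 1/2)"
    \<comment> \<open>The estimate will have the form
      \<open>(c * C * P * (1 + M) * e1 + c * C * L * norm h) * norm h\<close>. The choice of
      \<open>e1\<close> makes the first summand \<open>e / 2\<close>, and the last entry of
      \<open>d\<close> bounds the second by \<open>e / 2\<close>. The constant \<open>L\<close>
      collects the terms quadratic in \<open>h\<close>, and \<open>c\<close> is the Gronwall
      factor.\<close>
    define e1 where "e1 = e / (2 * (c * C * P * (1 + M)))"
    have e1: "0 < e1" using \<open>0 < e\<close> C(1) P d0 by (simp add: e1_def c_def)
    obtain d1 M1 where d1: "0 < d1" and lin: "\<And>q k. q \<in> K \<Longrightarrow> norm k < d1 \<Longrightarrow>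
       norm (\<omega> (q + k) - \<omega> q - \<omega>' q k) \<le> e1 * norm k"
      by (rule uniform_linearization[OF K(1,2) S K(3) der cont e1]) blast+
    define L where "L = M * (1 + M) + (M + M * P) * M"
    have L: "0 \<le> L" using d0 P by (simp add: L_def)
    define d where "d = min (min 1 (min d0 d1)) (e / (2 * (c * C * (L + 1))))"
    have "0 < d" using d0 d1 \<open>0 < e\<close> C(1) L by (simp add: d_def c_def)
    moreover have "norm (X y - X p - \<omega> p (y - p) (X p)) \<le> e * norm (y - p)" if y: "norm (y - p) < d" for y
    proof -
      define h where "h = y - p"
      have hn: "norm h \<le> 1" "norm h < d0" "norm h < d1" "norm h \<le> e / (2 * (c * C * (L + 1)))"
        using y by (auto simp: h_def d_def)
      have y_eq: "y = p + h" by (simp add: h_def)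
      have pK: "p \<in> K" by (auto simp: K_def intro: image_eqI[of _ _ 1])
      have yS: "y \<in> S" using M[OF pK hn(2)] by (simp add: y_eq)
      define a where "a t = \<omega> (t *\<^sub>R y) y" for t
      \<comment> \<open>The corrected solution minus the solution along the perturbed ray. At
        \<open>t = 1\<close> this is minus the remainder in the derivative of \<open>X\<close> at
        \<open>p\<close>.\<close>
      define D where "D t = x p t + t *\<^sub>R \<omega> (t *\<^sub>R p) h (x p t) - x y t" for t
      define D' where "D' t = \<omega> (t *\<^sub>R p) p (x p t) + (\<omega> (t *\<^sub>R p) h (x p t)
          + t *\<^sub>R (\<omega>' (t *\<^sub>R p) p h (x p t) + \<omega> (t *\<^sub>R p) h (\<omega> (t *\<^sub>R p) p (x p t)))) - a t (x y t)" for t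
      have th: "norm (t *\<^sub>R h) \<le> norm h" if "t \<in> {0..1}" for t
        using that by (rule norm_scaleR_le_norm)
      have tK: "t *\<^sub>R p \<in> K" if "t \<in> {0..1}" for t using that by (auto simp: K_def)
      have ty: "t *\<^sub>R y = t *\<^sub>R p + t *\<^sub>R h" for t by (simp add: y_eq scaleR_add_right)
      have bP: "norm p \<le> P" "norm y \<le> P"
        using hn norm_triangle_ineq[of p h] by (auto simp: P_def y_eq)
      have "norm (D 1) \<le> exp (M * P + 1/2) * (C * (P * e1 * (1 + M) + L * norm h) * norm h)"
      proof (rule linear_ode_bound)
        fix t :: real assume t: "t \<in> {0..1}"
        have tpS: "t *\<^sub>R p \<in> S" using star[OF p t] .
        have d\<omega>: "((\<lambda>t. \<omega> (t *\<^sub>R p)) has_vector_derivative \<omega>' (t *\<^sub>R p) p) (at t within {0..1})"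
        proof -
          have "((\<lambda>t. t *\<^sub>R p) has_vector_derivative p) (at t within {0..1})"
            by (auto intro!: derivative_eq_intros)
          from vector_derivative_diff_chain_within[OF this has_derivative_at_withinI[OF der[OF tpS]]]
          show ?thesis by (simp add: o_def)
        qed
        have "((\<lambda>t. \<omega> (t *\<^sub>R p) h) has_vector_derivative \<omega>' (t *\<^sub>R p) p h) (at t within {0..1})"
          by (rule bounded_linear.has_vector_derivative[OF blinfun.bounded_linear_left d\<omega>])
        from bounded_bilinear.has_vector_derivative[OF bounded_bilinear_blinfun_apply this x'[OF p t]]
        have "((\<lambda>t. \<omega> (t *\<^sub>R p) h (x p t)) has_vector_derivative
            \<omega> (t *\<^sub>R p) h (\<omega> (t *\<^sub>R p) p (x p t)) + \<omega>' (t *\<^sub>R p) p h (x p t)) (at t within {0..1})" .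
        note dd = this x'[OF p t] x'[OF yS t]
        show "(D has_vector_derivative D' t) (at t within {0..1})"
          unfolding D_def D'_def a_def
          by (rule derivative_eq_intros dd refl)+ (simp add: algebra_simps)
        have "norm (a t) \<le> norm (\<omega> (t *\<^sub>R y)) * norm y" unfolding a_def by (rule norm_blinfun)
        also have "\<dots> \<le> M * P"
        proof (rule mult_mono)
          show "norm (\<omega> (t *\<^sub>R y)) \<le> M"
            using M[OF tK[OF t] le_less_trans[OF th[OF t] hn(2)]] by (simp add: ty)
        qed (use bP d0 in auto)
        finally show "norm (a t) \<le> M * P" .
        define w where "w = \<omega> (t *\<^sub>R p)"
        define w' where "w' = \<omega>' (t *\<^sub>R p)"
        define R where "R = \<omega> (t *\<^sub>R y) - w - w' (t *\<^sub>R h)"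
        define E where "E = t *\<^sub>R w' h h + R y"
        define \<xi> where "\<xi> = x p t"
        have t01: "0 \<le> t" "t \<le> 1" using t by auto
        \<comment> \<open>Expansion of the perturbed coefficient around
          \<open>t *\<^sub>R p\<close>. \<open>E\<close> holds the quadratic term and the
          linearization remainder.\<close>
        have a_eq: "a t = w p + w h + t *\<^sub>R w' h p + E"
          by (simp add: a_def E_def R_def y_eq blinfun.bilinear_simps algebra_simps)
        have Mw: "norm w \<le> M" "norm w' \<le> M" using M[OF tK[OF t], of 0] d0 by (auto simp: w_def w'_def)
        have nR: "norm R \<le> e1 * norm h"
        proof -
          have "norm R \<le> e1 * norm (t *\<^sub>R h)"
            using lin[OF tK[OF t], of "t *\<^sub>R h"] th[OF t] hn by (simp add: R_def w_def w'_def ty)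
          also have "\<dots> \<le> e1 * norm h" using th[OF t] e1 by (intro mult_left_mono) auto
          finally show ?thesis .
        qed
        have nw'2: "norm (w' u v) \<le> M * norm u * norm v" for u v
          using norm_blinfun[of "w' u" v] mult_right_mono[OF order_trans[OF norm_blinfun[of w' u] mult_right_mono[OF Mw(2) norm_ge_zero]] norm_ge_zero[of v]]
          by linarith
        have nw: "norm (w u) \<le> M * norm u" for u
          using order_trans[OF norm_blinfun[of w u] mult_right_mono[OF Mw(1) norm_ge_zero]] .
        have nE: "norm E \<le> M * norm h * norm h + e1 * P * norm h"
        proof -
          have "norm (t *\<^sub>R w' h h) \<le> norm (w' h h)"
            using t by (rule norm_scaleR_le_norm)
          also have "\<dots> \<le> M * norm h * norm h" by (rule nw'2)
          finally have 1: "norm (t *\<^sub>R w' h h) \<le> M * norm h * norm h" .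
          have "norm (R y) \<le> norm R * norm y" by (rule norm_blinfun)
          also have "\<dots> \<le> (e1 * norm h) * P" using nR bP e1 by (intro mult_mono) auto
          finally have "norm (R y) \<le> e1 * P * norm h" by (simp add: mult_ac)
          with 1 show ?thesis unfolding E_def by (rule norm_triangle_le[OF add_mono])
        qed
        have nb: "norm (w h + t *\<^sub>R w' h p) \<le> (M + M * P) * norm h"
        proof -
          have "norm (t *\<^sub>R w' h p) \<le> norm (w' h p)"
            using t by (rule norm_scaleR_le_norm)
          also have "\<dots> \<le> M * norm h * norm p" by (rule nw'2)
          also have "\<dots> \<le> M * norm h * P" using bP d0 by (intro mult_left_mono) auto
          finally have "norm (t *\<^sub>R w' h p) \<le> M * norm h * P" .
          with nw[of h] have "norm (w h + t *\<^sub>R w' h p) \<le> M * norm h + M * norm h * P"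
            by (intro norm_triangle_le add_mono)
          then show ?thesis by (simp add: algebra_simps)
        qed
        \<comment> \<open>Flatness enters here: it exchanges \<open>w' p h\<close>, which comes from
          differentiating along the ray, for \<open>w' h p\<close>, which comes from displacing the
          ray. All terms of first order then cancel.\<close>
        have fl: "w' p h \<xi> + w h (w p \<xi>) = w' h p \<xi> + w p (w h \<xi>)"
        proof -
          have "(w' p h - w' h p) \<xi> = ((w p o\<^sub>L w h) - (w h o\<^sub>L w p)) \<xi>"
            using flat[OF tpS, of p h] by (simp add: w_def w'_def)
          then show ?thesis by (simp add: blinfun.bilinear_simps algebra_simps)
        qed
        have "D' t - a t (D t) = w p \<xi> + w h \<xi> + t *\<^sub>R (w' p h \<xi> + w h (w p \<xi>)) - a t (\<xi> + t *\<^sub>R w h \<xi>)"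
          by (simp add: D'_def D_def w_def w'_def \<xi>_def blinfun.bilinear_simps)
        also have "\<dots> = - (E \<xi> + t *\<^sub>R (w h + t *\<^sub>R w' h p + E) (w h \<xi>))"
          unfolding fl a_eq by (simp add: blinfun.bilinear_simps algebra_simps)
        finally have "norm (D' t - a t (D t)) = norm (E \<xi> + t *\<^sub>R (w h + t *\<^sub>R w' h p + E) (w h \<xi>))"
          by (simp only: norm_minus_cancel)
        also have "\<dots> \<le> norm E * norm \<xi> + (norm (w h + t *\<^sub>R w' h p) + norm E) * (M * norm h * norm \<xi>)"
        proof (intro norm_triangle_le add_mono norm_blinfun)
          have "norm (t *\<^sub>R (w h + t *\<^sub>R w' h p + E) (w h \<xi>)) \<le> norm ((w h + t *\<^sub>R w' h p + E) (w h \<xi>))"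
            using t by (rule norm_scaleR_le_norm)
          also have "\<dots> \<le> norm (w h + t *\<^sub>R w' h p + E) * norm (w h \<xi>)" by (rule norm_blinfun)
          also have "\<dots> \<le> (norm (w h + t *\<^sub>R w' h p) + norm E) * (M * norm h * norm \<xi>)"
            by (intro mult_mono norm_triangle_ineq order_trans[OF norm_blinfun[of "w h" \<xi>] mult_right_mono[OF nw norm_ge_zero]]) auto
          finally show "norm (t *\<^sub>R (w h + t *\<^sub>R w' h p + E) (w h \<xi>)) \<le> \<dots>" .
        qed
        also have "\<dots> \<le> norm E * norm \<xi> + ((M + M * P) * norm h + norm E) * (M * norm h * norm \<xi>)"
          using nb d0 by (intro add_mono mult_right_mono) auto
        also have "\<dots> = norm \<xi> * (norm E * (1 + M * norm h) + (M + M * P) * M * norm h * norm h)"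
          by (simp add: algebra_simps)
        also have "\<dots> \<le> C * ((M * norm h * norm h + e1 * P * norm h) * (1 + M * 1) + (M + M * P) * M * norm h * norm h)"
        proof -
          have "M * norm h \<le> M * 1" using hn(1) d0(2) by (rule mult_left_mono)
          moreover have "0 \<le> M * norm h * norm h + e1 * P * norm h" using d0(2) e1 P by simp
          ultimately have "norm E * (1 + M * norm h) \<le> (M * norm h * norm h + e1 * P * norm h) * (1 + M * 1)"
            using d0(2) by - (rule mult_mono[OF nE add_left_mono], assumption+, simp)
          moreover have "0 \<le> (M + M * P) * M * norm h * norm h" using d0(2) P by simp
          moreover have "0 \<le> norm E * (1 + M * norm h)" using d0(2) by simp
          moreover have "norm \<xi> \<le> C" "0 \<le> C" using C(1) C(2)[OF t] by (auto simp: \<xi>_def)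
          ultimately show ?thesis
            by - (rule mult_mono[OF _ add_right_mono], assumption+, linarith)
        qed
        also have "\<dots> = C * (P * e1 * (1 + M) + L * norm h) * norm h"
          by (simp add: L_def algebra_simps)
        finally show "norm (D' t - a t (D t)) \<le> C * (P * e1 * (1 + M) + L * norm h) * norm h" .
      qed (simp add: D_def x0)
      also have "\<dots> = (c * C * P * (1 + M) * e1 + c * C * L * norm h) * norm h"
        by (simp add: c_def algebra_simps)
      also have "\<dots> \<le> (e / 2 + e / 2) * norm h"
      proof (intro mult_right_mono add_mono)
        show "c * C * P * (1 + M) * e1 \<le> e / 2"
        proof -
          have "c * C * P * (1 + M) \<noteq> 0" using C(1) P d0 by (simp add: c_def)
          then show ?thesis unfolding e1_def by (intro order_eq_refl half)
        qed
        have "c * C * L * norm h \<le> c * C * (L + 1) * norm h"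
          using C(1) by (intro mult_right_mono mult_left_mono) (auto simp: c_def)
        also have "\<dots> \<le> c * C * (L + 1) * (e / (2 * (c * C * (L + 1))))"
          using hn(4) C(1) L by (intro mult_left_mono) (auto simp: c_def)
        also have "\<dots> = e / 2" using C(1) L by (intro half) (simp add: c_def)
        finally show "c * C * L * norm h \<le> e / 2" .
      qed auto
      finally have "norm (D 1) \<le> e * norm h" by simp
      moreover have "D 1 = - (X y - X p - \<omega> p (y - p) (X p))"
        by (simp add: D_def X_def h_def)
      ultimately show ?thesis by (simp only: norm_minus_cancel h_def)
    qed
    ultimately show "\<exists>d>0. \<forall>y. norm (y - p) < d \<longrightarrow> norm (X y - X p - \<omega> p (y - p) (X p)) \<le> e * norm (y - p)"
      by blast
  qed
  ultimately show ?thesis by blast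
qed

text \<open>The Riemann map pulls the connection back to the disc.\<close>

lemma flat_section_simply_connected:
  fixes \<omega> :: "complex \<Rightarrow> complex \<Rightarrow>\<^sub>L ('a::{real_inner,banach} \<Rightarrow>\<^sub>L 'a)"
    and \<omega>' :: "complex \<Rightarrow> complex \<Rightarrow>\<^sub>L (complex \<Rightarrow>\<^sub>L ('a \<Rightarrow>\<^sub>L 'a))"
  assumes D: "open D" "simply_connected D" "D \<noteq> {}"
    and der: "\<And>p. p \<in> D \<Longrightarrow> (\<omega> has_derivative \<omega>' p) (at p)"
    and cont: "continuous_on D \<omega>'"
    and flat: "\<And>p v w. p \<in> D \<Longrightarrow> \<omega>' p v w - \<omega>' p w v = (\<omega> p v o\<^sub>L \<omega> p w) - (\<omega> p w o\<^sub>L \<omega> p v)"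
  obtains p0 where "p0 \<in> D"
    "\<And>x0. \<exists>X. X p0 = x0 \<and> (\<forall>p\<in>D. (X has_derivative (\<lambda>v. \<omega> p v (X p))) (at p))"
proof (cases "D = UNIV")
  \<comment> \<open>The plane is not biholomorphic to the disc, but it is itself
    star-shaped.\<close>
  case True
  have "\<exists>X. X 0 = x0 \<and> (\<forall>p\<in>D. (X has_derivative (\<lambda>v. \<omega> p v (X p))) (at p))" for x0
  proof -
    have star: "t *\<^sub>R p \<in> D" for p t using True by simp
    show ?thesis
      by (rule flat_section_star_shaped[OF D(1) star der cont flat])
  qed
  then show thesis using that[of 0] True by blast
next
  case False
  then have "\<exists>f g. f holomorphic_on D \<and> g holomorphic_on ball 0 1 \<and>
      (\<forall>z\<in>D. f z \<in> ball 0 1 \<and> g (f z) = z) \<and> (\<forall>z\<in>ball 0 1. g z \<in> D \<and> f (g z) = z)"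
    using D simply_connected_eq_biholomorphic_to_disc[OF \<open>open D\<close>] by simp
  then obtain f g where f: "f holomorphic_on D" and g: "g holomorphic_on ball 0 1"
    and f2: "\<forall>z\<in>D. f z \<in> ball 0 1 \<and> g (f z) = z" and g2: "\<forall>z\<in>ball 0 1. g z \<in> D \<and> f (g z) = z"
    by (elim exE conjE)
  have fD: "f z \<in> ball 0 1" "g (f z) = z" if "z \<in> D" for z using f2 that by auto
  have gB: "g z \<in> D" if "z \<in> ball 0 1" for z using g2 that by auto
  have fg0: "f (g 0) = 0" using g2 by simp
  define g1 where "g1 = deriv g"
  define g2 where "g2 = deriv g1"
  have g1: "g1 holomorphic_on ball 0 1" unfolding g1_def by (intro holomorphic_deriv g) auto
  have g2: "g2 holomorphic_on ball 0 1" unfolding g2_def by (intro holomorphic_deriv g1) auto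
  have dg: "(g has_derivative (*) (g1 q)) (at q)" "(g1 has_derivative (*) (g2 q)) (at q)"
    if "q \<in> ball 0 1" for q
    using holomorphic_derivI[OF g _ that] holomorphic_derivI[OF g1 _ that]
    by (auto simp: has_field_derivative_def g1_def g2_def)
  define w where "w q = \<omega> (g q) o\<^sub>L blinfun_mult_right (g1 q)" for q
  define W where "W q k = (\<omega>' (g q) (g1 q * k) o\<^sub>L blinfun_mult_right (g1 q)) + (\<omega> (g q) o\<^sub>L blinfun_mult_right (g2 q * k))" for q k
  have W: "(w has_derivative W q) (at q)" if q: "q \<in> ball 0 1" for q
  proof -
    have 1: "((\<lambda>q. \<omega> (g q)) has_derivative (\<lambda>k. \<omega>' (g q) (g1 q * k))) (at q)"
      using has_derivative_compose[OF dg(1)[OF q] der[OF gB[OF q]]] .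
    have 2: "((\<lambda>q. blinfun_mult_right (g1 q)) has_derivative (\<lambda>k. blinfun_mult_right (g2 q * k))) (at q)"
      by (rule bounded_linear.has_derivative[OF bounded_linear_blinfun_mult_right dg(2)[OF q]])
    show ?thesis
      unfolding w_def W_def
      by (rule has_derivative_eq_rhs[OF bounded_bilinear.FDERIV[OF bounded_bilinear_blinfun_compose 1 2]])
        (simp add: fun_eq_iff add.commute)
  qed
  define w' where "w' q = Blinfun (W q)" for q
  have w': "blinfun_apply (w' q) = W q" if "q \<in> ball 0 1" for q
    unfolding w'_def by (rule bounded_linear_Blinfun_apply[OF has_derivative_bounded_linear[OF W[OF that]]])
  have cont\<omega>: "continuous_on D \<omega>"
    using der by (meson continuous_at_imp_continuous_on has_derivative_continuous)
  have cg: "continuous_on (ball 0 1) g" "continuous_on (ball 0 1) g1" "continuous_on (ball 0 1) g2"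
    using g g1 g2 by (auto intro: holomorphic_on_imp_continuous_on)
  have cW: "continuous_on (ball 0 1) (\<lambda>q. W q k)" for k
    unfolding W_def
    by (intro continuous_intros continuous_on_compose2[OF cont] continuous_on_compose2[OF cont\<omega>] cg
        bounded_linear.continuous_on[OF bounded_linear_blinfun_mult_right]
        bounded_bilinear.continuous_on[OF bounded_bilinear_blinfun_compose]) (use gB in auto)
  have cw': "continuous_on (ball 0 1) w'"
  proof (rule continuous_on_blinfun_componentwise)
    show "continuous_on (ball 0 1) (\<lambda>q. w' q k)" for k
      using cW[of k] by (rule continuous_on_eq) (simp add: w')
  qed
  have dw: "(w has_derivative w' q) (at q)" if "q \<in> ball 0 1" for q
    using W[OF that] w'[OF that] by simp
  \<comment> \<open>The contribution of the second derivative \<open>g2\<close> is symmetric in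
    \<open>u\<close> and \<open>v\<close>, so it drops out, and flatness pulls back like a
    tensor.\<close>
  have flat': "w' q v u - w' q u v = (w q v o\<^sub>L w q u) - (w q u o\<^sub>L w q v)" if q: "q \<in> ball 0 1" for q u v
    using flat[OF gB[OF q], of "g1 q * v" "g1 q * u"]
    by (simp add: w'[OF q] W_def w_def plus_blinfun.rep_eq mult_ac)
  \<comment> \<open>\<open>c\<close> is the derivative of the inverse \<open>f\<close> of
    \<open>g\<close>; it cancels the factor \<open>g1 (f p)\<close> that the pullback has
    introduced.\<close>
  have df: "\<exists>c. (f has_derivative (*) c) (at p) \<and> g1 (f p) * c = 1" if p: "p \<in> D" for p
  proof -
    have d: "(f has_derivative (*) (deriv f p)) (at p)"
      using holomorphic_derivI[OF f D(1) p] by (simp add: has_field_derivative_def)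
    have "((\<lambda>z. g (f z)) has_derivative (\<lambda>v. g1 (f p) * (deriv f p * v))) (at p)"
      using has_derivative_compose[OF d dg(1)[OF fD(1)[OF p]]] .
    then have "((\<lambda>z. z) has_derivative (\<lambda>v. g1 (f p) * (deriv f p * v))) (at p)"
      by (rule has_derivative_transform_within_open[OF _ D(1) p]) (rule fD(2))
    from has_derivative_unique[OF this has_derivative_ident] d show ?thesis
      by (metis mult.right_neutral)
  qed
  show thesis
  proof (rule that[of "g 0"])
    show "g 0 \<in> D" by (rule gB) simp
    fix x0 :: 'a
    have star: "t *\<^sub>R p \<in> ball 0 1" if "p \<in> ball 0 1" "t \<in> {0..1}" for p :: complex and t
      using le_less_trans[OF norm_scaleR_le_norm[OF that(2), of p]] that(1) by simp
    obtain X where X: "X 0 = x0" "\<And>q. q \<in> ball 0 1 \<Longrightarrow> (X has_derivative (\<lambda>v. w q v (X q))) (at q)"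
      using flat_section_star_shaped[OF open_ball star dw cw' flat', of x0] by auto
    show "\<exists>X. X (g 0) = x0 \<and> (\<forall>p\<in>D. (X has_derivative (\<lambda>v. \<omega> p v (X p))) (at p))"
    proof (intro exI[of _ "\<lambda>p. X (f p)"] conjI ballI)
      show "X (f (g 0)) = x0" by (simp add: fg0 X)
      fix p assume p: "p \<in> D"
      from df[OF p] obtain c where c: "(f has_derivative (*) c) (at p)" "g1 (f p) * c = 1" by blast
      have "((\<lambda>p. X (f p)) has_derivative (\<lambda>v. w (f p) (c * v) (X (f p)))) (at p)"
        using has_derivative_compose[OF c(1) X(2)[OF fD(1)[OF p]]] .
      moreover have "w (f p) (c * v) = \<omega> p v" for v
        using c(2) by (simp add: w_def fD(2)[OF p] flip: mult.assoc)
      ultimately show "((\<lambda>p. X (f p)) has_derivative (\<lambda>v. \<omega> p v (X (f p)))) (at p)"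
        by simp
    qed
  qed
qed

section \<open>Smooth maps\<close>

text \<open>The mean value inequality in the direction \<open>v\<close> reduces the second
  difference to a difference of two values of \<open>f' q v\<close>, and the first order expansion
  of that map at \<open>p\<close> controls this difference.\<close>

lemma second_difference_bound:
  fixes f :: "'a::real_normed_vector \<Rightarrow> 'b::real_normed_vector"
  assumes S: "open S" "p \<in> S"
    and f': "\<And>q. q \<in> S \<Longrightarrow> (f has_derivative f' q) (at q)"
    and A: "((\<lambda>q. f' q v) has_derivative A) (at p)" and "0 < e"
  shows "\<exists>d>0. \<forall>s. 0 < s \<and> s < d \<longrightarrow>
    norm (f (p + s *\<^sub>R w + s *\<^sub>R v) - f (p + s *\<^sub>R v) - f (p + s *\<^sub>R w) + f p - s\<^sup>2 *\<^sub>R A w) \<le> e * s\<^sup>2"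
proof -
  interpret A: bounded_linear A using A by (rule has_derivative_bounded_linear)
  \<comment> \<open>For \<open>t \<le> s\<close> both displacements from \<open>p\<close> have norm
    at most \<open>s * N\<close>, so the tolerance \<open>e / (2 * N)\<close> leaves
    \<open>e / 2 * s\<close> for each of the two remainders.\<close>
  define N where "N = norm v + norm w + 1"
  have N: "0 < N" by (simp add: N_def add_nonneg_pos)
  obtain r where r: "0 < r" "ball p r \<subseteq> S" using S openE by blast
  from A obtain d where d: "0 < d"
    "\<And>q. norm (q - p) < d \<Longrightarrow> norm (f' q v - f' p v - A (q - p)) \<le> e / (2 * N) * norm (q - p)"
    unfolding has_derivative_at_alt using \<open>0 < e\<close> N by (metis divide_pos_pos mult_pos_pos zero_less_numeral)
  have small: "norm (s *\<^sub>R w + t *\<^sub>R v) \<le> s * N" "norm (t *\<^sub>R v) \<le> s * N" if "t \<in> {0..s}" for s t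
  proof -
    have t: "t * norm v \<le> s * norm v" "0 \<le> s" "0 \<le> t" using that by (auto intro: mult_right_mono)
    have "norm (s *\<^sub>R w + t *\<^sub>R v) \<le> s * norm w + t * norm v"
      using norm_triangle_ineq[of "s *\<^sub>R w" "t *\<^sub>R v"] t by simp
    also have "\<dots> \<le> s * N" using t by (simp add: N_def algebra_simps)
    finally show "norm (s *\<^sub>R w + t *\<^sub>R v) \<le> s * N" .
    have "0 \<le> s * norm w" using t(2) by simp
    moreover have "s * N = s * norm v + s * norm w + s" by (simp add: N_def algebra_simps)
    moreover have "norm (t *\<^sub>R v) = t * norm v" using t(3) by simp
    ultimately show "norm (t *\<^sub>R v) \<le> s * N" using t by linarith
  qed
  have bound: "norm (f (p + s *\<^sub>R w + s *\<^sub>R v) - f (p + s *\<^sub>R v) - f (p + s *\<^sub>R w) + f p - s\<^sup>2 *\<^sub>R A w) \<le> e * s\<^sup>2"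
    if s: "0 < s" "s < min r d / N" for s
  proof -
    have sN: "s * N < r" "s * N < d" using s N by (auto simp: field_simps)
    define \<phi> where "\<phi> t = f (p + s *\<^sub>R w + t *\<^sub>R v) - f (p + t *\<^sub>R v) - (t * s) *\<^sub>R A w" for t
    have inS: "p + k \<in> S" if "norm k \<le> s * N" for k
      using that sN r by (auto simp: subset_iff dist_norm)
    have line: "((\<lambda>t. f (q + t *\<^sub>R v)) has_derivative (\<lambda>h. f' (q + t *\<^sub>R v) (h *\<^sub>R v))) (at t within X)"
      if "q + t *\<^sub>R v \<in> S" for q t X
    proof -
      have "((\<lambda>t. q + t *\<^sub>R v) has_derivative (\<lambda>h. h *\<^sub>R v)) (at t within X)"
        by (auto intro!: derivative_eq_intros)
      from has_derivative_compose[OF this f'[OF that]] show ?thesis .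
    qed
    have "norm (\<phi> s - \<phi> 0) \<le> (e * s) * norm (s - 0)"
    proof (rule differentiable_bound[of "{0..s}" \<phi>
          "\<lambda>t h. f' (p + s *\<^sub>R w + t *\<^sub>R v) (h *\<^sub>R v) - f' (p + t *\<^sub>R v) (h *\<^sub>R v) - (h * s) *\<^sub>R A w"])
      fix t assume t: "t \<in> {0..s}"
      have S1: "p + s *\<^sub>R w + t *\<^sub>R v \<in> S" and S2: "p + t *\<^sub>R v \<in> S"
        using inS[OF small(1)[OF t]] inS[OF small(2)[OF t]] by (simp_all add: add.assoc)
      show "(\<phi> has_derivative (\<lambda>h. f' (p + s *\<^sub>R w + t *\<^sub>R v) (h *\<^sub>R v)
          - f' (p + t *\<^sub>R v) (h *\<^sub>R v) - (h * s) *\<^sub>R A w)) (at t within {0..s})"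
        unfolding \<phi>_def
        by (intro has_derivative_diff line S1 S2) (auto intro!: derivative_eq_intros)
      have "norm (f' (p + s *\<^sub>R w + t *\<^sub>R v) v - f' (p + t *\<^sub>R v) v - s *\<^sub>R A w) \<le> e * s"
      proof -
        define R where "R k = f' (p + k) v - f' p v - A k" for k
        have R: "norm (R k) \<le> e / 2 * s" if "norm k \<le> s * N" for k
        proof -
          have "norm (R k) \<le> e / (2 * N) * norm k" using d(2)[of "p + k"] that sN by (simp add: R_def)
          also have "\<dots> \<le> e / (2 * N) * (s * N)" using that \<open>0 < e\<close> N by (intro mult_left_mono) auto
          finally show ?thesis using N by simp
        qed
        have "f' (p + s *\<^sub>R w + t *\<^sub>R v) v - f' (p + t *\<^sub>R v) v - s *\<^sub>R A w = R (s *\<^sub>R w + t *\<^sub>R v) - R (t *\<^sub>R v)"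
          by (simp add: R_def A.add A.scaleR add.assoc)
        also have "norm \<dots> \<le> e / 2 * s + e / 2 * s"
          by (intro norm_triangle_le_diff add_mono R small t)
        finally show ?thesis by simp
      qed
      moreover have "f' (p + s *\<^sub>R w + t *\<^sub>R v) (h *\<^sub>R v) - f' (p + t *\<^sub>R v) (h *\<^sub>R v) - (h * s) *\<^sub>R A w
          = h *\<^sub>R (f' (p + s *\<^sub>R w + t *\<^sub>R v) v - f' (p + t *\<^sub>R v) v - s *\<^sub>R A w)" for h
        using has_derivative_linear[OF f'[OF S1]] has_derivative_linear[OF f'[OF S2]]
        by (simp add: linear_scale scaleR_diff_right)
      ultimately show "onorm (\<lambda>h. f' (p + s *\<^sub>R w + t *\<^sub>R v) (h *\<^sub>R v)
          - f' (p + t *\<^sub>R v) (h *\<^sub>R v) - (h * s) *\<^sub>R A w) \<le> e * s"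
        using \<open>0 < e\<close> s(1) by (intro onorm_bound) (auto simp: mult.commute mult_left_mono)
    qed (use s(1) in auto)
    then show ?thesis
      using s(1) by (simp add: \<phi>_def power2_eq_square algebra_simps)
  qed
  show ?thesis
    by (rule exI[of _ "min r d / N"]) (use bound r d N in auto)
qed

text \<open>The second difference is symmetric in \<open>v\<close> and \<open>w\<close>; divided by
  \<open>s\<^sup>2\<close>, it tends to \<open>A w\<close> and to \<open>B v\<close>.\<close>

lemma second_derivative_symmetric:
  fixes f :: "'a::real_normed_vector \<Rightarrow> 'b::real_normed_vector"
  assumes S: "open S" "p \<in> S"
    and f': "\<And>q. q \<in> S \<Longrightarrow> (f has_derivative f' q) (at q)"
    and A: "((\<lambda>q. f' q v) has_derivative A) (at p)"
    and B: "((\<lambda>q. f' q w) has_derivative B) (at p)"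
  shows "A w = B v"
proof -
  have "norm (A w - B v) \<le> e" if "0 < e" for e
  proof -
    have e2: "0 < e / 2" using that by simp
    let ?\<Delta> = "\<lambda>s. f (p + s *\<^sub>R w + s *\<^sub>R v) - f (p + s *\<^sub>R v) - f (p + s *\<^sub>R w) + f p"
    obtain d1 where d1: "0 < d1" "\<And>s. 0 < s \<Longrightarrow> s < d1 \<Longrightarrow> norm (?\<Delta> s - s\<^sup>2 *\<^sub>R A w) \<le> e / 2 * s\<^sup>2"
      using second_difference_bound[OF S f' A e2] by metis
    obtain d2 where d2: "0 < d2" "\<And>s. 0 < s \<Longrightarrow> s < d2 \<Longrightarrow>
        norm (f (p + s *\<^sub>R v + s *\<^sub>R w) - f (p + s *\<^sub>R w) - f (p + s *\<^sub>R v) + f p - s\<^sup>2 *\<^sub>R B v) \<le> e / 2 * s\<^sup>2"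
      using second_difference_bound[OF S f' B e2] by metis
    define s where "s = min d1 d2 / 2"
    have s: "0 < s" "s < d1" "s < d2" using d1(1) d2(1) by (auto simp: s_def min_def)
    have 1: "norm (?\<Delta> s - s\<^sup>2 *\<^sub>R A w) \<le> e / 2 * s\<^sup>2" using d1(2) s by blast
    have "norm (f (p + s *\<^sub>R v + s *\<^sub>R w) - f (p + s *\<^sub>R w) - f (p + s *\<^sub>R v) + f p - s\<^sup>2 *\<^sub>R B v) \<le> e / 2 * s\<^sup>2"
      using d2(2) s by blast
    then have 2: "norm (?\<Delta> s - s\<^sup>2 *\<^sub>R B v) \<le> e / 2 * s\<^sup>2"
      by (simp add: add_ac diff_diff_eq)
    have "s\<^sup>2 *\<^sub>R (A w - B v) = (?\<Delta> s - s\<^sup>2 *\<^sub>R B v) - (?\<Delta> s - s\<^sup>2 *\<^sub>R A w)"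
      by (simp add: scaleR_diff_right)
    also have "norm \<dots> \<le> e / 2 * s\<^sup>2 + e / 2 * s\<^sup>2"
      by (intro norm_triangle_le_diff add_mono 1 2)
    finally have "s\<^sup>2 * norm (A w - B v) \<le> s\<^sup>2 * e" by (simp add: mult.commute)
    then show ?thesis using s(1) by simp
  qed
  then have "norm (A w - B v) \<le> 0" by (rule field_le_epsilon) simp
  then show ?thesis by simp
qed

section \<open>Closure properties of smooth maps\<close>

lemma Ck_on_cong:
  assumes "open S" "\<And>p. p \<in> S \<Longrightarrow> f p = g p" "Ck_on k S f"
  shows "Ck_on k S g"
  using assms(2,3)
proof (induction k arbitrary: f g)
  case 0
  then show ?case by (simp cong: continuous_on_cong)
next
  case (Suc k)
  have der: "(g has_derivative frechet_derivative f (at p)) (at p)" if "p \<in> S" for p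
    using Suc.prems that \<open>open S\<close>
    by (intro has_derivative_transform_within_open[of f _ p UNIV S g]) (auto simp: frechet_derivative_works)
  then have eq: "frechet_derivative g (at p) = frechet_derivative f (at p)" if "p \<in> S" for p
    using frechet_derivative_at that by metis
  have "Ck_on k S (\<lambda>p. frechet_derivative g (at p) v)" for v
    by (rule Suc.IH[of "\<lambda>p. frechet_derivative f (at p) v"]) (use Suc.prems eq in auto)
  then show ?case using der by (auto simp: differentiable_def)
qed

text \<open>Allows any formula for the derivative that is valid on the open set in place of
  \<open>frechet_derivative\<close>.\<close>

lemma Ck_on_SucI:
  assumes "open S" and der: "\<And>p. p \<in> S \<Longrightarrow> (f has_derivative f' p) (at p)"
    and "\<And>v. Ck_on k S (\<lambda>p. f' p v)"
  shows "Ck_on (Suc k) S f"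
proof -
  have eq: "f' p = frechet_derivative f (at p)" if "p \<in> S" for p
    using frechet_derivative_at[OF der[OF that]] .
  have "Ck_on k S (\<lambda>p. frechet_derivative f (at p) v)" for v
    by (rule Ck_on_cong[OF \<open>open S\<close> _ assms(3)[of v]]) (simp add: eq)
  then show ?thesis using der by (auto simp: differentiable_def)
qed

lemma Ck_on_SucD:
  assumes "Ck_on (Suc k) S f"
  shows "Ck_on k S f"
  using assms
proof (induction k arbitrary: f)
  case 0
  then show ?case
    by (auto intro!: differentiable_imp_continuous_on simp: differentiable_on_def differentiable_at_withinI)
qed auto

lemma Ck_on_add:
  assumes "open S" "Ck_on k S f" "Ck_on k S g"
  shows "Ck_on k S (\<lambda>p. f p + g p)"
  using assms(2,3)
proof (induction k arbitrary: f g)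
  case (Suc k)
  show ?case
    by (rule Ck_on_SucI[OF \<open>open S\<close> has_derivative_add[OF iffD1[OF frechet_derivative_works] iffD1[OF frechet_derivative_works]]])
      (use Suc in auto)
qed (simp add: continuous_on_add)

lemma Ck_on_bounded_linear:
  assumes "open S" "bounded_linear L" "Ck_on k S f"
  shows "Ck_on k S (\<lambda>p. L (f p))"
  using assms(3)
proof (induction k arbitrary: f)
  case 0
  then show ?case using bounded_linear.continuous_on[OF assms(2)] by auto
next
  case (Suc k)
  show ?case
    by (rule Ck_on_SucI[OF \<open>open S\<close> bounded_linear.has_derivative[OF assms(2) iffD1[OF frechet_derivative_works]]])
      (use Suc in auto)
qed

lemma Ck_on_bounded_bilinear:
  assumes "open S" "bounded_bilinear B" "Ck_on k S f" "Ck_on k S g"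
  shows "Ck_on k S (\<lambda>p. B (f p) (g p))"
  using assms(3,4)
proof (induction k arbitrary: f g)
  case 0
  then show ?case using bounded_bilinear.continuous_on[OF assms(2)] by auto
next
  case (Suc k)
  have d: "f differentiable (at p)" "g differentiable (at p)" if "p \<in> S" for p
    using Suc.prems that by auto
  have c: "Ck_on k S (\<lambda>p. B (f p) (frechet_derivative g (at p) v) + B (frechet_derivative f (at p) v) (g p))" for v
    by (rule Ck_on_add[OF \<open>open S\<close> Suc.IH Suc.IH]) (use Suc.prems Ck_on_SucD in auto)
  show ?case
    by (rule Ck_on_SucI[OF \<open>open S\<close> bounded_bilinear.FDERIV[OF assms(2)
            frechet_derivative_works[THEN iffD1, OF d(1)] frechet_derivative_works[THEN iffD1, OF d(2)]] c])
qed

lemma Ck_on_inverse: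
  fixes f :: "complex \<Rightarrow> 'a::real_normed_field"
  assumes "open S" "Ck_on k S f" "\<And>p. p \<in> S \<Longrightarrow> f p \<noteq> 0"
  shows "Ck_on k S (\<lambda>p. inverse (f p))"
  using assms(2,3)
proof (induction k)
  case 0
  then show ?case by (auto intro: continuous_on_inverse)
next
  case (Suc k)
  have d: "f differentiable (at p)" if "p \<in> S" for p
    using Suc.prems that by auto
  have "Ck_on k S (\<lambda>p. inverse (f p))"
    using Suc Ck_on_SucD by blast
  then have c: "Ck_on k S (\<lambda>p. - (inverse (f p) * frechet_derivative f (at p) v * inverse (f p)))" for v
    by (intro Ck_on_bounded_bilinear[OF \<open>open S\<close> bounded_bilinear_mult]
        Ck_on_bounded_linear[OF \<open>open S\<close> bounded_linear_minus[OF bounded_linear_ident]])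
      (use Suc.prems in auto)
  show ?case
    by (rule Ck_on_SucI[OF \<open>open S\<close> Deriv.has_derivative_inverse[OF Suc.prems(2) frechet_derivative_works[THEN iffD1, OF d]] c])
qed

lemma Cinf_on_has_derivative:
  "Cinf_on S f \<Longrightarrow> p \<in> S \<Longrightarrow> (f has_derivative frechet_derivative f (at p)) (at p)"
  by (auto simp: Cinf_on_def frechet_derivative_works[symmetric] dest: spec[of _ "Suc 0"])

lemma Cinf_on_frechet_derivative:
  "Cinf_on S f \<Longrightarrow> Cinf_on S (\<lambda>p. frechet_derivative f (at p) v)"
  unfolding Cinf_on_def by (metis Ck_on.simps(2))

lemma Cinf_on_subset: "Cinf_on S f \<Longrightarrow> T \<subseteq> S \<Longrightarrow> Cinf_on T f"
proof -
  have "Ck_on k S f \<Longrightarrow> T \<subseteq> S \<Longrightarrow> Ck_on k T f" for k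
    by (induction k arbitrary: f) (auto intro: continuous_on_subset)
  then show "Cinf_on S f \<Longrightarrow> T \<subseteq> S \<Longrightarrow> Cinf_on T f" by (auto simp: Cinf_on_def)
qed

lemma Cinf_on_cong: "open S \<Longrightarrow> (\<And>p. p \<in> S \<Longrightarrow> f p = g p) \<Longrightarrow> Cinf_on S f \<Longrightarrow> Cinf_on S g"
  unfolding Cinf_on_def using Ck_on_cong by blast

lemma Cinf_on_bounded_linear:
  "open S \<Longrightarrow> bounded_linear L \<Longrightarrow> Cinf_on S f \<Longrightarrow> Cinf_on S (\<lambda>p. L (f p))"
  by (simp add: Cinf_on_def Ck_on_bounded_linear)

lemma Cinf_on_bounded_bilinear:
  "open S \<Longrightarrow> bounded_bilinear B \<Longrightarrow> Cinf_on S f \<Longrightarrow> Cinf_on S g \<Longrightarrow> Cinf_on S (\<lambda>p. B (f p) (g p))"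
  by (simp add: Cinf_on_def Ck_on_bounded_bilinear)

lemma Cinf_on_inverse:
  fixes f :: "complex \<Rightarrow> 'a::real_normed_field"
  shows "open S \<Longrightarrow> Cinf_on S f \<Longrightarrow> (\<And>p. p \<in> S \<Longrightarrow> f p \<noteq> 0) \<Longrightarrow> Cinf_on S (\<lambda>p. inverse (f p))"
  by (simp add: Cinf_on_def Ck_on_inverse)

lemma Cinf_on_add: "open S \<Longrightarrow> Cinf_on S f \<Longrightarrow> Cinf_on S g \<Longrightarrow> Cinf_on S (\<lambda>p. f p + g p)"
  by (simp add: Cinf_on_def Ck_on_add)

lemma Cinf_on_diff:
  assumes "open S" "Cinf_on S f" "Cinf_on S g"
  shows "Cinf_on S (\<lambda>p. f p - g p)"
  using Cinf_on_add[OF assms(1,2) Cinf_on_bounded_linear[OF assms(1) bounded_linear_minus[OF bounded_linear_ident] assms(3)]]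
  by simp

text \<open>Both sides of the flatness condition are alternating in the two directions, so in the
  plane they are determined by the pair \<open>1\<close>, \<open>\<i>\<close>, and one equation
  between the components suffices. The base point is common to all initial values, as a frame
  requires.\<close>

lemma flat_section_plane:
  fixes E1 E2 :: "complex \<Rightarrow> 'a::{real_inner,banach} \<Rightarrow>\<^sub>L 'a"
  assumes D: "open D" "simply_connected D" "D \<noteq> {}"
    and E: "Cinf_on D E1" "Cinf_on D E2"
    and flat: "\<And>p. p \<in> D \<Longrightarrow> frechet_derivative E2 (at p) 1 - frechet_derivative E1 (at p) \<i>
      = (E1 p o\<^sub>L E2 p) - (E2 p o\<^sub>L E1 p)"
  shows "\<exists>p0\<in>D. \<forall>x0. \<exists>X. X p0 = x0 \<and>
    (\<forall>p\<in>D. (X has_derivative (\<lambda>v. Re v *\<^sub>R E1 p (X p) + Im v *\<^sub>R E2 p (X p))) (at p))"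
proof -
  define lin :: "('a \<Rightarrow>\<^sub>L 'a) \<Rightarrow> ('a \<Rightarrow>\<^sub>L 'a) \<Rightarrow> complex \<Rightarrow>\<^sub>L ('a \<Rightarrow>\<^sub>L 'a)" where
    "lin A B = (blinfun_scaleR_left A o\<^sub>L Blinfun Re) + (blinfun_scaleR_left B o\<^sub>L Blinfun Im)" for A B
  have lin_apply: "lin A B v = Re v *\<^sub>R A + Im v *\<^sub>R B" for A B v
    by (simp add: lin_def plus_blinfun.rep_eq bounded_linear_Blinfun_apply[OF bounded_linear_Re]
        bounded_linear_Blinfun_apply[OF bounded_linear_Im])
  define \<omega> where "\<omega> p = lin (E1 p) (E2 p)" for p
  define W where "W p h = lin (frechet_derivative E1 (at p) h) (frechet_derivative E2 (at p) h)" for p h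
  have W: "(\<omega> has_derivative W p) (at p)" if "p \<in> D" for p
    unfolding \<omega>_def W_def lin_def
    by (intro has_derivative_add bounded_linear.has_derivative[OF
          bounded_linear_compose[OF bounded_bilinear.bounded_linear_left[OF bounded_bilinear_blinfun_compose]
            bounded_linear_blinfun_scaleR_left]] Cinf_on_has_derivative[OF _ that] E)
  define \<omega>' where "\<omega>' p = Blinfun (W p)" for p
  have \<omega>': "blinfun_apply (\<omega>' p) = W p" if "p \<in> D" for p
    unfolding \<omega>'_def by (rule bounded_linear_Blinfun_apply[OF has_derivative_bounded_linear[OF W[OF that]]])
  have dw: "(\<omega> has_derivative \<omega>' p) (at p)" if "p \<in> D" for p
    using W[OF that] \<omega>'[OF that] by simp
  have cE: "continuous_on D (\<lambda>p. frechet_derivative E1 (at p) h)" "continuous_on D (\<lambda>p. frechet_derivative E2 (at p) h)" for h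
    using E by (auto simp: Cinf_on_def dest!: spec[of _ "Suc 0"])
  have cw: "continuous_on D \<omega>'"
  proof (rule continuous_on_blinfun_componentwise)
    have "continuous_on D (\<lambda>p. W p k)" for k
      unfolding W_def lin_def
      by (intro continuous_intros cE bounded_bilinear.continuous_on[OF bounded_bilinear_blinfun_compose]
          bounded_linear.continuous_on[OF bounded_linear_blinfun_scaleR_left])
    then show "continuous_on D (\<lambda>p. \<omega>' p k)" for k
      by (rule continuous_on_eq) (simp add: \<omega>')
  qed
  have fl: "\<omega>' p v w - \<omega>' p w v = (\<omega> p v o\<^sub>L \<omega> p w) - (\<omega> p w o\<^sub>L \<omega> p v)" if p: "p \<in> D" for p v w
  proof -
    interpret d1: bounded_linear "frechet_derivative E1 (at p)"
      using Cinf_on_has_derivative[OF E(1) p] by (rule has_derivative_bounded_linear)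
    interpret d2: bounded_linear "frechet_derivative E2 (at p)"
      using Cinf_on_has_derivative[OF E(2) p] by (rule has_derivative_bounded_linear)
    have e: "Re v *\<^sub>R 1 + Im v *\<^sub>R \<i> = v" for v by (simp add: complex_eq_iff)
    have v: "frechet_derivative E1 (at p) v = Re v *\<^sub>R frechet_derivative E1 (at p) 1 + Im v *\<^sub>R frechet_derivative E1 (at p) \<i>"
      "frechet_derivative E2 (at p) v = Re v *\<^sub>R frechet_derivative E2 (at p) 1 + Im v *\<^sub>R frechet_derivative E2 (at p) \<i>" for v
      unfolding d1.scaleR[symmetric] d2.scaleR[symmetric] d1.add[symmetric] d2.add[symmetric] e
      by (rule refl)+
    have "\<omega>' p v w - \<omega>' p w v = (Re v * Im w - Im v * Re w) *\<^sub>R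
        (frechet_derivative E2 (at p) 1 - frechet_derivative E1 (at p) \<i>)"
      by (simp add: \<omega>'[OF p] W_def lin_apply v[of v] v[of w] algebra_simps)
    also have "\<dots> = (\<omega> p v o\<^sub>L \<omega> p w) - (\<omega> p w o\<^sub>L \<omega> p v)"
      unfolding flat[OF p]
      by (rule blinfun_eqI) (simp add: \<omega>_def lin_apply blinfun.bilinear_simps algebra_simps)
    finally show ?thesis .
  qed
  obtain p0 where "p0 \<in> D" and X: "\<And>x0. \<exists>X. X p0 = x0 \<and> (\<forall>p\<in>D. (X has_derivative (\<lambda>v. \<omega> p v (X p))) (at p))"
    using flat_section_simply_connected[OF D dw cw fl] by metis
  then show ?thesis
    by (intro bexI[of _ p0] allI) (simp_all add: \<omega>_def lin_apply blinfun.bilinear_simps)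
qed

section \<open>Linear algebra of \<open>\<complex>\<^sup>4\<^sub>2\<close>\<close>

lemma bounded_bilinear_bil: "bounded_bilinear bil"
  unfolding bilinear_conv_bounded_bilinear[symmetric]
  by (auto simp: bilinear_def bil_def intro!: linearI simp: algebra_simps scaleR_conv_of_real[where 'a=complex])

lemma bounded_bilinear_smult: "bounded_bilinear ((*s) :: complex \<Rightarrow> complex^4 \<Rightarrow> complex^4)"
  unfolding bilinear_conv_bounded_bilinear[symmetric]
  by (auto simp: bilinear_def vec_eq_iff intro!: linearI simp: algebra_simps scaleR_conv_of_real[where 'a=complex])

lemma bounded_linear_cnj_vec: "bounded_linear cnj_vec"
  unfolding linear_conv_bounded_linear[symmetric]
  by (auto simp: cnj_vec_def vec_eq_iff intro!: linearI)

interpretation bil: bounded_bilinear bil by (rule bounded_bilinear_bil)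
interpretation smult: bounded_bilinear "(*s) :: complex \<Rightarrow> complex^4 \<Rightarrow> complex^4" by (rule bounded_bilinear_smult)
lemmas cnj_vec_add = linear_add[OF bounded_linear.linear[OF bounded_linear_cnj_vec]]
lemmas cnj_vec_diff = linear_diff[OF bounded_linear.linear[OF bounded_linear_cnj_vec]]
lemmas cnj_vec_scaleR = linear_scale[OF bounded_linear.linear[OF bounded_linear_cnj_vec]]

lemma bil_commute: "bil z w = bil w z"
  by (simp add: bil_def mult.commute)

lemma bil_smult [simp]: "bil (c *s z) w = c * bil z w" "bil z (c *s w) = c * bil z w"
  by (simp_all add: bil_def algebra_simps)

lemma cnj_vec_nth [simp]: "cnj_vec z $ i = cnj (z $ i)"
  by (simp add: cnj_vec_def)

lemma cnj_vec_cnj_vec [simp]: "cnj_vec (cnj_vec z) = z"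
  by (simp add: vec_eq_iff)

lemma cnj_vec_smult [simp]: "cnj_vec (c *s z) = cnj c *s cnj_vec z"
  by (simp add: vec_eq_iff)

lemma scaleR_eq_smult: "r *\<^sub>R z = complex_of_real r *s z"
  by (simp add: vec_eq_iff scaleR_conv_of_real[where 'a=complex])

lemma bil_cnj_vec: "bil (cnj_vec z) (cnj_vec w) = cnj (bil z w)"
  by (simp add: bil_def)

lemma bil_cnj_vec_left: "bil (cnj_vec z) w = cnj (bil z (cnj_vec w))"
  by (simp add: bil_def)

lemma bounded_bilinear_add:
  assumes "bounded_bilinear f" "bounded_bilinear g"
  shows "bounded_bilinear (\<lambda>x y. f x y + g x y)"
proof -
  interpret f: bounded_bilinear f by fact
  interpret g: bounded_bilinear g by fact
  obtain K L where "\<And>a b. norm (f a b) \<le> norm a * norm b * K" "\<And>a b. norm (g a b) \<le> norm a * norm b * L"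
    using f.bounded g.bounded by blast
  then have "norm (f a b + g a b) \<le> norm a * norm b * (K + L)" for a b
    by (simp add: distrib_left norm_triangle_le add_mono)
  then show ?thesis
    by unfold_locales
      (auto simp: f.add_left f.add_right g.add_left g.add_right f.scaleR_left f.scaleR_right
        g.scaleR_left g.scaleR_right scaleR_add_right)
qed

text \<open>The element of the orthogonal Lie algebra of \<open>bil\<close> that belongs to the
  bivector of \<open>a\<close> and \<open>b\<close>. It is a bounded linear function so that it can
  serve as a value of a connection form.\<close>

definition wedge :: "complex^4 \<Rightarrow> complex^4 \<Rightarrow> (complex^4) \<Rightarrow>\<^sub>L (complex^4)" where
  "wedge a b = Blinfun (\<lambda>X. bil b X *s a - bil a X *s b)"

lemma wedge_apply: "wedge a b X = bil b X *s a - bil a X *s b"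
proof -
  have "bounded_linear (\<lambda>X. bil b X *s a - bil a X *s b)"
    by (intro bounded_linear_sub bounded_linear_compose[OF smult.bounded_linear_left bil.bounded_linear_right])
  then show ?thesis by (simp add: wedge_def bounded_linear_Blinfun_apply)
qed

lemma bounded_bilinear_wedge: "bounded_bilinear wedge"
proof
  show "wedge (a + a') b = wedge a b + wedge a' b" for a a' b
    by (rule blinfun_eqI)
      (simp add: wedge_apply plus_blinfun.rep_eq bil.add_left smult.add_left smult.add_right algebra_simps)
  show "wedge a (b + b') = wedge a b + wedge a b'" for a b b'
    by (rule blinfun_eqI)
      (simp add: wedge_apply plus_blinfun.rep_eq bil.add_left smult.add_left smult.add_right algebra_simps)
  show "wedge (r *\<^sub>R a) b = r *\<^sub>R wedge a b" "wedge a (r *\<^sub>R b) = r *\<^sub>R wedge a b" for r a b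
    by (rule blinfun_eqI, simp add: wedge_apply scaleR_blinfun.rep_eq bil.scaleR_left smult.scaleR_left smult.scaleR_right algebra_simps)+
  obtain K1 where K1: "0 \<le> K1" "\<And>a b. norm (bil a b) \<le> norm a * norm b * K1"
    using bil.nonneg_bounded by blast
  obtain K2 where K2: "0 \<le> K2" "\<And>a (b::complex^4). norm (a *s b) \<le> norm a * norm b * K2"
    using smult.nonneg_bounded by blast
  have "norm (wedge a b) \<le> norm a * norm b * (2 * K1 * K2)" for a b
  proof (rule norm_blinfun_bound)
    fix X
    have *: "norm (bil b X *s a) \<le> norm a * norm b * K1 * K2 * norm X" for a b :: "complex^4"
    proof -
      have "norm (bil b X *s a) \<le> norm (bil b X) * norm a * K2" by (rule K2(2))
      also have "\<dots> \<le> (norm b * norm X * K1) * norm a * K2"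
        by (rule mult_right_mono[OF mult_right_mono[OF K1(2) norm_ge_zero] K2(1)])
      finally show ?thesis by (simp add: mult_ac)
    qed
    have "norm (wedge a b X) \<le> norm (bil b X *s a) + norm (bil a X *s b)"
      unfolding wedge_apply by (rule norm_triangle_ineq4)
    with *[of b a] *[of a b] show "norm (wedge a b X) \<le> norm a * norm b * (2 * K1 * K2) * norm X"
      by (simp add: mult_ac)
  qed (use K1 K2 in simp)
  then show "\<exists>K. \<forall>a b. norm (wedge a b) \<le> norm a * norm b * K" by blast
qed

text \<open>\<open>conn F (dF(v))\<close> is \<open>- \<sigma> d\<sigma>(v) / 2\<close> for the reflection \<open>\<sigma>\<close> that is \<open>-1\<close> on the span of
  \<open>F\<close> and its conjugate.\<close>

definition conn :: "complex^4 \<Rightarrow> complex^4 \<Rightarrow> (complex^4) \<Rightarrow>\<^sub>L (complex^4)" where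
  "conn a b = wedge a (cnj_vec b) + wedge (cnj_vec a) b"

lemma bounded_bilinear_conn: "bounded_bilinear conn"
proof -
  have "bounded_bilinear (\<lambda>a b. wedge a (cnj_vec b))" "bounded_bilinear (\<lambda>a b. wedge (cnj_vec a) b)"
    using bounded_bilinear.comp[OF bounded_bilinear_wedge bounded_linear_ident bounded_linear_cnj_vec]
      bounded_bilinear.comp[OF bounded_bilinear_wedge bounded_linear_cnj_vec bounded_linear_ident] by auto
  from bounded_bilinear_add[OF this] show ?thesis by (simp add: conn_def[abs_def])
qed

interpretation conn: bounded_bilinear conn by (rule bounded_bilinear_conn)

lemma conn_apply: "conn a b X = (bil (cnj_vec b) X *s a - bil a X *s cnj_vec b) + (bil b X *s cnj_vec a - bil (cnj_vec a) X *s b)"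
  by (simp add: conn_def plus_blinfun.rep_eq wedge_apply)

lemma conn_commute: "conn b a = - conn a b"
  by (rule blinfun_eqI) (simp add: conn_apply uminus_blinfun.rep_eq)

lemma conn_self [simp]: "conn a a = 0"
  by (rule blinfun_eqI) (simp add: conn_apply)

text \<open>The reason why parallel frames stay orthonormal.\<close>

lemma bil_conn_skew: "bil (conn a b X) Y + bil X (conn a b Y) = 0"
  by (simp add: conn_apply bil.add_left bil.add_right bil.diff_left bil.diff_right bil_commute)

text \<open>\<open>conn a b\<close> is the sum of a wedge and its conjugate, hence a real
  endomorphism, so real parts of parallel sections are parallel.\<close>

lemma cnj_vec_conn: "cnj_vec (conn a b X) = conn a b (cnj_vec X)"
  by (simp add: conn_apply cnj_vec_add cnj_vec_diff bil_cnj_vec[symmetric])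

text \<open>The commutator of two endomorphisms that exchange \<open>P\<close> and its complement
  preserves both. On \<open>F\<close> it is multiplication by
  \<open>bil w (cnj_vec u) - bil u (cnj_vec w)\<close>, which the Lagrangian condition
  \<open>uw\<close> makes zero; on the complement \<open>conn u w\<close> remains.\<close>

lemma conn_commutator:
  assumes F: "bil F F = 0" "bil F (cnj_vec F) = -1"
    and u: "bil F u = 0" "bil (cnj_vec F) u = 0" and w: "bil F w = 0" "bil (cnj_vec F) w = 0"
    and uw: "bil u (cnj_vec w) = bil w (cnj_vec u)"
  shows "(conn F u o\<^sub>L conn F w) - (conn F w o\<^sub>L conn F u) = conn u w"
proof (rule blinfun_eqI)
  fix X
  have c: "bil F (cnj_vec u) = 0" "bil (cnj_vec F) (cnj_vec u) = 0" "bil F (cnj_vec w) = 0" "bil (cnj_vec F) (cnj_vec w) = 0"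
    "bil (cnj_vec F) (cnj_vec F) = 0"
    using u w F by (simp_all add: bil_cnj_vec bil_cnj_vec_left)
  have s: "bil u F = 0" "bil w F = 0" "bil u (cnj_vec F) = 0" "bil w (cnj_vec F) = 0"
    "bil (cnj_vec u) F = 0" "bil (cnj_vec w) F = 0" "bil (cnj_vec u) (cnj_vec F) = 0" "bil (cnj_vec w) (cnj_vec F) = 0"
    "bil (cnj_vec F) F = -1"
    using u w c F(2) by (simp_all only: bil_commute)
  have uw': "bil (cnj_vec u) w = bil (cnj_vec w) u" using uw by (simp add: bil_commute)
  show "((conn F u o\<^sub>L conn F w) - (conn F w o\<^sub>L conn F u)) X = conn u w X"
    using bil_commute[of "cnj_vec u" "cnj_vec w"] bil_commute[of u w]
    by (simp add: minus_blinfun.rep_eq conn_apply bil.add_right bil.diff_right F u w c s uw uw')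
qed

section \<open>The Hermitian form and the orthogonal projections\<close>

lemma herm_simps:
  "herm (x + y) z = herm x z + herm y z" "herm x (y + z) = herm x y + herm x z"
  "herm (x - y) z = herm x z - herm y z" "herm x (y - z) = herm x y - herm x z"
  "herm (c *s x) y = c * herm x y" "herm x (c *s y) = cnj c * herm x y"
  "herm (r *\<^sub>R x) y = r * herm x y" "herm x (r *\<^sub>R y) = r * herm x y"
  "herm (- x) y = - herm x y" "herm x (- y) = - herm x y"
  by (simp_all add: herm_def bil.add_left bil.add_right bil.diff_left bil.diff_right cnj_vec_add cnj_vec_diff
      cnj_vec_scaleR bil.scaleR_left bil.scaleR_right scaleR_conv_of_real[where 'a=complex] bil.minus_left bil.minus_right
      linear_neg[OF bounded_linear.linear[OF bounded_linear_cnj_vec]])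

lemma herm_cnj: "cnj (herm x y) = herm y x"
  by (simp add: herm_def bil_def mult.commute)

lemma herm_cnj_vec: "herm x (cnj_vec y) = bil x y" "herm (cnj_vec x) y = cnj (bil x y)"
  by (simp_all add: herm_def bil_cnj_vec)

lemma bounded_bilinear_herm: "bounded_bilinear herm"
  using bounded_bilinear.comp[OF bounded_bilinear_bil bounded_linear_ident bounded_linear_cnj_vec]
  by (simp add: herm_def[abs_def])

lemma metric_simps:
  "metric (x + y) z = metric x z + metric y z" "metric x (y + z) = metric x y + metric x z"
  "metric (x - y) z = metric x z - metric y z" "metric x (y - z) = metric x y - metric x z"
  "metric (r *\<^sub>R x) y = r * metric x y" "metric x (r *\<^sub>R y) = r * metric x y"
  by (simp_all add: metric_def herm_simps)

lemma metric_commute: "metric x y = metric y x"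
  using arg_cong[OF herm_cnj[of x y], of Re] by (simp add: metric_def)

lemma unit_mult_cnj:
  assumes "cmod c = 1"
  shows "c * cnj c = 1" "c * (cnj c * z) = z" "cnj c * (c * z) = z"
proof -
  show "c * cnj c = 1" using assms complex_norm_square[of c] by simp
  then show "c * (cnj c * z) = z" "cnj c * (c * z) = z"
    by (simp_all add: mult.assoc[symmetric] mult.commute)
qed

lemma metric_unit_smult: "cmod c = 1 \<Longrightarrow> metric (c *s x) (c *s y) = metric x y"
  unfolding metric_def herm_simps by (simp only: unit_mult_cnj)

lemma metric_nondegenerate:
  assumes "\<And>y. metric x y = 0"
  shows "x = 0"
proof -
  \<comment> \<open>Flipping the signs of the two negative coordinates of \<open>x\<close> turns the
    pairing with \<open>x\<close> into the Euclidean square norm.\<close>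
  have "metric x (\<chi> i. if i = 1 \<or> i = 2 then - x $ i else x $ i) =
      (cmod (x$1))\<^sup>2 + (cmod (x$2))\<^sup>2 + (cmod (x$3))\<^sup>2 + (cmod (x$4))\<^sup>2"
    unfolding cmod_power2 by (simp add: metric_def herm_def bil_def power2_eq_square)
  then have "x $ 1 = 0 \<and> x $ 2 = 0 \<and> x $ 3 = 0 \<and> x $ 4 = 0"
    using assms by (simp add: add_nonneg_eq_0_iff)
  then show ?thesis by (simp add: vec_eq_iff forall_4)
qed

text \<open>The two real conditions are the real and imaginary parts of one complex
  equation.\<close>

lemma horizontal_iff: "X \<in> horizontal v \<longleftrightarrow> herm X v = 0"
  by (simp add: horizontal_def metric_def herm_simps complex_eq_iff)

lemma horizontal_Q_iff: "X \<in> horizontal_Q v \<longleftrightarrow> herm X v = 0 \<and> bil X v = 0"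
  by (simp add: horizontal_Q_def horizontal_iff)

text \<open>The form is indefinite, so uniqueness of the projection rests on \<open>nondeg\<close>
  instead of positivity.\<close>

lemma oproj_eqI:
  assumes "Y \<in> S" "\<And>Z. Z \<in> S \<Longrightarrow> metric (X - Y) Z = 0"
    and diff: "\<And>Y Z. Y \<in> S \<Longrightarrow> Z \<in> S \<Longrightarrow> Y - Z \<in> S"
    and nondeg: "\<And>V. V \<in> S \<Longrightarrow> (\<And>Z. Z \<in> S \<Longrightarrow> metric V Z = 0) \<Longrightarrow> V = 0"
  shows "oproj S X = Y"
  unfolding oproj_def
proof (rule the_equality)
  fix Y' assume Y': "Y' \<in> S \<and> (\<forall>Z\<in>S. metric (X - Y') Z = 0)"
  have "Y' - Y = 0"
  proof (rule nondeg)
    fix Z assume "Z \<in> S"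
    then have "metric (X - Y) Z = 0" "metric (X - Y') Z = 0" using assms(2) Y' by auto
    then show "metric (Y' - Y) Z = 0" by (simp add: metric_simps)
  qed (use diff Y' assms(1) in auto)
  then show "Y' = Y" by simp
qed (use assms in auto)

lemma oproj_horizontal:
  assumes v: "herm v v = -1"
  shows "oproj (horizontal v) X = X + herm X v *s v"
proof (rule oproj_eqI)
  show "X + herm X v *s v \<in> horizontal v" for X
    by (simp add: horizontal_iff herm_simps v)
  have ort: "metric (c *s v) Z = 0" if "Z \<in> horizontal v" for c Z
    using that herm_cnj[of Z v] by (simp add: metric_def herm_simps horizontal_iff)
  show "metric (X - (X + herm X v *s v)) Z = 0" if "Z \<in> horizontal v" for Z
  proof -
    have "X - (X + herm X v *s v) = (- herm X v) *s v" by (simp add: vec_eq_iff)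
    then show ?thesis by (simp only: ort[OF that])
  qed
  show "Y - Z \<in> horizontal v" if "Y \<in> horizontal v" "Z \<in> horizontal v" for Y Z
    using that by (simp add: horizontal_iff herm_simps)
  fix V assume V: "V \<in> horizontal v" "\<And>Z. Z \<in> horizontal v \<Longrightarrow> metric V Z = 0"
  show "V = 0"
  proof (rule metric_nondegenerate)
    fix Y
    have "Y + herm Y v *s v \<in> horizontal v" by (simp add: horizontal_iff herm_simps v)
    from V(2)[OF this] ort[OF V(1)] show "metric V Y = 0"
      by (simp add: metric_simps metric_commute[of V "_ *s v"])
  qed
qed

text \<open>For \<open>v\<close> on the quadric with \<open>herm v v = -1\<close>, the vectors
  \<open>v\<close> and \<open>cnj_vec v\<close> are orthogonal of square \<open>-1\<close>, and
  \<open>bil X v\<close> is the product of \<open>X\<close> with \<open>cnj_vec v\<close>. This is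
  then the projection onto the complement of their span, with plus signs because both squares are
  negative.\<close>

definition projQ :: "complex^4 \<Rightarrow> complex^4 \<Rightarrow> complex^4" where
  "projQ v X = X + herm X v *s v + bil X v *s cnj_vec v"

lemma oproj_horizontal_Q:
  assumes v: "herm v v = -1" "bil v v = 0"
  shows "oproj (horizontal_Q v) X = projQ v X"
proof (rule oproj_eqI)
  have v': "herm (cnj_vec v) v = 0" "bil (cnj_vec v) v = -1"
    using v by (simp_all add: herm_cnj_vec) (simp add: herm_def bil_commute)
  show mem: "projQ v X \<in> horizontal_Q v" for X
    by (simp add: projQ_def horizontal_Q_iff herm_simps bil.add_left v v')
  have ort: "metric (c *s v + d *s cnj_vec v) Z = 0" if "Z \<in> horizontal_Q v" for c d Z
    using that herm_cnj[of Z v] by (simp add: metric_def herm_simps horizontal_Q_iff herm_cnj_vec bil_commute[of v])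
  show "metric (X - projQ v X) Z = 0" if "Z \<in> horizontal_Q v" for Z
  proof -
    have "X - projQ v X = (- herm X v) *s v + (- bil X v) *s cnj_vec v" by (simp add: vec_eq_iff projQ_def)
    then show ?thesis by (simp only: ort[OF that])
  qed
  show "Y - Z \<in> horizontal_Q v" if "Y \<in> horizontal_Q v" "Z \<in> horizontal_Q v" for Y Z
    using that by (simp add: horizontal_Q_iff herm_simps bil.diff_left)
  fix V assume V: "V \<in> horizontal_Q v" "\<And>Z. Z \<in> horizontal_Q v \<Longrightarrow> metric V Z = 0"
  show "V = 0"
  proof (rule metric_nondegenerate)
    fix Y
    from V(2)[OF mem[of Y]] ort[OF V(1), of "herm Y v" "bil Y v"] show "metric V Y = 0"
      by (simp add: metric_simps projQ_def metric_commute[of V])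
  qed
qed

lemma projQ_smult:
  assumes "cmod c = 1"
  shows "projQ (c *s v) (c *s X) = c *s projQ v X"
proof -
  have c: "c * (c * (cnj c * z)) = c * z" for z by (simp only: unit_mult_cnj[OF assms])
  show ?thesis by (simp add: projQ_def herm_simps smult.add_right mult_ac) (simp only: c)
qed

lemma projQ_add: "projQ v (X + Y) = projQ v X + projQ v Y"
  by (simp add: projQ_def herm_simps bil.add_left smult.add_left)

section \<open>Geometry in terms of horizontal lifts\<close>

lemma frechet_derivative_Re_Im:
  assumes "Cinf_on D F" "q \<in> D"
  shows "frechet_derivative F (at q) v = Re v *\<^sub>R frechet_derivative F (at q) 1 + Im v *\<^sub>R frechet_derivative F (at q) \<i>"
proof -
  have l: "linear (frechet_derivative F (at q))"
    using Cinf_on_has_derivative[OF assms] by (rule has_derivative_linear)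
  have e: "Re v *\<^sub>R 1 + Im v *\<^sub>R \<i> = v" by (simp add: complex_eq_iff)
  show ?thesis
    unfolding linear_scale[OF l, symmetric] linear_add[OF l, symmetric] e ..
qed

text \<open>Either side says that both partial derivatives are orthogonal to \<open>y\<close>;
  \<open>d_z\<close> and \<open>d_zbar\<close> are invertible complex combinations of these.\<close>

lemma herm_frechet_derivative_eq_0_iff:
  assumes "Cinf_on D F" "q \<in> D"
  shows "(\<forall>v. herm (frechet_derivative F (at q) v) y = 0) \<longleftrightarrow>
    bil (d_z F q) (cnj_vec y) = 0 \<and> bil (d_zbar F q) (cnj_vec y) = 0"
proof -
  define a b where "a = herm (frechet_derivative F (at q) 1) y" and "b = herm (frechet_derivative F (at q) \<i>) y"
  have h: "herm (frechet_derivative F (at q) v) y = Re v * a + Im v * b" for v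
    by (subst frechet_derivative_Re_Im[OF assms]) (simp add: herm_simps a_def b_def)
  have "bil (d_z F q) (cnj_vec y) = (a - \<i> * b) / 2" "bil (d_zbar F q) (cnj_vec y) = (a + \<i> * b) / 2"
    unfolding herm_def[symmetric] d_z_def d_zbar_def by (simp_all add: herm_simps a_def b_def)
  moreover have "(\<forall>v. complex_of_real (Re v) * a + Im v * b = 0) \<longleftrightarrow> a = 0 \<and> b = 0"
    by (auto dest: spec[of _ 1] spec[of _ \<i>])
  moreover have "a = 0 \<and> b = 0 \<longleftrightarrow> (a - \<i> * b) / 2 = 0 \<and> (a + \<i> * b) / 2 = 0"
  proof (intro iffI conjI; elim conjE)
    assume h: "(a - \<i> * b) / 2 = 0" "(a + \<i> * b) / 2 = 0"
    have "a = (a - \<i> * b) / 2 + (a + \<i> * b) / 2" by (simp add: field_simps)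
    with h show "a = 0" by simp
    with h show "b = 0" by simp
  qed auto
  ultimately show ?thesis unfolding h by (simp only:)
qed

lemma horizontal_lift_iff:
  "horizontal_lift D f F \<longleftrightarrow> Cinf_on D F \<and>
    (\<forall>p\<in>D. herm (F p) (F p) = -1 \<and> cline (F p) = f p \<and> (\<forall>v. herm (frechet_derivative F (at p) v) (F p) = 0))"
  unfolding horizontal_lift_def H73_def mem_Collect_eq
  by (intro conj_cong refl ball_cong) (simp only: herm_frechet_derivative_eq_0_iff)

lemma cline_eq: "cline z = range (\<lambda>c. c *s z)"
  by (simp add: cline_def vec.span_singleton)

text \<open>The geometric quantities all depend on the choice \<open>lift_at\<close>. Its ratio
  \<open>c\<close> to \<open>F\<close> is stationary at \<open>p\<close> since both lifts are
  horizontal there. At other points the derivative of \<open>c\<close> contributes only along the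
  fibre, which \<open>hdiff\<close> projects away. The formula for \<open>hdiff\<close> is needed on
  a neighbourhood because \<open>cov_deriv\<close> differentiates it.\<close>

lemma lift_at_gauge:
  assumes D: "open D" "p \<in> D" and F: "horizontal_lift D f F"
  obtains c U where "open U" "p \<in> U" "U \<subseteq> D" "(c has_derivative (\<lambda>_. 0)) (at p)"
    "\<And>q. q \<in> U \<Longrightarrow> cmod (c q) = 1" "\<And>q. q \<in> U \<Longrightarrow> lift_at f p q = c q *s F q"
    "\<And>q v. q \<in> U \<Longrightarrow> hdiff (lift_at f p) q v = c q *s frechet_derivative F (at q) v"
proof -
  have CF: "Cinf_on D F" and FF: "\<And>q. q \<in> D \<Longrightarrow> herm (F q) (F q) = -1" and Ff: "\<And>q. q \<in> D \<Longrightarrow> cline (F q) = f q"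
    and hF: "\<And>q v. q \<in> D \<Longrightarrow> herm (frechet_derivative F (at q) v) (F q) = 0"
    using F by (auto simp: horizontal_lift_iff)
  have "is_lift_at f p F"
    unfolding is_lift_at_def using D CF FF Ff hF by (auto simp: H73_def horizontal_iff)
  then have "is_lift_at f p (lift_at f p)" unfolding lift_at_def by (rule someI[of "is_lift_at f p"])
  then obtain U' where U': "open U'" "p \<in> U'" "Cinf_on U' (lift_at f p)"
    "\<And>q. q \<in> U' \<Longrightarrow> herm (lift_at f p q) (lift_at f p q) = -1 \<and> cline (lift_at f p q) = f q"
    and hG: "\<And>v. herm (frechet_derivative (lift_at f p) (at p) v) (lift_at f p p) = 0"
    by (auto simp: is_lift_at_def H73_def horizontal_iff)
  define G where "G = lift_at f p"
  define U where "U = U' \<inter> D"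
  have U: "open U" "p \<in> U" "U \<subseteq> D" "U \<subseteq> U'" using U' D by (auto simp: U_def)
  \<comment> \<open>The sign comes from \<open>herm (F q) (F q) = -1\<close>; written as a product
    of the two lifts, the ratio is visibly differentiable.\<close>
  define c where "c q = - herm (G q) (F q)" for q
  have GF: "G q = c q *s F q" if "q \<in> U" for q
  proof -
    have q: "q \<in> D" "q \<in> U'" using that U by auto
    have "G q \<in> cline (G q)" unfolding cline_eq by (rule image_eqI[of _ _ 1]) auto
    also have "cline (G q) = cline (F q)" using U'(4)[OF q(2)] Ff[OF q(1)] by (simp add: G_def)
    finally obtain k where "G q = k *s F q" by (auto simp: cline_eq)
    then show ?thesis using FF[OF q(1)] by (simp add: c_def herm_simps)
  qed
  have c1: "c q * cnj (c q) = 1" if "q \<in> U" for q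
  proof -
    have "herm (G q) (G q) = -1" using U'(4) that U by (auto simp: G_def)
    moreover have "q \<in> D" using that U by auto
    ultimately show ?thesis using FF[of q] unfolding GF[OF that] by (simp add: herm_simps mult.commute)
  qed
  have cmod: "cmod (c q) = 1" if "q \<in> U" for q
  proof -
    have "complex_of_real ((cmod (c q))\<^sup>2) = 1" using c1[OF that] complex_norm_square[of "c q"] by simp
    then have "(cmod (c q))\<^sup>2 = 1" by (simp only: of_real_eq_1_iff)
    then show ?thesis using norm_ge_zero[of "c q"] by (auto simp: power2_eq_1_iff)
  qed
  define dc where "dc q h = - (herm (G q) (frechet_derivative F (at q) h) + herm (frechet_derivative G (at q) h) (F q))" for q h
  have dc: "(c has_derivative dc q) (at q)" if "q \<in> U" for q
  proof -
    have q: "q \<in> D" "q \<in> U'" using that U by auto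
    show ?thesis
      unfolding c_def dc_def
      by (intro has_derivative_minus bounded_bilinear.FDERIV[OF bounded_bilinear_herm]
          Cinf_on_has_derivative[OF CF q(1)] Cinf_on_has_derivative[OF U'(3)[folded G_def] q(2)])
  qed
  have dG: "frechet_derivative G (at q) h = c q *s frechet_derivative F (at q) h + dc q h *s F q" if q: "q \<in> U" for q h
  proof -
    have "((\<lambda>q. c q *s F q) has_derivative (\<lambda>h. c q *s frechet_derivative F (at q) h + dc q h *s F q)) (at q)"
      by (rule bounded_bilinear.FDERIV[OF bounded_bilinear_smult dc[OF q] Cinf_on_has_derivative[OF CF]]) (use q U in auto)
    then have "(G has_derivative (\<lambda>h. c q *s frechet_derivative F (at q) h + dc q h *s F q)) (at q)"
      by (rule has_derivative_transform_within_open[OF _ U(1) q]) (simp add: GF)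
    from fun_cong[OF frechet_derivative_at[OF this, symmetric], of h] show ?thesis .
  qed
  show thesis
  proof (rule that[of U c])
    have "dc p h = 0" for h
    proof -
      have "cnj (c p) * herm (frechet_derivative G (at p) h) (F p) = 0"
        using hG[of h] by (simp add: G_def[symmetric] GF[OF U(2)] herm_simps)
      then have "herm (frechet_derivative G (at p) h) (F p) = 0" using c1[OF U(2)] by auto
      moreover have "herm (F p) (frechet_derivative F (at p) h) = 0"
        using hF[OF D(2), of h] herm_cnj by (metis complex_cnj_zero)
      ultimately show ?thesis by (simp add: dc_def GF[OF U(2)] herm_simps)
    qed
    then have "dc p = (\<lambda>_. 0)" by (rule ext)
    then show "(c has_derivative (\<lambda>_. 0)) (at p)" using dc[OF U(2)] by simp
    fix q v assume q: "q \<in> U"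
    then have qD: "q \<in> D" using U by auto
    show "lift_at f p q = c q *s F q" using GF[OF q] by (simp add: G_def)
    have "herm (G q) (G q) = -1" using U'(4) q U by (auto simp: G_def)
    then have "hdiff G q v = frechet_derivative G (at q) v + herm (frechet_derivative G (at q) v) (G q) *s G q"
      by (simp add: hdiff_def oproj_horizontal)
    also have "herm (frechet_derivative G (at q) v) (G q) = - dc q v * cnj (c q)"
      using hF[OF qD] FF[OF qD] by (simp add: dG[OF q] GF[OF q] herm_simps)
    also have "(- dc q v * cnj (c q)) *s G q = - dc q v *s F q"
      using c1[OF q] by (simp add: GF[OF q] mult.assoc mult.commute[of "cnj (c q)"])
    finally show "hdiff (lift_at f p) q v = c q *s frechet_derivative F (at q) v"
      by (simp add: G_def[symmetric] dG[OF q] vec_eq_iff)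
  qed (use U cmod in auto)
qed

text \<open>As the ratio of the lifts is stationary at \<open>p\<close>, it behaves like a constant
  when \<open>hdiff\<close> is differentiated, so the same unit factor appears in both
  formulas.\<close>

lemma lift_quantities:
  assumes D: "open D" "p \<in> D" and F: "horizontal_lift D f F" and Q: "bil (F p) (F p) = 0"
  obtains c where "cmod c = 1" "\<And>v. hdiff (lift_at f p) p v = c *s frechet_derivative F (at p) v"
    "\<And>v w. cov_deriv f p v w = c *s projQ (F p) (frechet_derivative (\<lambda>q. frechet_derivative F (at q) w) (at p) v)"
proof -
  obtain c U where U: "open U" "p \<in> U" "U \<subseteq> D" and dc: "(c has_derivative (\<lambda>_. 0)) (at p)"
    and c: "\<And>q. q \<in> U \<Longrightarrow> cmod (c q) = 1" and G: "\<And>q. q \<in> U \<Longrightarrow> lift_at f p q = c q *s F q"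
    and hd: "\<And>q v. q \<in> U \<Longrightarrow> hdiff (lift_at f p) q v = c q *s frechet_derivative F (at q) v"
    by (rule lift_at_gauge[OF D F]) blast
  have CF: "Cinf_on D F" and FF: "herm (F p) (F p) = -1" using F D by (auto simp: horizontal_lift_iff)
  have "cov_deriv f p v w = c p *s projQ (F p) (frechet_derivative (\<lambda>q. frechet_derivative F (at q) w) (at p) v)" for v w
  proof -
    let ?S = "frechet_derivative (\<lambda>q. frechet_derivative F (at q) w) (at p)"
    have "((\<lambda>q. c q *s frechet_derivative F (at q) w) has_derivative (\<lambda>h. c p *s ?S h + 0 *s frechet_derivative F (at p) w)) (at p)"
      by (rule bounded_bilinear.FDERIV[OF bounded_bilinear_smult dc Cinf_on_has_derivative[OF Cinf_on_frechet_derivative[OF CF] D(2)]])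
    then have "((\<lambda>q. hdiff (lift_at f p) q w) has_derivative (\<lambda>h. c p *s ?S h + 0 *s frechet_derivative F (at p) w)) (at p)"
      by (rule has_derivative_transform_within_open[OF _ U(1,2)]) (simp add: hd)
    from frechet_derivative_at[OF this, symmetric]
    have "cov_deriv f p v w = oproj (horizontal_Q (c p *s F p)) (c p *s ?S v)"
      by (simp add: cov_deriv_def Let_def G[OF U(2)])
    also have "\<dots> = projQ (c p *s F p) (c p *s ?S v)"
      using unit_mult_cnj(1)[OF c[OF U(2)]]
      by (intro oproj_horizontal_Q) (simp_all add: herm_simps FF Q mult.commute)
    finally show ?thesis by (simp add: projQ_smult c[OF U(2)])
  qed
  with c[OF U(2)] hd[OF U(2)] show thesis by (rule that)
qed

lemma induced_metric_eq:
  assumes "open D" "p \<in> D" "horizontal_lift D f F" "bil (F p) (F p) = 0"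
  shows "induced_metric f p v w = metric (frechet_derivative F (at p) v) (frechet_derivative F (at p) w)"
proof -
  obtain c where "cmod c = 1" "\<And>v. hdiff (lift_at f p) p v = c *s frechet_derivative F (at p) v"
    by (rule lift_quantities[OF assms]) blast
  then show ?thesis by (simp add: induced_metric_def metric_unit_smult)
qed

lemma induced_Kaehler_form_eq:
  assumes "open D" "p \<in> D" "horizontal_lift D f F" "bil (F p) (F p) = 0"
  shows "induced_Kaehler_form f p v w = metric (\<i> *s frechet_derivative F (at p) v) (frechet_derivative F (at p) w)"
proof -
  obtain c where c: "cmod c = 1" "\<And>v. hdiff (lift_at f p) p v = c *s frechet_derivative F (at p) v"
    by (rule lift_quantities[OF assms]) blast
  have "\<i> *s (c *s x) = c *s (\<i> *s x)" for x :: "complex^4" by (simp add: mult.commute)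
  then show ?thesis using c by (simp only: induced_Kaehler_form_def metric_unit_smult)
qed

lemma oproj_orthogonal_pair:
  assumes ab: "metric a a = m" "metric b b = m" "metric a b = 0" and m: "m > 0"
  shows "oproj {r *\<^sub>R a + s *\<^sub>R b | r s. True} X = (metric X a / m) *\<^sub>R a + (metric X b / m) *\<^sub>R b"
proof (rule oproj_eqI)
  have ba: "metric b a = 0" using ab(3) metric_commute by simp
  show "(metric X a / m) *\<^sub>R a + (metric X b / m) *\<^sub>R b \<in> {r *\<^sub>R a + s *\<^sub>R b | r s. True}" by blast
  show "metric (X - ((metric X a / m) *\<^sub>R a + (metric X b / m) *\<^sub>R b)) Z = 0" if "Z \<in> {r *\<^sub>R a + s *\<^sub>R b | r s. True}" for Z
    using that m by (auto simp: metric_simps ab ba)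
  show "Y - Z \<in> {r *\<^sub>R a + s *\<^sub>R b | r s. True}"
    if YZ: "Y \<in> {r *\<^sub>R a + s *\<^sub>R b | r s. True}" "Z \<in> {r *\<^sub>R a + s *\<^sub>R b | r s. True}" for Y Z
  proof -
    from YZ obtain r s r' s' where "Y = r *\<^sub>R a + s *\<^sub>R b" "Z = r' *\<^sub>R a + s' *\<^sub>R b" by blast
    then have "Y - Z = (r - r') *\<^sub>R a + (s - s') *\<^sub>R b" by (simp add: algebra_simps)
    then show ?thesis by blast
  qed
  fix V assume "V \<in> {r *\<^sub>R a + s *\<^sub>R b | r s. True}"
    and 0: "\<And>Z. Z \<in> {r *\<^sub>R a + s *\<^sub>R b | r s. True} \<Longrightarrow> metric V Z = 0"
  then obtain r s where V: "V = r *\<^sub>R a + s *\<^sub>R b" by blast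
  have "metric V V = 0" using V by (intro 0) blast
  then have "m * (r\<^sup>2 + s\<^sup>2) = 0" by (simp add: V metric_simps ab ba power2_eq_square algebra_simps)
  then show "V = 0" using m V by (simp add: sum_power2_eq_zero_iff)
qed

text \<open>In a conformal frame the trace becomes a positive multiple of the normal part of
  \<open>projQ (F p) \<Delta>\<close>, up to the unit factor of the lifts; it vanishes when nothing
  but a tangent vector is left.\<close>

lemma mean_curvature_eq_0_iff:
  assumes D: "open D" "p \<in> D" and F: "horizontal_lift D f F" and Q: "bil (F p) (F p) = 0"
    and conf: "\<And>v w. metric (frechet_derivative F (at p) v) (frechet_derivative F (at p) w) = m * (v \<bullet> w)" and m: "m > 0"
  defines "\<Delta> \<equiv> frechet_derivative (\<lambda>q. frechet_derivative F (at q) 1) (at p) 1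
      + frechet_derivative (\<lambda>q. frechet_derivative F (at q) \<i>) (at p) \<i>"
  shows "mean_curvature f p = 0 \<longleftrightarrow>
    (\<exists>r s. projQ (F p) \<Delta> = r *\<^sub>R frechet_derivative F (at p) 1 + s *\<^sub>R frechet_derivative F (at p) \<i>)"
proof -
  obtain c where c: "cmod c = 1" and hd: "\<And>v. hdiff (lift_at f p) p v = c *s frechet_derivative F (at p) v"
    and cov: "\<And>v w. cov_deriv f p v w = c *s projQ (F p) (frechet_derivative (\<lambda>q. frechet_derivative F (at q) w) (at p) v)"
    by (rule lift_quantities[OF D F Q]) blast
  have CF: "Cinf_on D F" using F by (simp add: horizontal_lift_iff)
  define a b where "a = c *s frechet_derivative F (at p) 1" and "b = c *s frechet_derivative F (at p) \<i>"
  have ab: "metric a a = m" "metric b b = m" "metric a b = 0"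
    by (simp_all add: a_def b_def metric_unit_smult[OF c] conf inner_complex_def)
  have hd_ab: "hdiff (lift_at f p) p v = Re v *\<^sub>R a + Im v *\<^sub>R b" for v
    unfolding hd a_def b_def
    by (subst frechet_derivative_Re_Im[OF CF D(2)]) (simp add: smult.add_right smult.scaleR_right)
  have rng: "range (hdiff (lift_at f p) p) = {r *\<^sub>R a + s *\<^sub>R b | r s. True}"
  proof (intro equalityI subsetI)
    fix x assume "x \<in> {r *\<^sub>R a + s *\<^sub>R b | r s. True}"
    then obtain r s where "x = hdiff (lift_at f p) p (Complex r s)" by (auto simp: hd_ab)
    then show "x \<in> range (hdiff (lift_at f p) p)" by blast
  qed (auto simp: hd_ab)
  \<comment> \<open>The projection to the tangent plane. It is additive and fixes that plane, so
    \<open>W = P W\<close> characterizes membership in it.\<close>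
  define P where "P X = (metric X a / m) *\<^sub>R a + (metric X b / m) *\<^sub>R b" for X
  have sff: "second_fundamental_form f p v w = cov_deriv f p v w - P (cov_deriv f p v w)" for v w
    unfolding second_fundamental_form_def rng P_def by (subst oproj_orthogonal_pair[OF ab m]) simp
  have P_add: "P (X + Y) = P X + P Y" for X Y
    by (simp add: P_def metric_simps add_divide_distrib scaleR_add_left)
  have P_id: "P (r *\<^sub>R a + s *\<^sub>R b) = r *\<^sub>R a + s *\<^sub>R b" for r s
    using m ab metric_commute[of b a] by (simp add: P_def metric_simps)
  have im: "induced_metric f p v w = m * (v \<bullet> w)" for v w
    by (simp add: induced_metric_eq[OF D F Q] conf)
  define W where "W = c *s projQ (F p) \<Delta>"
  have covW: "cov_deriv f p 1 1 + cov_deriv f p \<i> \<i> = W"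
    by (simp add: W_def cov \<Delta>_def projQ_add smult.add_right)
  have "mean_curvature f p = (1 / (2 * m\<^sup>2)) *\<^sub>R (m *\<^sub>R (second_fundamental_form f p 1 1 + second_fundamental_form f p \<i> \<i>))"
    by (simp add: mean_curvature_def Let_def im inner_complex_def power2_eq_square scaleR_add_right)
  then have "mean_curvature f p = 0 \<longleftrightarrow> second_fundamental_form f p 1 1 + second_fundamental_form f p \<i> \<i> = 0"
    using m by simp
  also have "\<dots> \<longleftrightarrow> W = P W"
    unfolding sff covW[symmetric] P_add by (simp add: algebra_simps)
  also have "\<dots> \<longleftrightarrow> (\<exists>r s. W = r *\<^sub>R a + s *\<^sub>R b)"
    using P_id by (auto simp: P_def)
  also have "\<dots> \<longleftrightarrow> (\<exists>r s. projQ (F p) \<Delta> = r *\<^sub>R frechet_derivative F (at p) 1 + s *\<^sub>R frechet_derivative F (at p) \<i>)"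
  proof -
    have "c \<noteq> 0" using c by auto
    have "W = r *\<^sub>R a + s *\<^sub>R b \<longleftrightarrow> projQ (F p) \<Delta> = r *\<^sub>R frechet_derivative F (at p) 1 + s *\<^sub>R frechet_derivative F (at p) \<i>" for r s
    proof -
      have "r *\<^sub>R a + s *\<^sub>R b = c *s (r *\<^sub>R frechet_derivative F (at p) 1 + s *\<^sub>R frechet_derivative F (at p) \<i>)"
        by (simp add: a_def b_def smult.add_right smult.scaleR_right)
      then show ?thesis using \<open>c \<noteq> 0\<close> by (simp only: W_def vector_mul_lcancel simp_thms)
    qed
    then show ?thesis by simp
  qed
  finally show ?thesis .
qed

section \<open>Minimality and the Lagrangian condition as equations for a lift\<close>

definition flat_laplacian :: "(complex \<Rightarrow> complex^4) \<Rightarrow> complex \<Rightarrow> complex^4" where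
  "flat_laplacian F p = frechet_derivative (\<lambda>q. frechet_derivative F (at q) 1) (at p) 1
    + frechet_derivative (\<lambda>q. frechet_derivative F (at q) \<i>) (at p) \<i>"

text \<open>The last condition expresses that the map to the quadric is harmonic.\<close>

definition minimal_lagrangian_lift :: "complex set \<Rightarrow> (complex \<Rightarrow> complex^4) \<Rightarrow> (complex \<Rightarrow> real) \<Rightarrow> bool" where
  "minimal_lagrangian_lift D F m \<longleftrightarrow> Cinf_on D F \<and> (\<forall>p\<in>D. m p > 0 \<and>
     herm (F p) (F p) = -1 \<and> bil (F p) (F p) = 0 \<and>
     (\<forall>v. herm (frechet_derivative F (at p) v) (F p) = 0) \<and>
     (\<forall>v w. herm (frechet_derivative F (at p) v) (frechet_derivative F (at p) w) = complex_of_real (m p * (v \<bullet> w))) \<and>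
     (\<exists>k t. flat_laplacian F p = k *s F p + t *s cnj_vec (F p)))"

lemma derivative_of_constant_product:
  assumes "bounded_bilinear B" "open D" "p \<in> D" "(f has_derivative f') (at p)" "(g has_derivative g') (at p)"
    and "\<And>q. q \<in> D \<Longrightarrow> B (f q) (g q) = k"
  shows "B (f p) (g' h) + B (f' h) (g p) = 0"
proof -
  have "((\<lambda>q. B (f q) (g q)) has_derivative (\<lambda>h. B (f p) (g' h) + B (f' h) (g p))) (at p)"
    by (rule bounded_bilinear.FDERIV[OF assms(1,4,5)])
  then have "((\<lambda>_. k) has_derivative (\<lambda>h. B (f p) (g' h) + B (f' h) (g p))) (at p)"
    by (rule has_derivative_transform_within_open[OF _ assms(2,3)]) (rule assms(6))
  from fun_cong[OF has_derivative_unique[OF this has_derivative_const]] show ?thesis .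
qed

lemma bil_frechet_derivative_eq_0:
  assumes "open D" "p \<in> D" "Cinf_on D F" "\<And>q. q \<in> D \<Longrightarrow> bil (F q) (F q) = 0"
  shows "bil (frechet_derivative F (at p) h) (F p) = 0"
proof -
  note d = Cinf_on_has_derivative[OF assms(3,2)]
  have "bil (F p) (frechet_derivative F (at p) h) + bil (frechet_derivative F (at p) h) (F p) = 0"
    by (rule derivative_of_constant_product[OF bounded_bilinear_bil assms(1,2) d d assms(4)])
  then show ?thesis by (simp add: bil_commute[of "F p"] flip: mult_2)
qed

lemma frechet_derivative_2_commute:
  assumes "open D" "p \<in> D" "Cinf_on D F"
  shows "frechet_derivative (\<lambda>q. frechet_derivative F (at q) v) (at p) w =
    frechet_derivative (\<lambda>q. frechet_derivative F (at q) w) (at p) v"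
  by (rule second_derivative_symmetric[OF assms(1,2) Cinf_on_has_derivative[OF assms(3)]
        Cinf_on_has_derivative[OF Cinf_on_frechet_derivative[OF assms(3)] assms(2)]
        Cinf_on_has_derivative[OF Cinf_on_frechet_derivative[OF assms(3)] assms(2)]])

text \<open>Differentiating horizontality in the direction \<open>v\<close> pairs the second
  derivative in that direction with \<open>F\<close> to minus the square of the first; summing over
  \<open>1\<close> and \<open>\<i>\<close> gives the trace. The resulting coefficient of
  \<open>F\<close> in the Laplacian is real, on which \<open>conn_flat\<close> depends.\<close>

lemma herm_flat_laplacian:
  assumes D: "open D" "p \<in> D" and CF: "Cinf_on D F"
    and hF: "\<And>q v. q \<in> D \<Longrightarrow> herm (frechet_derivative F (at q) v) (F q) = 0"
    and conf: "\<And>v w. herm (frechet_derivative F (at p) v) (frechet_derivative F (at p) w) = complex_of_real (m * (v \<bullet> w))"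
  shows "herm (flat_laplacian F p) (F p) = - complex_of_real (2 * m)"
proof -
  have "herm (frechet_derivative F (at p) v) (frechet_derivative F (at p) v) +
      herm (frechet_derivative (\<lambda>q. frechet_derivative F (at q) v) (at p) v) (F p) = 0" for v
    by (rule derivative_of_constant_product[OF bounded_bilinear_herm D
          Cinf_on_has_derivative[OF Cinf_on_frechet_derivative[OF CF] D(2)] Cinf_on_has_derivative[OF CF D(2)] hF])
  from this[of 1] this[of \<i>] show ?thesis
    by (simp add: flat_laplacian_def herm_simps conf inner_complex_def add_eq_0_iff)
qed

text \<open>Differentiating the conformality relations shows that the second derivatives have no
  tangential trace.\<close>

lemma minimal_lagrangian_liftI:
  assumes D: "open D" and F: "horizontal_lift D f F"
    and Q: "\<And>q. q \<in> D \<Longrightarrow> bil (F q) (F q) = 0"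
    and lag: "lagrangian_on D f" and min: "minimal_on D f" and u: "has_induced_metric D f u"
  shows "minimal_lagrangian_lift D F (\<lambda>p. 2 * exp (u p))"
proof -
  have CF: "Cinf_on D F" and FF: "\<And>q. q \<in> D \<Longrightarrow> herm (F q) (F q) = -1"
    and hF: "\<And>q v. q \<in> D \<Longrightarrow> herm (frechet_derivative F (at q) v) (F q) = 0"
    using F by (auto simp: horizontal_lift_iff)
  define m where "m p = 2 * exp (u p)" for p
  have m: "m p > 0" for p by (simp add: m_def)
  have met: "metric (frechet_derivative F (at q) v) (frechet_derivative F (at q) w) = m q * (v \<bullet> w)" if "q \<in> D" for q v w
    using u[unfolded has_induced_metric_def, rule_format, OF that, of v w]
    by (simp add: induced_metric_eq[OF D that F Q[OF that]] m_def)
  \<comment> \<open>The real part of the Hermitian product is the induced metric, and its imaginary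
    part is, up to sign, the Kaehler form.\<close>
  have conf: "herm (frechet_derivative F (at q) v) (frechet_derivative F (at q) w) = complex_of_real (m q * (v \<bullet> w))" if "q \<in> D" for q v w
    using lag[unfolded lagrangian_on_def, rule_format, OF that, of v w] met[OF that, of v w]
    by (simp add: induced_Kaehler_form_eq[OF D that F Q[OF that]] metric_def herm_simps complex_eq_iff)
  have "\<exists>k t. flat_laplacian F p = k *s F p + t *s cnj_vec (F p)" if p: "p \<in> D" for p
  proof -
    define X where "X q = frechet_derivative F (at q) 1" for q
    define Y where "Y q = frechet_derivative F (at q) \<i>" for q
    define X' where "X' = frechet_derivative X (at p)"
    define Y' where "Y' = frechet_derivative Y (at p)"
    have dX: "(X has_derivative X') (at p)" and dY: "(Y has_derivative Y') (at p)"
      unfolding X'_def Y'_def X_def Y_def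
      using Cinf_on_has_derivative[OF Cinf_on_frechet_derivative[OF CF] p] by auto
    have sym: "X' \<i> = Y' 1"
      unfolding X'_def Y'_def X_def Y_def by (rule frechet_derivative_2_commute[OF D p CF])
    have \<Delta>: "flat_laplacian F p = X' 1 + Y' \<i>"
      unfolding flat_laplacian_def X'_def Y'_def X_def Y_def ..
    obtain r s where rs: "projQ (F p) (flat_laplacian F p) = r *\<^sub>R X p + s *\<^sub>R Y p"
      using mean_curvature_eq_0_iff[OF D p F Q[OF p] met[OF p] m] min p
      unfolding minimal_on_def flat_laplacian_def X_def Y_def by blast
    have XY: "herm (X q) (X q) = m q" "herm (Y q) (Y q) = m q" "herm (X q) (Y q) = 0" "herm (Y q) (X q) = 0" if "q \<in> D" for q
      using conf[OF that] by (simp_all add: X_def Y_def inner_complex_def)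
    have ort: "herm (F p) (X p) = 0" "herm (F p) (Y p) = 0" "bil (F p) (X p) = 0" "bil (F p) (Y p) = 0"
      using hF[OF p, of 1] hF[OF p, of \<i>] herm_cnj[of "X p" "F p"] herm_cnj[of "Y p" "F p"]
        bil_frechet_derivative_eq_0[OF D p CF Q, of 1] bil_frechet_derivative_eq_0[OF D p CF Q, of \<i>]
      by (simp_all add: X_def Y_def bil_commute)
    note const = derivative_of_constant_product[OF bounded_bilinear_herm D p]
    have 1: "herm (X p) (X' h) + herm (X' h) (X p) = herm (Y p) (Y' h) + herm (Y' h) (Y p)" for h
    proof -
      have "((\<lambda>q. herm (X q) (X q) - herm (Y q) (Y q)) has_derivative
          (\<lambda>h. (herm (X p) (X' h) + herm (X' h) (X p)) - (herm (Y p) (Y' h) + herm (Y' h) (Y p)))) (at p)"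
        by (intro has_derivative_diff bounded_bilinear.FDERIV[OF bounded_bilinear_herm] dX dY)
      then have "((\<lambda>q. 0) has_derivative
          (\<lambda>h. (herm (X p) (X' h) + herm (X' h) (X p)) - (herm (Y p) (Y' h) + herm (Y' h) (Y p)))) (at p)"
        by (rule has_derivative_transform_within_open[OF _ D p]) (simp add: XY)
      from fun_cong[OF has_derivative_unique[OF this has_derivative_const], of h] show ?thesis by simp
    qed
    have 2: "herm (X p) (Y' h) + herm (X' h) (Y p) = 0" for h
      by (rule const[OF dX dY]) (rule XY(3))
    have Re_cnj: "Re (herm x y) = Re (herm y x)" for x y
      using metric_commute[of x y] by (simp add: metric_def)
    have "Re (herm (X' h) (X p)) = Re (herm (Y' h) (Y p))" for h
      using arg_cong[OF 1[of h], of Re] Re_cnj[of "X p"] Re_cnj[of "Y p"] by simp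
    from this[of 1] this[of \<i>]
    \<comment> \<open>The derivatives of the two conformality relations are taken in both directions
      \<open>1\<close> and \<open>\<i>\<close>. With the mixed derivative
      \<open>X' \<i> = Y' 1\<close>, they cancel in the components of the Laplacian along
      \<open>X p\<close> and \<open>Y p\<close>.\<close>
    have 3: "Re (herm (X' 1) (X p)) = Re (herm (Y' 1) (Y p))" "Re (herm (Y' 1) (X p)) = Re (herm (Y' \<i>) (Y p))"
      by (simp_all add: sym)
    have 4: "Re (herm (Y' \<i>) (X p)) = - Re (herm (Y' 1) (Y p))" "Re (herm (Y' 1) (X p)) = - Re (herm (X' 1) (Y p))"
      using arg_cong[OF 2[of \<i>], of Re] arg_cong[OF 2[of 1], of Re] Re_cnj[of "X p"] by (simp_all add: sym)
    have "metric (flat_laplacian F p) (X p) = 0" "metric (flat_laplacian F p) (Y p) = 0"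
      using 3 4 by (simp_all add: \<Delta> metric_def herm_simps)
    then have "metric (projQ (F p) (flat_laplacian F p)) (X p) = 0" "metric (projQ (F p) (flat_laplacian F p)) (Y p) = 0"
      using ort by (simp_all add: projQ_def metric_def herm_simps herm_cnj_vec)
    then have "r = 0" "s = 0"
      unfolding rs using m[of p] XY[OF p] by (simp_all add: metric_def herm_simps)
    with rs have "projQ (F p) (flat_laplacian F p) = 0" by simp
    then have "flat_laplacian F p = (- herm (flat_laplacian F p) (F p)) *s F p + (- bil (flat_laplacian F p) (F p)) *s cnj_vec (F p)"
      by (simp add: projQ_def vec_eq_iff add_eq_0_iff2 algebra_simps)
    then show ?thesis by blast
  qed
  then show ?thesis
    unfolding minimal_lagrangian_lift_def m_def[symmetric] using CF FF hF Q conf m by auto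
qed

text \<open>In the derivative of \<open>\<Phi> F\<close> this lets the connection term subtract
  exactly the defect, so that \<open>dF(v / \<mu>)\<close> remains.\<close>

lemma conn_horizontal:
  assumes "bil F F = 0" "bil F (cnj_vec F) = -1" "bil F u = 0" "bil (cnj_vec F) u = 0"
  shows "conn F u F = u"
proof -
  have "bil (cnj_vec u) F = 0" using assms(4) bil_cnj_vec_left[of u F] by (simp add: bil_commute)
  moreover have "bil u F = 0" "bil (cnj_vec F) F = -1" using assms by (simp_all add: bil_commute)
  ultimately show ?thesis using assms by (simp add: conn_apply)
qed

section \<open>The associated family\<close>

locale associated_family =
  fixes D F m and \<mu> :: complex
  assumes D: "open D" and F: "minimal_lagrangian_lift D F m" and \<mu>: "cmod \<mu> = 1"
begin

lemma lift_Cinf: "Cinf_on D F"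
  using F by (simp add: minimal_lagrangian_lift_def)

lemma lift_pointwise:
  assumes "p \<in> D"
  shows "herm (F p) (F p) = -1" "bil (F p) (F p) = 0" "herm (frechet_derivative F (at p) v) (F p) = 0"
    "herm (frechet_derivative F (at p) v) (frechet_derivative F (at p) w) = complex_of_real (m p * (v \<bullet> w))"
    "m p > 0"
  using F assms by (auto simp: minimal_lagrangian_lift_def)

lemma lift_bil:
  assumes "p \<in> D"
  shows "bil (F p) (cnj_vec (F p)) = -1" "bil (F p) (frechet_derivative F (at p) v) = 0"
    "bil (cnj_vec (F p)) (frechet_derivative F (at p) v) = 0"
proof -
  show "bil (F p) (cnj_vec (F p)) = -1" using lift_pointwise(1)[OF assms] by (simp add: herm_def)
  show "bil (F p) (frechet_derivative F (at p) v) = 0"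
    using bil_frechet_derivative_eq_0[OF D assms lift_Cinf lift_pointwise(2)] by (simp add: bil_commute)
  show "bil (cnj_vec (F p)) (frechet_derivative F (at p) v) = 0"
    using lift_pointwise(3)[OF assms, of v] by (simp add: herm_def bil_commute)
qed

lemma lift_laplacian:
  assumes p: "p \<in> D"
  obtains t where "flat_laplacian F p = complex_of_real (2 * m p) *s F p + t *s cnj_vec (F p)"
proof -
  obtain k t where kt: "flat_laplacian F p = k *s F p + t *s cnj_vec (F p)"
    using F p by (auto simp: minimal_lagrangian_lift_def)
  have "herm (flat_laplacian F p) (F p) = - complex_of_real (2 * m p)"
    by (rule herm_flat_laplacian[OF D p lift_Cinf lift_pointwise(3) lift_pointwise(4)[OF p]])
  then have k: "k = complex_of_real (2 * m p)"
    unfolding kt using lift_pointwise(1,2)[OF p] by (simp add: herm_simps herm_cnj_vec)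
  from kt[unfolded k] show thesis by (rule that)
qed

text \<open>Since \<open>\<mu>\<close> is a unit, \<open>cnj \<mu> * v\<close> is
  \<open>v / \<mu>\<close>, so \<open>conn (F p) (defect p v)\<close> is
  \<open>B(v) - B(v / \<mu>)\<close>.\<close>

definition defect :: "complex \<Rightarrow> complex \<Rightarrow> complex^4" where
  "defect p v = frechet_derivative F (at p) v - frechet_derivative F (at p) (cnj \<mu> * v)"

lemma defect_Re_Im:
  assumes "p \<in> D"
  shows "defect p v = Re v *\<^sub>R defect p 1 + Im v *\<^sub>R defect p \<i>"
  unfolding defect_def
  by (subst (1 2 4 6) frechet_derivative_Re_Im[OF lift_Cinf assms]) (simp add: algebra_simps)

lemma Cinf_on_defect: "Cinf_on D (\<lambda>p. defect p v)"
  unfolding defect_def by (intro Cinf_on_diff D Cinf_on_frechet_derivative lift_Cinf)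

lemma bil_defect:
  assumes "p \<in> D"
  shows "bil (F p) (defect p v) = 0" "bil (cnj_vec (F p)) (defect p v) = 0"
  by (simp_all add: defect_def bil.diff_right lift_bil[OF assms])

text \<open>With \<open>a = Re \<mu>\<close> and \<open>b = Im \<mu>\<close>, the exterior
  derivative is \<open>2 * (1 - a)\<close> times \<open>conn (dF(1)) (dF(\<i>))\<close> minus
  \<open>b\<close> times \<open>conn F\<close> of the Laplacian. The commutator is
  \<open>(1 - a)\<^sup>2 + b\<^sup>2\<close> times the same endomorphism. Harmonicity removes the
  Laplacian, and \<open>cmod \<mu> = 1\<close> equates the two coefficients.\<close>

lemma conn_flat:
  assumes p: "p \<in> D"
  defines "E \<equiv> \<lambda>v p. conn (F p) (defect p v)"
  shows "frechet_derivative (E \<i>) (at p) 1 - frechet_derivative (E 1) (at p) \<i> = (E 1 p o\<^sub>L E \<i> p) - (E \<i> p o\<^sub>L E 1 p)"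
proof -
  define a b where "a = Re \<mu>" and "b = Im \<mu>"
  have ab: "a\<^sup>2 + b\<^sup>2 = 1" using \<mu> by (simp add: a_def b_def cmod_def)
  let ?F = "\<lambda>v. frechet_derivative F (at p) v"
  define S where "S v = frechet_derivative (\<lambda>q. frechet_derivative F (at q) v) (at p)" for v
  have S: "((\<lambda>q. frechet_derivative F (at q) v) has_derivative S v) (at p)" for v
    unfolding S_def by (rule Cinf_on_has_derivative[OF Cinf_on_frechet_derivative[OF lift_Cinf] p])
  have sym: "S \<i> 1 = S 1 \<i>"
    unfolding S_def by (rule frechet_derivative_2_commute[OF D p lift_Cinf])
  have def1: "defect q 1 = (1 - a) *\<^sub>R frechet_derivative F (at q) 1 + b *\<^sub>R frechet_derivative F (at q) \<i>"
    and defi: "defect q \<i> = (1 - a) *\<^sub>R frechet_derivative F (at q) \<i> - b *\<^sub>R frechet_derivative F (at q) 1" if "q \<in> D" for q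
    unfolding defect_def
    by (subst (2) frechet_derivative_Re_Im[OF lift_Cinf that], simp add: a_def b_def algebra_simps)+
  have d1: "((\<lambda>q. defect q 1) has_derivative (\<lambda>h. (1 - a) *\<^sub>R S 1 h + b *\<^sub>R S \<i> h)) (at p)"
    by (rule has_derivative_transform_within_open[OF _ D p def1[symmetric]]) (intro derivative_intros S)
  have di: "((\<lambda>q. defect q \<i>) has_derivative (\<lambda>h. (1 - a) *\<^sub>R S \<i> h - b *\<^sub>R S 1 h)) (at p)"
    by (rule has_derivative_transform_within_open[OF _ D p defi[symmetric]]) (intro derivative_intros S)
  note dE = bounded_bilinear.FDERIV[OF bounded_bilinear_conn Cinf_on_has_derivative[OF lift_Cinf p]]
  have E1: "frechet_derivative (E 1) (at p) \<i> = conn (F p) ((1 - a) *\<^sub>R S 1 \<i> + b *\<^sub>R S \<i> \<i>) + conn (?F \<i>) (defect p 1)"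
    using fun_cong[OF frechet_derivative_at[OF dE[OF d1]], of \<i>] by (simp add: E_def)
  have Ei: "frechet_derivative (E \<i>) (at p) 1 = conn (F p) ((1 - a) *\<^sub>R S \<i> 1 - b *\<^sub>R S 1 1) + conn (?F 1) (defect p \<i>)"
    using fun_cong[OF frechet_derivative_at[OF dE[OF di]], of 1] by (simp add: E_def)
  have lap: "conn (F p) (S 1 1 + S \<i> \<i>) = 0"
  proof -
    obtain t where t: "flat_laplacian F p = complex_of_real (2 * m p) *s F p + t *s cnj_vec (F p)"
      by (rule lift_laplacian[OF p])
    \<comment> \<open>The coefficient of \<open>z\<close> is real: for complex \<open>c\<close>,
      \<open>conn z (c *s z)\<close> is \<open>cnj c - c\<close> times
      \<open>wedge z (cnj_vec z)\<close>. The multiple of \<open>cnj_vec z\<close> only yields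
      wedges of proportional vectors.\<close>
    have "conn z (complex_of_real r *s z + t *s cnj_vec z) = 0" for z r
      by (rule blinfun_eqI) (simp add: conn_apply cnj_vec_add bil.add_left smult.add_left smult.add_right vec_eq_iff algebra_simps)
    then have "conn (F p) (flat_laplacian F p) = 0" unfolding t .
    then show ?thesis by (simp only: flat_laplacian_def S_def)
  qed
  have "frechet_derivative (E \<i>) (at p) 1 - frechet_derivative (E 1) (at p) \<i>
      = ((1 - a) *\<^sub>R conn (?F 1) (?F \<i>) + (1 - a) *\<^sub>R conn (?F 1) (?F \<i>)) - b *\<^sub>R conn (F p) (S 1 1 + S \<i> \<i>)"
    unfolding E1 Ei sym def1[OF p] defi[OF p]
    using conn_commute[of "?F \<i>" "?F 1"]
    by (simp add: conn.add_right conn.diff_right conn.scaleR_right algebra_simps)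
  also have "\<dots> = ((1 - a)\<^sup>2 + b\<^sup>2) *\<^sub>R conn (?F 1) (?F \<i>)"
  proof -
    have e: "(1 - a)\<^sup>2 + b\<^sup>2 = (1 - a) + (1 - a)" using ab by (simp add: power2_eq_square algebra_simps)
    show ?thesis unfolding e lap by (simp only: scaleR_add_left scaleR_zero_right diff_zero)
  qed
  also have "\<dots> = conn (defect p 1) (defect p \<i>)"
    unfolding def1[OF p] defi[OF p] using conn_commute[of "?F \<i>" "?F 1"]
      scaleR_add_left[of a a "conn (?F 1) (?F \<i>)", folded mult_2_right]
    by (simp add: conn.add_right conn.diff_right conn.scaleR_right conn.add_left conn.diff_left conn.scaleR_left
        power2_eq_square algebra_simps)
  also have "\<dots> = (E 1 p o\<^sub>L E \<i> p) - (E \<i> p o\<^sub>L E 1 p)"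
    unfolding E_def
  proof (rule conn_commutator[symmetric])
    show "bil (defect p 1) (cnj_vec (defect p \<i>)) = bil (defect p \<i>) (cnj_vec (defect p 1))"
      unfolding herm_def[symmetric] def1[OF p] defi[OF p]
      by (simp add: herm_simps lift_pointwise(4)[OF p] inner_complex_def)
  qed (simp_all add: lift_pointwise lift_bil bil_defect p)
  finally show ?thesis .
qed

end

section \<open>Parallel frames and the deformed lift\<close>

definition eta :: "4 \<Rightarrow> complex" where
  "eta i = (if i = 1 \<or> i = 2 then -1 else 1)"

lemma eta_simps [simp]: "eta i * eta i = 1" "eta i * (eta i * z) = z" "cnj (eta i) = eta i"
  by (simp_all add: eta_def)

lemma bil_sum: "bil x y = (\<Sum>i\<in>UNIV. eta i * x $ i * y $ i)"
  by (simp add: sum_4 eta_def bil_def)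

lemma bil_axis: "bil (axis i 1) X = eta i * X $ i"
proof -
  have "eta k * axis i 1 $ k * X $ k = (if k = i then eta i * X $ i else 0)" for k
    by (simp add: axis_def)
  then show ?thesis by (simp add: bil_sum)
qed

text \<open>Orthonormality makes \<open>B\<close> a right inverse of the frame matrix
  \<open>M\<close>. For square matrices it is then also a left inverse, and this is the expansion of
  \<open>X\<close> in the frame.\<close>

lemma bil_orthonormal_expansion:
  assumes "\<And>i j. bil (\<psi> i) (\<psi> j) = (if i = j then eta i else 0)"
  shows "(\<Sum>i\<in>UNIV. eta i * bil (\<psi> i) X * bil (\<psi> i) Y) = bil X Y"
proof -
  define M :: "complex^4^4" where "M = (\<chi> i j. \<psi> i $ j)"
  define B :: "complex^4^4" where "B = (\<chi> j i. eta j * \<psi> i $ j * eta i)"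
  have "(M ** B) $ i $ k = (mat 1 :: complex^4^4) $ i $ k" for i k
  proof -
    have "(M ** B) $ i $ k = eta k * bil (\<psi> i) (\<psi> k)"
      by (simp add: matrix_matrix_mult_def M_def B_def bil_sum sum_distrib_left mult_ac)
    also have "\<dots> = (mat 1 :: complex^4^4) $ i $ k" by (simp add: assms mat_def)
    finally show ?thesis .
  qed
  then have "M ** B = mat 1" by (simp add: vec_eq_iff)
  then have BM: "B ** M = mat 1" by (simp only: matrix_left_right_inverse)
  define Z :: "complex^4" where "Z = (\<chi> j. eta j * X $ j)"
  have "M *v Z = (\<chi> i. bil (\<psi> i) X)"
    by (simp add: vec_eq_iff matrix_vector_mult_def M_def Z_def bil_sum mult_ac)
  then have "B *v (\<chi> i. bil (\<psi> i) X) = Z"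
    by (metis BM matrix_vector_mul_assoc matrix_vector_mul_lid)
  then have "eta j * X $ j = (\<Sum>i\<in>UNIV. eta j * \<psi> i $ j * eta i * bil (\<psi> i) X)" for j
    by (auto simp: vec_eq_iff matrix_vector_mult_def B_def Z_def)
  then have "bil X Y = (\<Sum>j\<in>UNIV. (\<Sum>i\<in>UNIV. eta j * \<psi> i $ j * eta i * bil (\<psi> i) X) * Y $ j)"
    by (simp add: bil_sum[of X])
  also have "\<dots> = (\<Sum>j\<in>UNIV. \<Sum>i\<in>UNIV. eta i * bil (\<psi> i) X * (eta j * \<psi> i $ j * Y $ j))"
    unfolding sum_distrib_right by (intro sum.cong refl) (simp add: mult_ac)
  also have "\<dots> = (\<Sum>i\<in>UNIV. \<Sum>j\<in>UNIV. eta i * bil (\<psi> i) X * (eta j * \<psi> i $ j * Y $ j))"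
    by (rule sum.swap)
  also have "\<dots> = (\<Sum>i\<in>UNIV. eta i * bil (\<psi> i) X * bil (\<psi> i) Y)"
    by (simp add: bil_sum[of _ Y] sum_distrib_left)
  finally show ?thesis ..
qed

context associated_family
begin

text \<open>The standard basis at \<open>p0\<close> is real and orthonormal; the connection is real
  and skew, so transport keeps both properties.\<close>

lemma parallel_frame:
  assumes "simply_connected D" "D \<noteq> {}"
  obtains p0 \<psi> where "p0 \<in> D" "\<And>i. \<psi> i p0 = axis i 1"
    "\<And>p i. p \<in> D \<Longrightarrow> (\<psi> i has_derivative (\<lambda>v. conn (F p) (defect p v) (\<psi> i p))) (at p)"
    "\<And>p i. p \<in> D \<Longrightarrow> cnj_vec (\<psi> i p) = \<psi> i p"
    "\<And>p i j. p \<in> D \<Longrightarrow> bil (\<psi> i p) (\<psi> j p) = (if i = j then eta i else 0)"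
proof -
  have E: "Cinf_on D (\<lambda>p. conn (F p) (defect p v))" for v
    by (intro Cinf_on_bounded_bilinear[OF D bounded_bilinear_conn] lift_Cinf Cinf_on_defect)
  have "\<exists>p0\<in>D. \<forall>x0. \<exists>X. X p0 = x0 \<and> (\<forall>p\<in>D. (X has_derivative
      (\<lambda>v. Re v *\<^sub>R conn (F p) (defect p 1) (X p) + Im v *\<^sub>R conn (F p) (defect p \<i>) (X p))) (at p))"
    by (rule flat_section_plane[OF D assms E E conn_flat])
  then obtain p0 where p0: "p0 \<in> D" and
    ex: "\<forall>x0. \<exists>X. X p0 = x0 \<and> (\<forall>p\<in>D. (X has_derivative
      (\<lambda>v. Re v *\<^sub>R conn (F p) (defect p 1) (X p) + Im v *\<^sub>R conn (F p) (defect p \<i>) (X p))) (at p))"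
    by (rule bexE)
  from choice[OF ex] obtain Z where Z: "\<forall>x0. Z x0 p0 = x0 \<and> (\<forall>p\<in>D. (Z x0 has_derivative
      (\<lambda>v. Re v *\<^sub>R conn (F p) (defect p 1) (Z x0 p) + Im v *\<^sub>R conn (F p) (defect p \<i>) (Z x0 p))) (at p))"
    by (rule exE)
  define X where "X i = Z (axis i 1)" for i :: 4
  have X0: "X i p0 = axis i 1" and
    X': "p \<in> D \<Longrightarrow> (X i has_derivative
      (\<lambda>v. Re v *\<^sub>R conn (F p) (defect p 1) (X i p) + Im v *\<^sub>R conn (F p) (defect p \<i>) (X i p))) (at p)" for i p
    using spec[OF Z, of "axis i 1"] by (simp_all add: X_def)
  have dX: "(X i has_derivative (\<lambda>v. conn (F p) (defect p v) (X i p))) (at p)" if "p \<in> D" for i p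
  proof -
    have eq: "(\<lambda>v. conn (F p) (defect p v) (X i p)) =
        (\<lambda>v. Re v *\<^sub>R conn (F p) (defect p 1) (X i p) + Im v *\<^sub>R conn (F p) (defect p \<i>) (X i p))"
      by (rule ext, subst defect_Re_Im[OF that]) (simp add: conn.add_right conn.scaleR_right blinfun.add_left blinfun.add_right blinfun.scaleR_left blinfun.scaleR_right)
    show ?thesis by (subst eq) (rule X'[OF that])
  qed
  \<comment> \<open>Real parts of solutions are again solutions with the same real initial values,
    so realness needs no uniqueness argument.\<close>
  define \<psi> where "\<psi> i p = (1/2) *\<^sub>R (X i p + cnj_vec (X i p))" for i p
  have d\<psi>: "(\<psi> i has_derivative (\<lambda>v. conn (F p) (defect p v) (\<psi> i p))) (at p)" if p: "p \<in> D" for i p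
  proof -
    have "(\<psi> i has_derivative (\<lambda>v. (1/2) *\<^sub>R (conn (F p) (defect p v) (X i p) + cnj_vec (conn (F p) (defect p v) (X i p))))) (at p)"
      unfolding \<psi>_def
      by (intro derivative_intros dX[OF p] bounded_linear.has_derivative[OF bounded_linear_cnj_vec])
    then show ?thesis
      by (simp add: \<psi>_def cnj_vec_conn blinfun.add_left blinfun.add_right blinfun.scaleR_left blinfun.scaleR_right)
  qed
  have \<psi>0: "\<psi> i p0 = axis i 1" for i
    by (simp add: \<psi>_def X0 vec_eq_iff axis_def scaleR_conv_of_real[where 'a=complex])
  have "bil (\<psi> i p) (\<psi> j p) = bil (\<psi> i p0) (\<psi> j p0)" if p: "p \<in> D" for i j p
  proof (rule has_derivative_zero_unique_connected[OF D _ _ p p0, where f="\<lambda>p. bil (\<psi> i p) (\<psi> j p)"])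
    show "connected D" using assms(1) by (rule simply_connected_imp_connected)
    fix q assume q: "q \<in> D"
    have "((\<lambda>p. bil (\<psi> i p) (\<psi> j p)) has_derivative
      (\<lambda>v. bil (\<psi> i q) (conn (F q) (defect q v) (\<psi> j q)) + bil (conn (F q) (defect q v) (\<psi> i q)) (\<psi> j q))) (at q)"
      by (rule bounded_bilinear.FDERIV[OF bounded_bilinear_bil d\<psi>[OF q] d\<psi>[OF q]])
    then show "((\<lambda>p. bil (\<psi> i p) (\<psi> j p)) has_derivative (\<lambda>v. 0)) (at q)"
      by (simp only: add.commute[of "bil (\<psi> i q) _"] bil_conn_skew)
  qed
  then have "bil (\<psi> i p) (\<psi> j p) = (if i = j then eta i else 0)" if "p \<in> D" for i j p
    using that by (simp add: \<psi>0 bil_axis) (simp add: axis_def)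
  moreover have "cnj_vec (\<psi> i p) = \<psi> i p" for i p
    by (simp add: \<psi>_def vec_eq_iff)
  ultimately show thesis using that[OF p0 \<psi>0 d\<psi>] by blast
qed

lemma deformed_lift:
  assumes sc: "simply_connected D" "D \<noteq> {}"
  obtains G p0 where "p0 \<in> D" "G p0 = F p0" "minimal_lagrangian_lift D G m"
    "\<And>p. p \<in> D \<Longrightarrow> alpha G p = (cnj \<mu>)\<^sup>2 * alpha F p" "\<And>p. p \<in> D \<Longrightarrow> beta G p = beta F p"
proof -
  obtain p0 \<psi> where p0: "p0 \<in> D" and \<psi>0: "\<And>i. \<psi> i p0 = axis i 1"
    and d\<psi>: "\<And>p i. p \<in> D \<Longrightarrow> (\<psi> i has_derivative (\<lambda>v. conn (F p) (defect p v) (\<psi> i p))) (at p)"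
    and real: "\<And>p i. p \<in> D \<Longrightarrow> cnj_vec (\<psi> i p) = \<psi> i p"
    and orth: "\<And>p i j. p \<in> D \<Longrightarrow> bil (\<psi> i p) (\<psi> j p) = (if i = j then eta i else 0)"
    by (rule parallel_frame[OF sc]) blast
  \<comment> \<open>Coordinates in the parallel frame, with the signs of the form. Pairing with
    \<open>\<psi> i\<close> moves the connection to the other argument, so \<open>d\<Phi>\<close>
    carries it with a minus sign.\<close>
  define \<Phi> where "\<Phi> p X = (\<Sum>i\<in>UNIV. bil (\<psi> i p) X *s (eta i *s axis i 1))" for p X
  have nth: "\<Phi> p X $ i = eta i * bil (\<psi> i p) X" for p X i
  proof -
    have "(bil (\<psi> k p) X *s (eta k *s axis k 1)) $ i = (if k = i then eta i * bil (\<psi> i p) X else 0)" for k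
      by (simp add: axis_def)
    then show ?thesis by (simp add: \<Phi>_def)
  qed
  have lin: "\<Phi> p (X + Y) = \<Phi> p X + \<Phi> p Y" "\<Phi> p (X - Y) = \<Phi> p X - \<Phi> p Y" "\<Phi> p (c *s X) = c *s \<Phi> p X" for p X Y c
    by (simp_all add: vec_eq_iff nth bil.add_right bil.diff_right algebra_simps)
  have bil_\<Phi>: "bil (\<Phi> p X) (\<Phi> p Y) = bil X Y" if "p \<in> D" for p X Y
    using bil_orthonormal_expansion[OF orth[OF that], of X Y]
    by (simp add: bil_sum[of "\<Phi> p X"] nth mult_ac)
  have cnj_\<Phi>: "cnj_vec (\<Phi> p X) = \<Phi> p (cnj_vec X)" if "p \<in> D" for p X
    by (simp add: vec_eq_iff nth real[OF that] flip: bil_cnj_vec)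
  have herm_\<Phi>: "herm (\<Phi> p X) (\<Phi> p Y) = herm X Y" if "p \<in> D" for p X Y
    by (simp add: herm_def cnj_\<Phi>[OF that] bil_\<Phi>[OF that])
  have d\<Phi>: "((\<lambda>q. \<Phi> q (Y q)) has_derivative (\<lambda>h. \<Phi> p (Y' h - conn (F p) (defect p h) (Y p)))) (at p)"
    if p: "p \<in> D" and Y: "(Y has_derivative Y') (at p)" for p Y Y'
  proof -
    have "((\<lambda>q. \<Phi> q (Y q)) has_derivative (\<lambda>h. \<Sum>i\<in>UNIV.
        (bil (\<psi> i p) (Y' h) + bil (conn (F p) (defect p h) (\<psi> i p)) (Y p)) *s (eta i *s axis i 1))) (at p)"
      unfolding \<Phi>_def
      by (intro has_derivative_sum bounded_linear.has_derivative[OF smult.bounded_linear_left]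
          bounded_bilinear.FDERIV[OF bounded_bilinear_bil d\<psi>[OF p] Y])
    moreover have "bil (conn (F p) (defect p h) (\<psi> i p)) (Y p) = - bil (\<psi> i p) (conn (F p) (defect p h) (Y p))" for i h
      using bil_conn_skew[of "F p" "defect p h" "\<psi> i p" "Y p"] by (simp add: add_eq_0_iff2)
    ultimately show ?thesis by (simp add: \<Phi>_def bil.diff_right)
  qed
  define G where "G p = \<Phi> p (F p)" for p
  let ?F = "\<lambda>p v. frechet_derivative F (at p) v"
  have "(G has_derivative (\<lambda>h. \<Phi> p (?F p (cnj \<mu> * h)))) (at p)" if p: "p \<in> D" for p
  proof -
    have "conn (F p) (defect p h) (F p) = defect p h" for h
      by (rule conn_horizontal) (simp_all add: lift_pointwise lift_bil bil_defect p)
    then show ?thesis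
      using d\<Phi>[OF p Cinf_on_has_derivative[OF lift_Cinf p]] by (simp add: G_def[abs_def] defect_def)
  qed
  note dG = this
  have G': "frechet_derivative G (at p) v = \<Phi> p (?F p (cnj \<mu> * v))" if "p \<in> D" for p v
    using fun_cong[OF frechet_derivative_at[OF dG[OF that]], of v] by simp
  \<comment> \<open>Bootstrapping: the derivative of \<open>\<psi> i\<close> is a smooth coefficient
    applied to \<open>\<psi> i\<close>, so each order of smoothness yields the next.\<close>
  have C\<psi>: "Ck_on k D (\<psi> i)" for k i
  proof (induction k)
    case 0
    have "continuous_on D (\<psi> i)"
      using d\<psi> by (meson continuous_at_imp_continuous_on has_derivative_continuous)
    then show ?case by simp
  next
    case (Suc k)
    have "Cinf_on D (\<lambda>p. conn (F p) (defect p v))" for v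
      by (intro Cinf_on_bounded_bilinear[OF D bounded_bilinear_conn] lift_Cinf Cinf_on_defect)
    then have "Ck_on k D (\<lambda>p. conn (F p) (defect p v) (\<psi> i p))" for v
      by (intro Ck_on_bounded_bilinear[OF D bounded_bilinear_blinfun_apply] Suc) (simp add: Cinf_on_def)
    from Ck_on_SucI[OF D d\<psi> this] show ?case .
  qed
  have CG: "Cinf_on D G"
  proof -
    have "Cinf_on D (\<lambda>p. bil (\<psi> i p) (F p) *s (eta i *s axis i 1))" for i
      by (intro Cinf_on_bounded_linear[OF D smult.bounded_linear_left]
          Cinf_on_bounded_bilinear[OF D bounded_bilinear_bil _ lift_Cinf]) (simp add: Cinf_on_def C\<psi>)
    then show ?thesis
      unfolding G_def[abs_def] \<Phi>_def sum_4 by (intro Cinf_on_add D)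
  qed
  have lap: "\<exists>k t. flat_laplacian G p = k *s G p + t *s cnj_vec (G p)" if p: "p \<in> D" for p
  proof -
    define a b where "a = Re \<mu>" and "b = Im \<mu>"
    define S where "S v = frechet_derivative (\<lambda>q. ?F q v) (at p)" for v
    have S: "((\<lambda>q. ?F q v) has_derivative S v) (at p)" for v
      unfolding S_def by (rule Cinf_on_has_derivative[OF Cinf_on_frechet_derivative[OF lift_Cinf] p])
    have sym: "S \<i> 1 = S 1 \<i>"
      unfolding S_def by (rule frechet_derivative_2_commute[OF D p lift_Cinf])
    have SG: "frechet_derivative (\<lambda>q. frechet_derivative G (at q) w) (at p) v
        = \<Phi> p (S (cnj \<mu> * w) v - conn (F p) (defect p v) (?F p (cnj \<mu> * w)))" for v w
    proof -
      have "((\<lambda>q. frechet_derivative G (at q) w) has_derivative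
          (\<lambda>h. \<Phi> p (S (cnj \<mu> * w) h - conn (F p) (defect p h) (?F p (cnj \<mu> * w))))) (at p)"
        by (rule has_derivative_transform_within_open[OF d\<Phi>[OF p S] D p]) (simp add: G')
      from fun_cong[OF frechet_derivative_at[OF this, symmetric], of v] show ?thesis .
    qed
    \<comment> \<open>The connection maps the complement of \<open>P\<close> into \<open>P\<close>,
      so its terms only alter the coefficients of \<open>F\<close> and its conjugate in the
      Laplacian.\<close>
    have conn_hor: "\<exists>k t. conn (F p) u (?F p w) = k *s F p + t *s cnj_vec (F p)" for u w
      by (simp add: conn_apply lift_bil[OF p]) blast
    have S_lin: "S (cnj \<mu>) h = a *\<^sub>R S 1 h - b *\<^sub>R S \<i> h" "S (cnj \<mu> * \<i>) h = b *\<^sub>R S 1 h + a *\<^sub>R S \<i> h" for h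
    proof -
      have 1: "?F q (cnj \<mu>) = a *\<^sub>R ?F q 1 - b *\<^sub>R ?F q \<i>" "?F q (cnj \<mu> * \<i>) = b *\<^sub>R ?F q 1 + a *\<^sub>R ?F q \<i>" if "q \<in> D" for q
        by (subst frechet_derivative_Re_Im[OF lift_Cinf that], simp add: a_def b_def)+
      have "((\<lambda>q. ?F q (cnj \<mu>)) has_derivative (\<lambda>h. a *\<^sub>R S 1 h - b *\<^sub>R S \<i> h)) (at p)"
        by (rule has_derivative_transform_within_open[OF _ D p 1(1)[symmetric]]) (intro derivative_intros S)
      from fun_cong[OF has_derivative_unique[OF S this]] show "S (cnj \<mu>) h = a *\<^sub>R S 1 h - b *\<^sub>R S \<i> h" .
      have "((\<lambda>q. ?F q (cnj \<mu> * \<i>)) has_derivative (\<lambda>h. b *\<^sub>R S 1 h + a *\<^sub>R S \<i> h)) (at p)"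
        by (rule has_derivative_transform_within_open[OF _ D p 1(2)[symmetric]]) (intro derivative_intros S)
      from fun_cong[OF has_derivative_unique[OF S this]] show "S (cnj \<mu> * \<i>) h = b *\<^sub>R S 1 h + a *\<^sub>R S \<i> h" .
    qed
    obtain k1 t1 k2 t2 where c: "conn (F p) (defect p 1) (?F p (cnj \<mu> * 1)) = k1 *s F p + t1 *s cnj_vec (F p)"
      "conn (F p) (defect p \<i>) (?F p (cnj \<mu> * \<i>)) = k2 *s F p + t2 *s cnj_vec (F p)"
      using conn_hor by metis
    obtain t where t: "flat_laplacian F p = complex_of_real (2 * m p) *s F p + t *s cnj_vec (F p)"
      by (rule lift_laplacian[OF p])
    \<comment> \<open>The second derivatives in the rotated directions sum to \<open>a\<close> times
      the Laplacian of \<open>F\<close>: the mixed terms with factor \<open>b\<close> cancel by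
      symmetry.\<close>
    have "flat_laplacian G p = \<Phi> p (a *\<^sub>R flat_laplacian F p - (k1 + k2) *s F p - (t1 + t2) *s cnj_vec (F p))"
      unfolding flat_laplacian_def[of G] SG c lin(1)[symmetric]
      by (rule arg_cong[of _ _ "\<Phi> p"])
        (simp add: S_lin S_lin(2)[unfolded mult.commute[of "cnj \<mu>"]] sym flat_laplacian_def S_def[symmetric] scaleR_add_right vec_eq_iff algebra_simps)
    also have "\<dots> = (a * (2 * m p) - (k1 + k2)) *s G p + (a * t - (t1 + t2)) *s cnj_vec (G p)"
      unfolding t G_def cnj_\<Phi>[OF p] lin(3)[symmetric] lin(1)[symmetric]
      by (rule arg_cong[of _ _ "\<Phi> p"]) (simp add: scaleR_eq_smult vec_eq_iff algebra_simps)
    finally show ?thesis by blast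
  qed
  have rot: "(cnj \<mu> * v) \<bullet> (cnj \<mu> * w) = v \<bullet> w" for v w
  proof -
    have "Re ((cnj \<mu> * v) * cnj (cnj \<mu> * w)) = Re (\<mu> * (cnj \<mu> * (v * cnj w)))"
      by (simp only: complex_cnj_mult complex_cnj_cnj mult_ac)
    then show ?thesis
      by (simp only: unit_mult_cnj[OF \<mu>]) (simp add: inner_complex_def algebra_simps)
  qed
  have "minimal_lagrangian_lift D G m"
    unfolding minimal_lagrangian_lift_def
    using CG lap by (auto simp: G' G_def herm_\<Phi> bil_\<Phi> lift_pointwise rot)
  \<comment> \<open>The rotation by \<open>cnj \<mu>\<close> multiplies the complex linear part of
    the differential by \<open>cnj \<mu>\<close> and the antilinear part by \<open>\<mu>\<close>.
    Hence \<open>alpha\<close> gains \<open>(cnj \<mu>)\<^sup>2\<close>, while in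
    \<open>beta\<close> the factors cancel.\<close>
  moreover have dz: "d_z G p = cnj \<mu> *s \<Phi> p (d_z F p)" "d_zbar G p = \<mu> *s \<Phi> p (d_zbar F p)" if p: "p \<in> D" for p
  proof -
    define X Y where "X = ?F p 1" and "Y = ?F p \<i>"
    have F1: "?F p (cnj \<mu> * 1) = Re \<mu> *\<^sub>R X - Im \<mu> *\<^sub>R Y" "?F p (cnj \<mu> * \<i>) = Im \<mu> *\<^sub>R X + Re \<mu> *\<^sub>R Y"
      by (subst frechet_derivative_Re_Im[OF lift_Cinf p], simp add: X_def Y_def)+
    have mu: "complex_of_real (Re \<mu>) = \<mu> - \<i> * Im \<mu>" by (simp add: complex_eq_iff)
    have mu': "cnj \<mu> = \<mu> - 2 * \<i> * Im \<mu>" by (simp add: complex_eq_iff)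
    show "d_z G p = cnj \<mu> *s \<Phi> p (d_z F p)"
      unfolding d_z_def G'[OF p] lin(3)[symmetric] lin(2)[symmetric] F1 X_def[symmetric] Y_def[symmetric]
      by (rule arg_cong[of _ _ "\<Phi> p"]) (simp add: scaleR_eq_smult mu mu' vec_eq_iff algebra_simps)
    show "d_zbar G p = \<mu> *s \<Phi> p (d_zbar F p)"
      unfolding d_zbar_def G'[OF p] lin(3)[symmetric] lin(1)[symmetric] F1 X_def[symmetric] Y_def[symmetric]
      by (rule arg_cong[of _ _ "\<Phi> p"]) (simp add: scaleR_eq_smult mu mu' vec_eq_iff algebra_simps)
  qed
  moreover have "alpha G p = (cnj \<mu>)\<^sup>2 * alpha F p" "beta G p = beta F p" if "p \<in> D" for p
    using unit_mult_cnj[OF \<mu>]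
    by (simp_all add: alpha_def beta_def dz[OF that] bil_\<Phi>[OF that] power2_eq_square)
  moreover have "G p0 = F p0"
    by (simp add: vec_eq_iff G_def nth \<psi>0 bil_axis)
  ultimately show thesis using that p0 by blast
qed

end

section \<open>From lifts to maps into the quadric\<close>

lemma smult_mem_cline: "c *s z \<in> cline z"
  unfolding cline_eq by (rule rangeI)

lemma mem_cline_self: "z \<in> cline z"
  using smult_mem_cline[of 1 z] by simp

lemma cline_smult: "c \<noteq> 0 \<Longrightarrow> cline (c *s z) = cline z"
proof -
  assume c: "c \<noteq> 0"
  have "k *s z = (k / c) *s (c *s z)" for k using c by simp
  then have "k *s z \<in> cline (c *s z)" for k unfolding cline_eq by (metis rangeI)
  moreover have "k *s (c *s z) \<in> cline z" for k unfolding cline_eq vector_smult_assoc by (rule rangeI)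
  ultimately show ?thesis unfolding cline_eq by blast
qed

lemma cline_in_chart_dom_iff: "z \<noteq> 0 \<Longrightarrow> cline z \<in> chart_dom j \<longleftrightarrow> z $ j \<noteq> 0"
  unfolding chart_dom_def CP3_def by (auto simp: cline_eq intro: exI[of _ 1])

lemma chart_cline: "z $ j \<noteq> 0 \<Longrightarrow> chart j (cline z) = inverse (z $ j) *s z"
  unfolding chart_def
proof (rule the_equality)
  assume z: "z $ j \<noteq> 0"
  then show "inverse (z $ j) *s z \<in> cline z \<and> (inverse (z $ j) *s z) $ j = 1"
    by (simp add: smult_mem_cline)
  fix v assume v: "v \<in> cline z \<and> v $ j = 1"
  then obtain k where k: "v = k *s z" by (auto simp: cline_eq)
  with v z show "v = inverse (z $ j) *s z" by (auto simp: field_simps)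
qed

lemma smooth_into_CP3_cline:
  assumes D: "open D" and G: "Cinf_on D G" and nz: "\<And>p. p \<in> D \<Longrightarrow> G p \<noteq> 0"
  shows "smooth_into_CP3 D (\<lambda>p. cline (G p))"
  unfolding smooth_into_CP3_def
proof (intro conjI allI)
  show "(\<lambda>p. cline (G p)) ` D \<subseteq> CP3" using nz by (auto simp: CP3_def)
  fix j :: 4
  have dom: "{p \<in> D. cline (G p) \<in> chart_dom j} = {p \<in> D. G p $ j \<noteq> 0}"
    using nz cline_in_chart_dom_iff by blast
  have "continuous_on D (\<lambda>p. G p $ j)"
    using G by (auto simp: Cinf_on_def intro!: continuous_intros dest: spec[of _ 0])
  then have "open (D \<inter> (\<lambda>p. G p $ j) -` (- {0}))"
    using D by (rule continuous_open_preimage) (simp add: open_Compl)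
  then have op: "open {p \<in> D. G p $ j \<noteq> 0}"
    by (rule back_subst[where P="open"]) auto
  then show "open {p \<in> D. cline (G p) \<in> chart_dom j}" unfolding dom .
  have G': "Cinf_on {p \<in> D. G p $ j \<noteq> 0} G" using G by (rule Cinf_on_subset) auto
  have "Cinf_on {p \<in> D. G p $ j \<noteq> 0} (\<lambda>p. inverse (G p $ j) *s G p)"
    by (intro Cinf_on_bounded_bilinear[OF op bounded_bilinear_smult _ G'] Cinf_on_inverse[OF op]
        Cinf_on_bounded_linear[OF op bounded_linear_vec_nth G']) auto
  then have "Cinf_on {p \<in> D. G p $ j \<noteq> 0} (\<lambda>p. chart j (cline (G p)))"
    by (rule Cinf_on_cong[OF op, rotated]) (simp add: chart_cline)
  then show "Cinf_on {p \<in> D. cline (G p) \<in> chart_dom j} (\<lambda>p. chart j (cline (G p)))"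
    unfolding dom .
qed

lemma topspace_CP3_topology: "topspace CP3_topology = CP3"
proof
  show "topspace CP3_topology \<subseteq> CP3"
    using openin_CP3_topology[of "topspace CP3_topology"] by simp
  have "{z. z \<noteq> 0 \<and> cline z \<in> CP3} = - {0}" by (auto simp: CP3_def)
  then have "openin CP3_topology CP3" by (simp add: openin_CP3_topology open_Compl)
  then show "CP3 \<subseteq> topspace CP3_topology" by (rule openin_subset)
qed

text \<open>The equations for \<open>G\<close> put the image in the quadric; its connectedness and
  the single point over \<open>p0\<close> put it in \<open>Q\<close>.\<close>

lemma cline_image_in_component:
  assumes Q: "is_Q2star Q" and D: "connected D" and G: "continuous_on D G"
    and quad: "\<And>p. p \<in> D \<Longrightarrow> herm (G p) (G p) = -1" "\<And>p. p \<in> D \<Longrightarrow> bil (G p) (G p) = 0"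
    and p0: "p0 \<in> D" "cline (G p0) \<in> Q"
  shows "(\<lambda>p. cline (G p)) ` D \<subseteq> Q"
proof -
  define T where "T = {L \<in> CH31. \<forall>z\<in>L. bil z z = 0}"
  have nz: "G p \<noteq> 0" if "p \<in> D" for p
    using quad(1)[OF that] by (auto simp: herm_def bil.zero_left)
  have inT: "cline (G p) \<in> T" if "p \<in> D" for p
    using quad[OF that] by (auto simp: T_def CH31_def cline_eq)
  have "continuous_map (top_of_set D) CP3_topology (\<lambda>p. cline (G p))"
    unfolding continuous_map_def
  proof (intro conjI allI impI)
    show "(\<lambda>p. cline (G p)) \<in> topspace (top_of_set D) \<rightarrow> topspace CP3_topology"
      using nz by (auto simp: topspace_CP3_topology CP3_def)
    fix U assume "openin CP3_topology U"
    then have "openin (top_of_set D) (D \<inter> G -` {z. z \<noteq> 0 \<and> cline z \<in> U})"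
      by (intro continuous_openin_preimage_gen G) (simp add: openin_CP3_topology)
    then show "openin (top_of_set D) {p \<in> topspace (top_of_set D). cline (G p) \<in> U}"
      by (rule back_subst[where P="openin (top_of_set D)"]) (use nz in auto)
  qed
  then have "continuous_map (top_of_set D) (subtopology CP3_topology T) (\<lambda>p. cline (G p))"
    using inT by (auto simp: continuous_map_in_subtopology)
  moreover have "connectedin (top_of_set D) D"
    using D by (simp add: connectedin_subtopology)
  ultimately have "connectedin (subtopology CP3_topology T) ((\<lambda>p. cline (G p)) ` D)"
    by (rule connectedin_continuous_map_image)
  then show ?thesis
    using Q p0 by (intro connected_components_of_maximal[of Q "subtopology CP3_topology T"])
      (auto simp: is_Q2star_def T_def disjnt_iff)
qed

lemma is_Q2star_bil:
  assumes "is_Q2star Q" "cline z \<in> Q"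
  shows "bil z z = 0"
proof -
  have "Q \<subseteq> topspace (subtopology CP3_topology {L \<in> CH31. \<forall>z\<in>L. bil z z = 0})"
    using assms(1) unfolding is_Q2star_def by (rule connected_components_of_subset)
  then show ?thesis using assms(2) mem_cline_self[of z] by auto
qed

section \<open>Rescaled lifts, and the geometry of the projected map\<close>

lemma frechet_derivative_smult:
  fixes F :: "complex \<Rightarrow> complex^4"
  assumes "Cinf_on D F" "p \<in> D"
  shows "frechet_derivative (\<lambda>p. c *s F p) (at p) v = c *s frechet_derivative F (at p) v"
  using fun_cong[OF frechet_derivative_at[OF bounded_linear.has_derivative[OF smult.bounded_linear_right
        Cinf_on_has_derivative[OF assms]], symmetric]] .

lemma horizontal_lift_smult:
  assumes D: "open D" and F: "horizontal_lift D f F" and c: "cmod c = 1"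
  shows "horizontal_lift D f (\<lambda>p. c *s F p)"
proof -
  have CF: "Cinf_on D F" using F by (simp add: horizontal_lift_iff)
  have "c \<noteq> 0" using c by auto
  then show ?thesis
    using F Cinf_on_bounded_linear[OF D smult.bounded_linear_right CF, of c] unit_mult_cnj[OF c]
    by (auto simp: horizontal_lift_iff herm_simps cline_smult frechet_derivative_smult[OF CF] mult.commute)
qed

lemma beta_smult:
  assumes "Cinf_on D F" "p \<in> D"
  shows "beta (\<lambda>p. c *s F p) p = c\<^sup>2 * beta F p"
proof -
  have "d_z (\<lambda>p. c *s F p) p = c *s d_z F p" "d_zbar (\<lambda>p. c *s F p) p = c *s d_zbar F p"
    by (simp_all add: d_z_def d_zbar_def frechet_derivative_smult[OF assms] vec_eq_iff algebra_simps)
  then show ?thesis by (simp add: beta_def power2_eq_square)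
qed

text \<open>The converse of \<open>minimal_lagrangian_liftI\<close>. \<open>G\<close> is itself a
  horizontal lift of its projection, so each geometric quantity can be read off from it; injectivity
  of the differential follows from the positive factor \<open>2 * exp (u p)\<close>.\<close>

lemma minimal_lagrangian_liftD:
  assumes D: "open D" and G: "minimal_lagrangian_lift D G (\<lambda>p. 2 * exp (u p))"
  defines "f \<equiv> \<lambda>p. cline (G p)"
  shows "horizontal_lift D f G" "immersion_on D f" "lagrangian_on D f" "minimal_on D f" "has_induced_metric D f u"
proof -
  have CG: "Cinf_on D G" and GG: "\<And>p. p \<in> D \<Longrightarrow> herm (G p) (G p) = -1" and Q: "\<And>p. p \<in> D \<Longrightarrow> bil (G p) (G p) = 0"
    and hG: "\<And>p v. p \<in> D \<Longrightarrow> herm (frechet_derivative G (at p) v) (G p) = 0"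
    and conf: "\<And>p v w. p \<in> D \<Longrightarrow> herm (frechet_derivative G (at p) v) (frechet_derivative G (at p) w)
      = complex_of_real (2 * exp (u p) * (v \<bullet> w))"
    and lap: "\<And>p. p \<in> D \<Longrightarrow> \<exists>k t. flat_laplacian G p = k *s G p + t *s cnj_vec (G p)"
    using G by (auto simp: minimal_lagrangian_lift_def)
  show hl: "horizontal_lift D f G" using CG GG hG by (simp add: horizontal_lift_iff f_def)
  have met: "metric (frechet_derivative G (at p) v) (frechet_derivative G (at p) w) = 2 * exp (u p) * (v \<bullet> w)"
    if "p \<in> D" for p v w using conf[OF that, of v w] by (simp add: metric_def)
  show "has_induced_metric D f u"
    unfolding has_induced_metric_def using induced_metric_eq[OF D _ hl Q] met by auto
  show "lagrangian_on D f"
    unfolding lagrangian_on_def using induced_Kaehler_form_eq[OF D _ hl Q] conf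
    by (auto simp: metric_def herm_simps)
  show "minimal_on D f"
    unfolding minimal_on_def
  proof
    fix p assume p: "p \<in> D"
    obtain k t where "flat_laplacian G p = k *s G p + t *s cnj_vec (G p)" using lap[OF p] by blast
    \<comment> \<open>A Laplacian in the span of \<open>G p\<close> and its conjugate projects to
      zero, so it is tangent with \<open>r = s = 0\<close>.\<close>
    moreover have "projQ (G p) (k *s G p + t *s cnj_vec (G p)) = 0"
      using GG[OF p] Q[OF p] bil_commute[of "cnj_vec (G p)" "G p"]
      by (simp add: projQ_def herm_def bil.add_left bil_cnj_vec vec_eq_iff)
    ultimately have "\<exists>r s. projQ (G p) (flat_laplacian G p) =
        r *\<^sub>R frechet_derivative G (at p) 1 + s *\<^sub>R frechet_derivative G (at p) \<i>"
      by (intro exI[of _ 0]) simp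
    moreover have "0 < 2 * exp (u p)" by simp
    ultimately show "mean_curvature f p = 0"
      unfolding flat_laplacian_def by (simp only: mean_curvature_eq_0_iff[OF D p hl Q[OF p] met[OF p]])
  qed
  show "immersion_on D f"
    unfolding immersion_on_def
  proof
    show "smooth_into_CP3 D f"
      unfolding f_def by (rule smooth_into_CP3_cline[OF D CG]) (use GG in \<open>force simp: herm_def bil.zero_left\<close>)
    show "\<forall>p\<in>D. inj (hdiff (lift_at f p) p)"
    proof
      fix p assume p: "p \<in> D"
      obtain c where c: "cmod c = 1" "\<And>v. hdiff (lift_at f p) p v = c *s frechet_derivative G (at p) v"
        by (rule lift_quantities[OF D p hl Q[OF p]]) blast
      show "inj (hdiff (lift_at f p) p)"
      proof (rule injI)
        fix v w assume "hdiff (lift_at f p) p v = hdiff (lift_at f p) p w"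
        moreover have "c \<noteq> 0" using c(1) by auto
        ultimately have "frechet_derivative G (at p) v = frechet_derivative G (at p) w"
          by (simp only: c(2) vector_mul_lcancel simp_thms)
        then have "frechet_derivative G (at p) (v - w) = 0"
          using has_derivative_linear[OF Cinf_on_has_derivative[OF CG p]] by (simp add: linear_diff)
        then have "2 * exp (u p) * ((v - w) \<bullet> (v - w)) = 0"
          using met[OF p, of "v - w" "v - w"] by (simp add: metric_def herm_def bil.zero_left)
        then show "v = w" by simp
      qed
    qed
  qed
qed

section \<open>Assembly of the family from the normalized lift\<close>

theorem theorem1p6:
  fixes D :: "complex set" and Q :: "(complex^4) set set"
    and f :: "complex \<Rightarrow> (complex^4) set"
    and u :: "complex \<Rightarrow> real" and \<alpha> :: "complex \<Rightarrow> complex"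
  assumes "is_Q2star Q"
    and "open D" and "D \<noteq> {}" and "simply_connected D"
    and "minimal_lagrangian_immersion D Q f"
    and "has_induced_metric D f u"
    and "has_quadratic_differential D f \<alpha>"
  shows "\<exists>fam :: complex \<Rightarrow> complex \<Rightarrow> (complex^4) set.
    \<forall>\<mu>\<in>sphere 0 1.
      minimal_lagrangian_immersion D Q (fam \<mu>) \<and>
      has_induced_metric D (fam \<mu>) u \<and>
      has_quadratic_differential D (fam \<mu>) (\<lambda>z. \<mu> powi (-2) * \<alpha> z)"
proof -
  have dom: "open D" "D \<noteq> {}" "simply_connected D" and fQ: "f ` D \<subseteq> Q"
    and lag: "lagrangian_on D f" and min: "minimal_on D f"
    using assms by (auto simp: minimal_lagrangian_immersion_def)
  obtain F \<phi> where F: "horizontal_lift D f F" and \<beta>: "\<And>p. p \<in> D \<Longrightarrow> beta F p = cis \<phi> * of_real (cmod (beta F p))"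
    and \<alpha>: "\<And>p. p \<in> D \<Longrightarrow> \<alpha> p = alpha (\<lambda>p. cis (- \<phi> / 2) *s F p) p"
    using assms(7) unfolding has_quadratic_differential_def normalized_horizontal_lift_def by blast
  \<comment> \<open>The lift is normalized before it is deformed. As the deformation preserves
    \<open>beta\<close>, the new lift then has nonnegative \<open>beta\<close> too and no phase has
    to be carried along.\<close>
  define H where "H p = cis (- \<phi> / 2) *s F p" for p
  have H: "horizontal_lift D f H"
    unfolding H_def by (rule horizontal_lift_smult[OF dom(1) F]) simp
  have CF: "Cinf_on D F" using F by (simp add: horizontal_lift_iff)
  have \<beta>H: "beta H p = of_real (cmod (beta H p))" if p: "p \<in> D" for p
  proof -
    have "beta H p = (cis (- \<phi> / 2))\<^sup>2 * (cis \<phi> * of_real (cmod (beta F p)))"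
      unfolding H_def beta_smult[OF CF p] using \<beta>[OF p] by simp
    also have "\<dots> = of_real (cmod (beta F p))"
      by (simp add: power2_eq_square cis_mult flip: mult.assoc)
    finally show ?thesis by simp
  qed
  have fH: "cline (H p) = f p" if "p \<in> D" for p
    using H that by (simp add: horizontal_lift_iff)
  have QH: "bil (H p) (H p) = 0" if "p \<in> D" for p
    using is_Q2star_bil[OF assms(1), of "H p"] fQ fH[OF that] that by auto
  have mlH: "minimal_lagrangian_lift D H (\<lambda>p. 2 * exp (u p))"
    by (rule minimal_lagrangian_liftI[OF dom(1) H QH lag min assms(6)])
  have "\<exists>g. minimal_lagrangian_immersion D Q g \<and> has_induced_metric D g u \<and>
      has_quadratic_differential D g (\<lambda>z. \<mu> powi (-2) * \<alpha> z)" if "\<mu> \<in> sphere 0 1" for \<mu>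
  proof -
    have \<mu>: "cmod \<mu> = 1" using that by simp
    interpret family: associated_family D H "\<lambda>p. 2 * exp (u p)" \<mu>
      by (rule associated_family.intro[OF dom(1) mlH \<mu>])
    obtain G p0 where p0: "p0 \<in> D" "G p0 = H p0" and G: "minimal_lagrangian_lift D G (\<lambda>p. 2 * exp (u p))"
      and \<alpha>G: "\<And>p. p \<in> D \<Longrightarrow> alpha G p = (cnj \<mu>)\<^sup>2 * alpha H p" and \<beta>G: "\<And>p. p \<in> D \<Longrightarrow> beta G p = beta H p"
      by (rule family.deformed_lift[OF dom(3,2)]) blast
    define g where "g p = cline (G p)" for p
    note g = minimal_lagrangian_liftD[OF dom(1) G, folded g_def[abs_def]]
    have "g ` D \<subseteq> Q"
      unfolding g_def
    proof (rule cline_image_in_component[OF assms(1) simply_connected_imp_connected[OF dom(3)]])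
      show "continuous_on D G"
        using G by (auto simp: minimal_lagrangian_lift_def Cinf_on_def dest: spec[of _ 0])
      show "cline (G p0) \<in> Q" using p0 fH fQ by auto
    qed (use G p0 in \<open>auto simp: minimal_lagrangian_lift_def\<close>)
    then have "minimal_lagrangian_immersion D Q g"
      using g by (simp add: minimal_lagrangian_immersion_def)
    moreover have "normalized_horizontal_lift D g G"
      unfolding normalized_horizontal_lift_def
      \<comment> \<open>\<open>G\<close> is already normalized, so its phase is \<open>0\<close>.
        This also covers the case in which \<open>beta\<close> vanishes.\<close>
      by (rule exI[of _ G], rule exI[of _ 0]) (use g(1) \<beta>G \<beta>H in \<open>simp add: fun_eq_iff\<close>)
    moreover have "\<mu> powi (-2) = (cnj \<mu>)\<^sup>2"
    proof -
      have "inverse \<mu> = cnj \<mu>" using unit_mult_cnj(1)[OF \<mu>] by (rule inverse_unique)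
      then show ?thesis by (simp add: power_int_minus power_inverse[symmetric])
    qed
    then have "\<mu> powi (-2) * \<alpha> p = alpha G p" if "p \<in> D" for p
      using \<alpha>[OF that] \<alpha>G[OF that] by (simp add: H_def[abs_def])
    ultimately show ?thesis
      using g(5) unfolding has_quadratic_differential_def by blast
  qed
  then show ?thesis by (intro bchoice ballI)
qed

end
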